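(* Let $\Omega\subset\mathbb{R}^2$ be a bounded domain with $C^3$ boundary, $D=(-1,1)\times\Omega$, $\Gamma=[-1,1]\times\partial\Omega$, $\Sigma_{\pm1}=\{\pm1\}\times\Omega$. Fix $\gamma\ge1$, $b_0$ (with $1+(\gamma-1)b_0>0$ if $\gamma>1$), a constant $u^-$ with $c_*<u^-<\sqrt{2(b_0+\frac{1}{\gamma-1})}$ (for $\gamma=1$ the upper bound is $+\infty$), and a constant $c_1\in(0,c_* )$. Consider the problem $$\nabla\cdot\big(\rho(|\nabla\varphi|^2)\nabla\varphi\big)=0\ \text{in } D,\qquad \varphi=-u^-,\ \partial_{x_1}\varphi=u^-\ \text{on }\Sigma_{-1},\qquad |\nabla\varphi|=c_1\ \text{on }\Sigma_1,\qquad \nabla\varphi\cdot n=0\ \text{on }\Gamma,$$ where $n$ is the outward unit normal on $\Gamma$. Consider transonic shock solutions (as defined in the context) which in addition satisfy $\partial_{x_1}\varphi\ge0$ on $\Sigma_{-1}$ and on $\Sigma_1$. Then the problem admits a transonic shock solution if and only if $c_1=u^+$, where $u^+\in(0,c_* )$ is the constant determined by $u^-,b_0,\gamma$ as in the context. Moreover, in that case the solution is unique modulo translation: every such transonic shock solution equals $$\varphi_t(x_1,x_2,x_3)=\begin{cases}u^-x_1,& -1\le x_1<t,\\ u^+(x_1-t)+u^-t,& x_1>t,\end{cases}$$ for some $t\in(-1,1)$.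
   Context: The density is given by the Bernoulli law: $\rho(|\nabla\varphi|^2)=\big(1+(\gamma-1)(b_0-\tfrac12|\nabla\varphi|^2)\big)^{1/(\gamma-1)}$ for $\gamma>1$, and $\rho(|\nabla\varphi|^2)=e^{b_0-\frac12|\nabla\varphi|^2}$ for $\gamma=1$. The critical speed is $c_*=\sqrt{\frac{2}{\gamma+1}(1+(\gamma-1)b_0)}$ for $\gamma>1$ and $c_*=1$ for $\gamma=1$; a flow is subsonic where $|\nabla\varphi|<c_*$ and supersonic where $|\nabla\varphi|>c_*$. The constant $u^+$ is the unique number in $(0,c_* )$ with $\rho((u^+)^2)u^+=\rho((u^-)^2)u^-$. Transonic shock solution: for a $C^1$ function $f$ on $\bar\Omega$ let $S=\{(f(x_2,x_3),x_2,x_3)\in D:(x_2,x_3)\in\Omega\}$, $D^-=\{x\in D:x_1<f(x_2,x_3)\}$, $D^+=\{x\in D:x_1>f(x_2,x_3)\}$. A function $\varphi\in C^{0,1}(D)\cap C^2(D^-\cup D^+)$ is a transonic shock solution if it is supersonic in $D^-$ and subsonic in $D^+$, satisfies the equation in $D^-\cup D^+$ and the boundary conditions pointwise, satisfies the Rankine–Hugoniot condition $\rho(|\nabla\varphi^+|^2)\nabla\varphi^+\cdot\nu=\rho(|\nabla\varphi^-|^2)\nabla\varphi^-\cdot\nu$ on $S$ and the entropy condition $|\nabla\varphi^+|<|\nabla\varphi^-|$ on $S$, where $\nu$ is a normal vector to $S$ and $\varphi^\pm$ are the limits of $\varphi$ on $S$ from $D^\pm$. *)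

theory Defs
  imports "HOL-Analysis.Analysis"
begin

type_synonym pt3 = "real \<times> real \<times> real"
type_synonym pt2 = "real \<times> real"

text \<open>Density (Bernoulli law), as a function of q = |grad phi|^2.\<close>
definition rho :: "real \<Rightarrow> real \<Rightarrow> real \<Rightarrow> real" where
  "rho \<gamma> b0 q = (if \<gamma> = 1 then exp (b0 - q / 2)
                  else (1 + (\<gamma> - 1) * (b0 - q / 2)) powr (1 / (\<gamma> - 1)))"

definition c_star :: "real \<Rightarrow> real \<Rightarrow> real" where
  "c_star \<gamma> b0 = (if \<gamma> = 1 then 1 else sqrt (2 / (\<gamma> + 1) * (1 + (\<gamma> - 1) * b0)))"

definition u_plus :: "real \<Rightarrow> real \<Rightarrow> real \<Rightarrow> real" where
  "u_plus \<gamma> b0 um = (THE u. 0 < u \<and> u < c_star \<gamma> b0 \<and>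
       rho \<gamma> b0 (u\<^sup>2) * u = rho \<gamma> b0 (um\<^sup>2) * um)"

definition grad :: "('a::euclidean_space \<Rightarrow> real) \<Rightarrow> 'a \<Rightarrow> 'a" where
  "grad \<phi> x = (\<Sum>b\<in>Basis. frechet_derivative \<phi> (at x) b *\<^sub>R b)"

definition divg :: "('a::euclidean_space \<Rightarrow> 'a) \<Rightarrow> 'a \<Rightarrow> real" where
  "divg F x = (\<Sum>b\<in>Basis. frechet_derivative F (at x) b \<bullet> b)"

definition C2_on :: "'a::euclidean_space set \<Rightarrow> ('a \<Rightarrow> real) \<Rightarrow> bool" where
  "C2_on U \<phi> = ((\<forall>x\<in>U. \<phi> differentiable (at x) \<and> grad \<phi> differentiable (at x)) \<and>
      (\<forall>b\<in>Basis. continuous_on U (\<lambda>x. frechet_derivative (grad \<phi>) (at x) b)))"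

definition C1_on_closure :: "pt2 set \<Rightarrow> (pt2 \<Rightarrow> real) \<Rightarrow> bool" where
  "C1_on_closure \<Omega> f = (\<exists>Df. continuous_on (closure \<Omega>) Df \<and>
      (\<forall>y\<in>closure \<Omega>. (f has_derivative (\<lambda>h. Df y \<bullet> h)) (at y within closure \<Omega>)))"

definition C3_fun :: "(real \<Rightarrow> real) \<Rightarrow> bool" where
  "C3_fun h = ((\<forall>k<3. \<forall>x. (deriv ^^ k) h field_differentiable (at x)) \<and>
      continuous_on UNIV ((deriv ^^ 3) h))"

definition local_graph_rep :: "pt2 set \<Rightarrow> pt2 \<Rightarrow> real \<Rightarrow> pt2 \<Rightarrow> pt2 \<Rightarrow> (real \<Rightarrow> real) \<Rightarrow> bool" where
  "local_graph_rep \<Omega> p r e n h = (r > 0 \<and> norm e = 1 \<and> norm n = 1 \<and> e \<bullet> n = 0 \<and> h 0 = 0 \<and>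
      \<Omega> \<inter> ball p r = {x \<in> ball p r. (x - p) \<bullet> n < h ((x - p) \<bullet> e)})"

definition C3_boundary :: "pt2 set \<Rightarrow> bool" where
  "C3_boundary \<Omega> = (\<forall>p\<in>frontier \<Omega>. \<exists>r e n h. local_graph_rep \<Omega> p r e n h \<and> C3_fun h)"

definition bounded_domain :: "pt2 set \<Rightarrow> bool" where
  "bounded_domain \<Omega> = (open \<Omega> \<and> connected \<Omega> \<and> bounded \<Omega> \<and> \<Omega> \<noteq> {})"

definition outward_unit_normal :: "pt2 set \<Rightarrow> pt2 \<Rightarrow> pt2 \<Rightarrow> bool" where
  "outward_unit_normal \<Omega> p \<nu> = (\<exists>r e n h. local_graph_rep \<Omega> p r e n h \<and> h differentiable (at 0) \<and>
      \<nu> = (1 / sqrt (1 + (deriv h 0)\<^sup>2)) *\<^sub>R (n - deriv h 0 *\<^sub>R e))"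

definition cyl :: "pt2 set \<Rightarrow> pt3 set" where
  "cyl \<Omega> = {x. -1 < fst x \<and> fst x < 1 \<and> snd x \<in> \<Omega>}"

definition wall :: "pt2 set \<Rightarrow> pt3 set" where
  "wall \<Omega> = {x. -1 \<le> fst x \<and> fst x \<le> 1 \<and> snd x \<in> frontier \<Omega>}"

definition sigma :: "real \<Rightarrow> pt2 set \<Rightarrow> pt3 set" where
  "sigma a \<Omega> = {x. fst x = a \<and> snd x \<in> \<Omega>}"

definition Dminus :: "pt2 set \<Rightarrow> (pt2 \<Rightarrow> real) \<Rightarrow> pt3 set" where
  "Dminus \<Omega> f = {x \<in> cyl \<Omega>. fst x < f (snd x)}"

definition Dplus :: "pt2 set \<Rightarrow> (pt2 \<Rightarrow> real) \<Rightarrow> pt3 set" where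
  "Dplus \<Omega> f = {x \<in> cyl \<Omega>. fst x > f (snd x)}"

definition side_grad :: "(pt3 \<Rightarrow> real) \<Rightarrow> pt3 set \<Rightarrow> pt3 \<Rightarrow> pt3 \<Rightarrow> bool" where
  "side_grad \<phi> A q g = ((grad \<phi> \<longlongrightarrow> g) (at q within A))"

definition transonic_shock_solution ::
  "real \<Rightarrow> real \<Rightarrow> real \<Rightarrow> real \<Rightarrow> pt2 set \<Rightarrow> (pt2 \<Rightarrow> real) \<Rightarrow> (pt3 \<Rightarrow> real) \<Rightarrow> bool" where
  "transonic_shock_solution \<gamma> b0 um c1 \<Omega> f \<phi> = (
     let Dm = Dminus \<Omega> f; Dp = Dplus \<Omega> f;
         F = (\<lambda>z. rho \<gamma> b0 ((norm (grad \<phi> z))\<^sup>2) *\<^sub>R grad \<phi> z) in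
     C1_on_closure \<Omega> f \<and>
     (\<exists>L. L-lipschitz_on (cyl \<Omega>) \<phi>) \<and>
     C2_on (Dm \<union> Dp) \<phi> \<and>
     (\<gamma> > 1 \<longrightarrow> (\<forall>x\<in>Dm \<union> Dp. 1 + (\<gamma> - 1) * (b0 - (norm (grad \<phi> x))\<^sup>2 / 2) > 0)) \<and>
     (\<forall>x\<in>Dm. norm (grad \<phi> x) > c_star \<gamma> b0) \<and>
     (\<forall>x\<in>Dp. norm (grad \<phi> x) < c_star \<gamma> b0) \<and>
     (\<forall>x\<in>Dm \<union> Dp. F differentiable (at x) \<and> divg F x = 0) \<and>
     (\<forall>q\<in>sigma (-1) \<Omega>. (\<phi> \<longlongrightarrow> - um) (at q within cyl \<Omega>)) \<and>
     (\<forall>q\<in>sigma (-1) \<Omega>. \<forall>A\<in>{Dm, Dp}. q \<in> closure A \<longrightarrow>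
         (\<exists>g. side_grad \<phi> A q g \<and> fst g = um \<and> fst g \<ge> 0)) \<and>
     (\<forall>q\<in>sigma 1 \<Omega>. \<forall>A\<in>{Dm, Dp}. q \<in> closure A \<longrightarrow>
         (\<exists>g. side_grad \<phi> A q g \<and> norm g = c1 \<and> fst g \<ge> 0)) \<and>
     (\<forall>q\<in>wall \<Omega>. \<forall>A\<in>{Dm, Dp}. q \<in> closure A \<longrightarrow>
         (\<exists>g. side_grad \<phi> A q g \<and>
              (\<forall>\<nu>. outward_unit_normal \<Omega> (snd q) \<nu> \<longrightarrow> g \<bullet> (0, \<nu>) = 0))) \<and>
     (\<forall>y\<in>\<Omega>. -1 < f y \<and> f y < 1 \<longrightarrow>
         (\<exists>gm gp. side_grad \<phi> Dm (f y, y) gm \<and> side_grad \<phi> Dp (f y, y) gp \<and>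
            (let \<nu> = (1, - grad f y) :: pt3 in
              rho \<gamma> b0 ((norm gp)\<^sup>2) * (gp \<bullet> \<nu>) = rho \<gamma> b0 ((norm gm)\<^sup>2) * (gm \<bullet> \<nu>)) \<and>
            norm gp < norm gm)))"

definition phi_t :: "real \<Rightarrow> real \<Rightarrow> real \<Rightarrow> pt3 \<Rightarrow> real" where
  "phi_t um up t x = (if fst x < t then um * fst x else up * (fst x - t) + um * t)"

end

theory Submission
  imports Defs
begin

text \<open>
  Upstream, \<open>x1\<close>-momentum is conserved: \<open>E = (\<partial>\<^sub>1\<phi> - u\<^sup>-) \<rho> \<nabla>\<phi> + (p - p\<^sup>-) e\<^sub>1\<close> is divergence free, where
  \<open>p' = - \<rho> / 2\<close>. It vanishes to second order at the incoming state, and near that state its flux is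
  strictly negative across every surface that is spacelike for the incoming flow. The jump condition
  together with the change of type forces the shock to be spacelike, so integrating \<open>div (\<eta> E)\<close> with a
  weight \<open>\<eta>\<close> decreasing in \<open>x1\<close> gives \<open>\<nabla>\<phi> = u\<^sup>- e\<^sub>1\<close> in a slab, and then, by continuation, up to the shock.

  Downstream, let \<open>w = \<phi> - u\<^sup>+ x1\<close> and \<open>F = \<rho> \<nabla>\<phi>\<close>. The jump condition says that \<open>F - m\<^sub>0 e\<^sub>1\<close>, with
  \<open>m\<^sub>0 = \<rho>(u\<^sup>+) u\<^sup>+\<close>, has no flux through the shock or the wall, and \<open>F\<close> is strictly monotone in \<open>\<nabla>\<phi>\<close> in
  the subsonic range. Testing with \<open>((k - w)\<^sup>+)\<^sup>2\<close> shows that \<open>w\<close> attains its minimum on the outlet; there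
  \<open>\<nabla>\<phi> = c\<^sub>1 e\<^sub>1\<close>, whence \<open>c\<^sub>1 \<le> u\<^sup>+\<close>. Then \<open>F\<^sub>1 \<le> m\<^sub>0\<close> on the outlet, and testing with \<open>w - min w \<ge> 0\<close>
  gives \<open>\<nabla>w = 0\<close>. Finally, continuity of \<open>\<phi>\<close> across the shock makes the shock flat.
\<close>

section \<open>A divergence inequality for compactly supported cutoffs\<close>

text \<open>At the boundary the gradient has only pointwise one-sided limits, the duct has edges,
  and along the wall the shock may run into the inlet or the outlet. Every integral argument
  therefore rests on an inequality that asks only for limits of a field and their signs against the
  normals; at an edge the signs of the adjacent faces hold together.

  Upstream, a speed above \<open>c_star\<close> does not make \<open>x1\<close> a timelike
  direction, since the velocity may point sideways. Hyperbolicity in \<open>x1\<close> is known only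
  near the incoming state, hence the smallness condition in the energy step and the continuation
  from the inlet, where the two conditions amount to full Cauchy data. The field \<open>E\<close> is
  the \<open>x1\<close> row of the momentum tensor, corrected by a multiple of the mass flux and a
  constant so that its flux has no terms of order zero and one at the incoming state.

  Downstream, the outlet condition prescribes only the length of the gradient. Its direction is
  recovered at one point, a minimum of \<open>w\<close> on the outlet, where tangential derivatives
  vanish; the sign condition on the outlet then selects \<open>c1\<close> instead of
  \<open>-c1\<close>.\<close>

definition C1_grad :: "'a::euclidean_space set \<Rightarrow> ('a \<Rightarrow> real) \<Rightarrow> ('a \<Rightarrow> 'a) \<Rightarrow> bool" where
  "C1_grad A u g \<longleftrightarrow> (\<forall>x\<in>A. GDERIV u x :> g x) \<and> continuous_on A g"

text \<open>Derivatives are taken component by component and \<open>d\<close> is fixed on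
  \<open>A\<close> only, so a divergence found by the product rule can be exchanged for any function
  that equals it on \<open>A\<close>.\<close>

definition C1_div :: "'a::euclidean_space set \<Rightarrow> ('a \<Rightarrow> 'a) \<Rightarrow> ('a \<Rightarrow> real) \<Rightarrow> bool" where
  "C1_div A V d \<longleftrightarrow> (\<exists>D. (\<forall>b\<in>Basis. C1_grad A (\<lambda>x. V x \<bullet> b) (D b)) \<and>
     (\<forall>x\<in>A. d x = (\<Sum>b\<in>Basis. D b x \<bullet> b)))"

lemma GDERIV_unique: "GDERIV f x :> a \<Longrightarrow> GDERIV f x :> b \<Longrightarrow> a = b"
  unfolding gderiv_def by (drule (1) has_derivative_unique) (metis inner_commute vector_eq_rdot)

lemma GDERIV_isCont: "GDERIV f x :> a \<Longrightarrow> isCont f x"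
  unfolding gderiv_def by (rule has_derivative_continuous)

lemma GDERIV_transform_open:
  assumes "GDERIV f x :> a" "open S" "x \<in> S" "\<And>y. y \<in> S \<Longrightarrow> f y = g y"
  shows "GDERIV g x :> a"
  using assms unfolding gderiv_def by (metis has_derivative_transform_within_open)

lemma C1_grad_continuous: "C1_grad A u g \<Longrightarrow> continuous_on A u"
  unfolding C1_grad_def by (metis GDERIV_isCont continuous_at_imp_continuous_on)

lemma C1_grad_mult:
  assumes "C1_grad A u g" "C1_grad A v h"
  shows "C1_grad A (\<lambda>x. u x * v x) (\<lambda>x. u x *\<^sub>R h x + v x *\<^sub>R g x)"
  using assms C1_grad_continuous[OF assms(1)] C1_grad_continuous[OF assms(2)]
  unfolding C1_grad_def by (auto intro!: GDERIV_mult continuous_intros)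

lemma C1_div_continuous: "C1_div A V d \<Longrightarrow> continuous_on A d"
  unfolding C1_div_def C1_grad_def
  by (auto intro!: continuous_intros cong: continuous_on_cong)

lemma C1_div_continuous_field:
  assumes "C1_div A V d" shows "continuous_on A V"
proof -
  have "continuous_on A (\<lambda>x. \<Sum>b\<in>Basis. (V x \<bullet> b) *\<^sub>R b)"
    using assms unfolding C1_div_def by (auto intro!: continuous_intros C1_grad_continuous)
  then show ?thesis by (simp add: euclidean_representation)
qed

lemma C1_div_scale:
  assumes u: "C1_grad A u g" and V: "C1_div A V d"
  shows "C1_div A (\<lambda>x. u x *\<^sub>R V x) (\<lambda>x. u x * d x + V x \<bullet> g x)"
proof -
  obtain D where D: "\<And>b. b \<in> Basis \<Longrightarrow> C1_grad A (\<lambda>x. V x \<bullet> b) (D b)"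
    and d: "\<And>x. x \<in> A \<Longrightarrow> d x = (\<Sum>b\<in>Basis. D b x \<bullet> b)"
    using V unfolding C1_div_def by blast
  have "u x * d x + V x \<bullet> g x =
      (\<Sum>b\<in>Basis. (u x *\<^sub>R D b x + (V x \<bullet> b) *\<^sub>R g x) \<bullet> b)" if "x \<in> A" for x
    using d[OF that] euclidean_inner[of "V x" "g x"]
    by (simp add: inner_add_left sum.distrib sum_distrib_left)
  moreover have "C1_grad A (\<lambda>x. u x *\<^sub>R V x \<bullet> b) (\<lambda>x. u x *\<^sub>R D b x + (V x \<bullet> b) *\<^sub>R g x)" if "b \<in> Basis" for b
    using C1_grad_mult[OF u D[OF that]] by simp
  ultimately show ?thesis
    unfolding C1_div_def by (intro exI[of _ "\<lambda>b x. u x *\<^sub>R D b x + (V x \<bullet> b) *\<^sub>R g x"]) auto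
qed

lemma C1_div_add:
  assumes "C1_div A V d" "C1_div A W e"
  shows "C1_div A (\<lambda>x. V x + W x) (\<lambda>x. d x + e x)"
proof -
  obtain D where D: "\<And>b. b \<in> Basis \<Longrightarrow> C1_grad A (\<lambda>x. V x \<bullet> b) (D b)"
    and d: "\<And>x. x \<in> A \<Longrightarrow> d x = (\<Sum>b\<in>Basis. D b x \<bullet> b)"
    using assms(1) unfolding C1_div_def by blast
  obtain E where E: "\<And>b. b \<in> Basis \<Longrightarrow> C1_grad A (\<lambda>x. W x \<bullet> b) (E b)"
    and e: "\<And>x. x \<in> A \<Longrightarrow> e x = (\<Sum>b\<in>Basis. E b x \<bullet> b)"
    using assms(2) unfolding C1_div_def by blast
  have "C1_grad A (\<lambda>x. (V x + W x) \<bullet> b) (\<lambda>x. D b x + E b x)" if "b \<in> Basis" for b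
    using D[OF that] E[OF that] unfolding C1_grad_def inner_add_left
    by (auto intro!: GDERIV_add continuous_on_add)
  then show ?thesis
    unfolding C1_div_def
    by (intro exI[of _ "\<lambda>b x. D b x + E b x"]) (auto simp: d e inner_add_left sum.distrib)
qed

lemma C1_div_const: "C1_div A (\<lambda>x. c) (\<lambda>x. 0)"
  unfolding C1_div_def C1_grad_def
  by (intro exI[of _ "\<lambda>b x. 0"]) (auto intro!: GDERIV_const)

lemma C1_div_cong:
  assumes "C1_div A V d" "\<And>x. x \<in> A \<Longrightarrow> d x = e x"
  shows "C1_div A V e"
  using assms unfolding C1_div_def by metis

text \<open>Outside the region that supports \<open>V\<close>, the cutoffs used later need not tend
  to 1. There \<open>V\<close> vanishes on an open set, and its derivatives vanish with it.\<close>

lemma C1_div_zero_interior: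
  assumes "C1_div A V d" "open A" "open S" "\<And>x. x \<in> A \<inter> S \<Longrightarrow> V x = 0" "x \<in> A \<inter> S"
  shows "d x = 0"
proof -
  obtain D where D: "\<And>b. b \<in> Basis \<Longrightarrow> C1_grad A (\<lambda>x. V x \<bullet> b) (D b)"
    and d: "d x = (\<Sum>b\<in>Basis. D b x \<bullet> b)"
    using assms(1,5) unfolding C1_div_def by blast
  have "D b x = 0" if "b \<in> Basis" for b
  proof -
    have "GDERIV (\<lambda>x. V x \<bullet> b) x :> D b x" using D[OF that] assms(5) by (auto simp: C1_grad_def)
    moreover have "GDERIV (\<lambda>x. V x \<bullet> b) x :> 0"
      by (rule GDERIV_transform_open[OF GDERIV_const[where k = 0], of "A \<inter> S"]) (use assms in auto)
    ultimately show ?thesis by (rule GDERIV_unique)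
  qed
  then show ?thesis by (simp add: d)
qed

section \<open>Integrals of compactly supported divergences\<close>

lemma integrable_continuous_compact_support:
  fixes g :: "'a::euclidean_space \<Rightarrow> real"
  assumes "compact K" "continuous_on UNIV g" "\<And>x. x \<notin> K \<Longrightarrow> g x = 0"
  shows "integrable lborel g"
proof -
  have "integrable lborel (\<lambda>x. indicator K x *\<^sub>R g x)"
    using assms by (intro borel_integrable_compact) (auto intro: continuous_on_subset)
  moreover have "(\<lambda>x. indicator K x *\<^sub>R g x) = g"
    using assms(3) by (intro ext) (auto simp: indicator_def)
  ultimately show ?thesis by simp
qed

lemma integral_translation:
  fixes U :: "'a::euclidean_space \<Rightarrow> real"
  assumes "U \<in> borel_measurable borel"
  shows "(LINT x|lborel. U (a + x)) = (LINT x|lborel. U x)"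
proof -
  have "(LINT x|distr lborel borel ((+) a). U x) = (LINT x|lborel. U (a + x))"
    using assms by (subst integral_distr) auto
  then show ?thesis by (simp add: lborel_distr_plus)
qed

text \<open>Translation invariance makes the integral of every difference quotient vanish.\<close>
lemma integral_directional_derivative:
  fixes U :: "'a::euclidean_space \<Rightarrow> real"
  assumes K: "compact K" "\<And>x. x \<notin> K \<Longrightarrow> U x = 0"
    and U: "\<And>x. GDERIV U x :> g x" and g: "continuous_on UNIV g"
  shows "integrable lborel (\<lambda>x. g x \<bullet> v)" "(LINT x|lborel. g x \<bullet> v) = 0"
proof -
  have g0: "g x = 0" if "x \<notin> K" for x
  proof -
    have "GDERIV U x :> 0"
      by (rule GDERIV_transform_open[OF GDERIV_const[where k = 0], of "- K"])
        (use that K compact_imp_closed in auto)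
    then show ?thesis using U GDERIV_unique by blast
  qed
  show int: "integrable lborel (\<lambda>x. g x \<bullet> v)"
    by (rule integrable_continuous_compact_support[OF K(1)]) (auto intro!: continuous_intros g simp: g0)
  have contU: "continuous_on UNIV U"
    using U GDERIV_isCont continuous_at_imp_continuous_on by blast
  have "bounded (g ` K)"
    using K(1) g by (intro compact_imp_bounded compact_continuous_image) (auto intro: continuous_on_subset)
  then obtain B where "\<And>x. x \<in> K \<Longrightarrow> norm (g x) \<le> B"
    unfolding bounded_iff by blast
  then have B: "norm (g x) \<le> \<bar>B\<bar>" for x
    using g0[of x] by (cases "x \<in> K") force+
  have lip: "\<bar>U y - U x\<bar> \<le> \<bar>B\<bar> * norm (y - x)" for x y
  proof -
    have "norm (U y - U x) \<le> \<bar>B\<bar> * norm (y - x)"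
    proof (rule differentiable_bound[of UNIV])
      fix z :: 'a
      show "(U has_derivative (\<lambda>h. h \<bullet> g z)) (at z within UNIV)" using U[of z] by (simp add: gderiv_def)
      show "onorm (\<lambda>h. h \<bullet> g z) \<le> \<bar>B\<bar>"
      proof (rule onorm_le)
        fix h show "norm (h \<bullet> g z) \<le> \<bar>B\<bar> * norm h"
          using Cauchy_Schwarz_ineq2[of h "g z"] mult_right_mono[OF B[of z], of "norm h"]
          by (simp add: mult.commute)
      qed
    qed auto
    then show ?thesis by simp
  qed
  define t where "t n = 1 / real (Suc n)" for n
  have t: "0 < t n" "t n \<le> 1" for n by (auto simp: t_def)
  define q where "q n x = (U (t n *\<^sub>R v + x) - U x) / t n" for n x
  obtain R where R: "\<And>x. x \<in> K \<Longrightarrow> norm x \<le> R"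
    using compact_imp_bounded[OF K(1)] unfolding bounded_iff by blast
  \<comment> \<open>As \<open>t n\<close> is at most 1, translation moves the support by at most
    \<open>norm v\<close>. All the quotients vanish off the fixed ball \<open>C\<close>, which
    yields an integrable bound.\<close>
  define C where "C = cball (0::'a) (R + norm v)"
  have Kout: "x \<notin> K \<and> t n *\<^sub>R v + x \<notin> K" if "x \<notin> C" for x n
  proof -
    have "norm (t n *\<^sub>R v) \<le> norm v" using t[of n] by (simp add: mult_left_le_one_le)
    moreover have "norm x > R + norm v" using that by (simp add: C_def)
    moreover have "norm x \<le> norm (t n *\<^sub>R v + x) + norm (t n *\<^sub>R v)"
  by (metis add_diff_cancel_left' norm_triangle_ineq4)
    ultimately show ?thesis using R[of x] R[of "t n *\<^sub>R v + x"] norm_ge_zero[of v] by linarith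
  qed
  have contq: "continuous_on UNIV (q n)" for n
    unfolding q_def using t[of n]
    by (auto intro!: continuous_intros contU continuous_on_compose2[OF contU])
  have intU: "integrable lborel U"
    using integrable_continuous_compact_support[OF K(1) contU K(2)] .
  have zero: "(LINT x|lborel. q n x) = 0" for n
  proof -
    have "integrable lborel (\<lambda>x. U (t n *\<^sub>R v + x))"
      by (rule integrable_continuous_compact_support[of C])
        (use Kout K(2) in \<open>auto simp: C_def intro!: continuous_on_compose2[OF contU] continuous_intros\<close>)
    then show ?thesis
      using integral_translation[of U "t n *\<^sub>R v"] intU borel_measurable_continuous_onI[OF contU]
      by (simp add: q_def)
  qed
  have "(\<lambda>n. LINT x|lborel. q n x) \<longlonglongrightarrow> (LINT x|lborel. g x \<bullet> v)"
  proof (rule integral_dominated_convergence[where w = "\<lambda>x. indicator C x * (\<bar>B\<bar> * norm v)"])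
    show "(\<lambda>x. g x \<bullet> v) \<in> borel_measurable lborel" using int by auto
    show "q n \<in> borel_measurable lborel" for n
      using borel_measurable_continuous_onI[OF contq] by simp
    have "integrable lborel (\<lambda>x. indicator C x *\<^sub>R (\<bar>B\<bar> * norm v))"
      by (rule borel_integrable_compact) (auto simp: C_def)
    then show "integrable lborel (\<lambda>x. indicator C x * (\<bar>B\<bar> * norm v))" by simp
    show "AE x in lborel. (\<lambda>n. q n x) \<longlonglongrightarrow> g x \<bullet> v"
    proof (rule AE_I2)
      fix x
      have "((\<lambda>s. U (s *\<^sub>R v + x)) has_derivative (\<lambda>s. s *\<^sub>R v \<bullet> g x)) (at 0)"
        by (rule has_derivative_compose[where g = U and f = "\<lambda>s. s *\<^sub>R v + x"])
          (use U[of x] in \<open>auto intro!: derivative_eq_intros simp: gderiv_def\<close>)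
      then have "((\<lambda>s. U (s *\<^sub>R v + x)) has_field_derivative (g x \<bullet> v)) (at 0)"
        by (simp add: has_field_derivative_def inner_commute mult.commute[of _ "g x \<bullet> v"] mult_commute_abs)
      then have "((\<lambda>s. (U (s *\<^sub>R v + x) - U x) / s) \<longlongrightarrow> g x \<bullet> v) (at 0)"
        by (simp add: DERIV_def)
      moreover have "filterlim t (at 0) sequentially"
        unfolding t_def
        by (intro filterlim_atI LIMSEQ_inverse_real_of_nat[unfolded inverse_eq_divide]) auto
      ultimately show "(\<lambda>n. q n x) \<longlonglongrightarrow> g x \<bullet> v"
        unfolding q_def by (rule filterlim_compose)
    qed
    show "AE x in lborel. norm (q n x) \<le> indicator C x * (\<bar>B\<bar> * norm v)" for n
    proof (rule AE_I2)
      fix x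
      show "norm (q n x) \<le> indicator C x * (\<bar>B\<bar> * norm v)"
      proof (cases "x \<in> C")
        case True
        then show ?thesis using lip[of "t n *\<^sub>R v + x" x] t[of n]
          by (simp add: q_def field_simps)
      next
        case False
        then show ?thesis using Kout[OF False, of n] K(2) by (simp add: q_def)
      qed
    qed
  qed
  then show "(LINT x|lborel. g x \<bullet> v) = 0"
    using zero by (simp add: LIMSEQ_const_iff)
qed

text \<open>Extension by zero stays C1 because the open sets \<open>A\<close> and \<open>- K\<close>
  cover the space; each partial derivative then integrates to zero.\<close>

lemma integral_div_compact_support:
  fixes V :: "'a::euclidean_space \<Rightarrow> 'a"
  assumes A: "open A" and V: "C1_div A V d" and K: "compact K" "K \<subseteq> A"
    and V0: "\<And>x. x \<in> A - K \<Longrightarrow> V x = 0"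
  shows "set_integrable lborel A d" "(LINT x:A|lborel. d x) = 0"
proof -
  obtain D where D: "\<And>b. b \<in> Basis \<Longrightarrow> C1_grad A (\<lambda>x. V x \<bullet> b) (D b)"
    and d: "\<And>x. x \<in> A \<Longrightarrow> d x = (\<Sum>b\<in>Basis. D b x \<bullet> b)"
    using V unfolding C1_div_def by blast
  define E where "E b x = (if x \<in> A then D b x else 0)" for b x
  define U where "U b x = (if x \<in> A then V x \<bullet> b else 0)" for b x
  have cK: "open (- K)" using K(1) compact_imp_closed by auto
  have UG: "GDERIV (U b) x :> E b x" if b: "b \<in> Basis" for b x
  proof (cases "x \<in> A")
    case True
    then have "GDERIV (\<lambda>x. V x \<bullet> b) x :> E b x"
      using D[OF b] by (simp add: C1_grad_def E_def)
    then show ?thesis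
      by (rule GDERIV_transform_open[OF _ A True]) (simp add: U_def)
  next
    case False
    then have "E b x = 0" by (simp add: E_def)
    moreover have "GDERIV (U b) x :> 0"
      by (rule GDERIV_transform_open[OF GDERIV_const[where k = 0] cK])
        (use False K(2) V0 in \<open>auto simp: U_def\<close>)
    ultimately show ?thesis by simp
  qed
  have E0: "E b x = 0" if b: "b \<in> Basis" "x \<notin> K" for b x
  proof -
    have "GDERIV (U b) x :> 0"
      by (rule GDERIV_transform_open[OF GDERIV_const[where k = 0] cK])
        (use that K(2) V0 in \<open>auto simp: U_def\<close>)
    then show ?thesis using UG[OF b(1)] GDERIV_unique by blast
  qed
  have contE: "continuous_on UNIV (E b)" if b: "b \<in> Basis" for b
  proof -
    have "continuous_on A (E b)"
      using D[OF b] by (auto simp: C1_grad_def E_def cong: continuous_on_cong)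
    moreover have "continuous_on (- K) (E b)"
      using E0[OF b] by (subst continuous_on_cong[OF refl, of _ _ "\<lambda>_. 0"]) auto
    ultimately have "continuous_on (A \<union> - K) (E b)"
      using A cK by (rule continuous_on_open_Un[rotated 2])
    moreover have "A \<union> - K = UNIV" using K(2) by auto
    ultimately show ?thesis by simp
  qed
  have *: "integrable lborel (\<lambda>x. E b x \<bullet> b)" "(LINT x|lborel. E b x \<bullet> b) = 0" if "b \<in> Basis" for b
  proof -
    have "U b x = 0" if "x \<notin> K" for x using that V0 by (auto simp: U_def)
    from integral_directional_derivative[OF K(1) this UG[OF that] contE[OF that]]
    show "integrable lborel (\<lambda>x. E b x \<bullet> b)" "(LINT x|lborel. E b x \<bullet> b) = 0" by auto
  qed
  have eq: "(\<lambda>x. indicator A x *\<^sub>R d x) = (\<lambda>x. \<Sum>b\<in>Basis. E b x \<bullet> b)"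
    by (rule ext) (auto simp: indicator_def E_def d)
  show "set_integrable lborel A d"
    unfolding set_integrable_def eq using * by auto
  show "(LINT x:A|lborel. d x) = 0"
    unfolding set_lebesgue_integral_def eq using * by (simp add: Bochner_Integration.integral_sum)
qed

section \<open>A continuously differentiable cutoff\<close>

text \<open>Squaring makes the positive part C1. The same function serves the ramp, the partition of
  unity, the weight upstream and the truncation downstream.\<close>

definition pos2 :: "real \<Rightarrow> real" where "pos2 s = (max 0 s)\<^sup>2"

lemma pos2_nonneg [simp]: "0 \<le> pos2 s" by (simp add: pos2_def)

lemma DERIV_pos2: "(pos2 has_real_derivative 2 * max 0 s) (at s)"
proof -
  consider "s < 0" | "s > 0" | "s = 0" by linarith
  then show ?thesis
  proof cases
    case 1
    have "((\<lambda>_. 0) has_real_derivative 0) (at s)" by simp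
    then have "(pos2 has_real_derivative 0) (at s)"
      by (rule has_field_derivative_transform_within_open[of _ _ _ "{..<0}"])
        (use 1 in \<open>auto simp: pos2_def\<close>)
    then show ?thesis using 1 by simp
  next
    case 2
    have "((\<lambda>x. x\<^sup>2) has_real_derivative 2 * s) (at s)" by (auto intro!: derivative_eq_intros)
    then have "(pos2 has_real_derivative 2 * s) (at s)"
      by (rule has_field_derivative_transform_within_open[of _ _ _ "{0<..}"])
        (use 2 in \<open>auto simp: pos2_def\<close>)
    then show ?thesis using 2 by simp
  next
    case 3
    have "\<bar>pos2 h / h\<bar> \<le> \<bar>h\<bar>" for h :: real
      by (cases "h \<le> 0") (auto simp: pos2_def power2_eq_square)
    then have "(\<lambda>h. pos2 h / h) \<midarrow>0\<rightarrow> 0"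
      by (intro Lim_null_comparison[where g = "\<lambda>h::real. \<bar>h\<bar>", OF _ tendsto_rabs_zero[OF tendsto_ident_at]]
          always_eventually) simp
    then show ?thesis using 3 by (simp add: DERIV_def pos2_def)
  qed
qed

lemma continuous_on_pos2 [continuous_intros]:
  "continuous_on S f \<Longrightarrow> continuous_on S (\<lambda>x. pos2 (f x))"
  unfolding pos2_def by (intro continuous_intros)

text \<open>The derivative \<open>ramp'\<close> is the tent over the interval from 1 to 2 with
  height 2, hence area 1; a second difference of \<open>pos2\<close> is the simplest C1 transition
  from 0 to 1.\<close>

definition ramp :: "real \<Rightarrow> real" where
  "ramp s = 2 * pos2 (s - 1) - 4 * pos2 (s - 3/2) + 2 * pos2 (s - 2)"

definition ramp' :: "real \<Rightarrow> real" where
  "ramp' s = 4 * max 0 (s - 1) - 8 * max 0 (s - 3/2) + 4 * max 0 (s - 2)"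

lemma DERIV_ramp: "(ramp has_real_derivative ramp' s) (at s)"
proof -
  have *: "((\<lambda>s. pos2 (s - c)) has_real_derivative 2 * max 0 (s - c)) (at s)" for c
    by (rule DERIV_cong[OF DERIV_chain2[OF DERIV_pos2, of "\<lambda>s. s - c" 1]])
      (auto intro!: derivative_eq_intros)
  show ?thesis
    unfolding ramp_def ramp'_def by (rule derivative_eq_intros * refl | simp)+
qed

lemma ramp_eq_0: "s \<le> 1 \<Longrightarrow> ramp s = 0"
  by (simp add: ramp_def pos2_def)

lemma ramp_eq_1: "2 \<le> s \<Longrightarrow> ramp s = 1"
  by (simp add: ramp_def pos2_def power2_eq_square algebra_simps)

lemma ramp'_bounds: "0 \<le> ramp' s" "ramp' s \<le> 2"
  by (auto simp: ramp'_def max_def)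

lemma ramp'_eq_0: "s \<le> 1 \<or> 2 \<le> s \<Longrightarrow> ramp' s = 0"
  by (auto simp: ramp'_def max_def)

lemma ramp_mono: "a \<le> b \<Longrightarrow> ramp a \<le> ramp b"
  using DERIV_nonneg_imp_nondecreasing[of a b ramp] DERIV_ramp ramp'_bounds by blast

lemma ramp_bounds: "0 \<le> ramp s" "ramp s \<le> 1"
  using ramp_mono[of "min s 1" s] ramp_mono[of s "max s 2"] ramp_eq_0[of "min s 1"] ramp_eq_1[of "max s 2"]
  by auto

lemma continuous_on_ramp' [continuous_intros]:
  "continuous_on S f \<Longrightarrow> continuous_on S (\<lambda>x. ramp' (f x))"
  unfolding ramp'_def by (intro continuous_intros)

lemma C1_grad_compose:
  assumes "C1_grad A u g" "\<And>x. x \<in> A \<Longrightarrow> (\<theta> has_real_derivative \<theta>' (u x)) (at (u x))"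
    "continuous_on (u ` A) \<theta>'"
  shows "C1_grad A (\<lambda>x. \<theta> (u x)) (\<lambda>x. \<theta>' (u x) *\<^sub>R g x)"
  unfolding C1_grad_def
proof
  show "\<forall>x\<in>A. GDERIV (\<lambda>x. \<theta> (u x)) x :> \<theta>' (u x) *\<^sub>R g x"
    using assms(1,2) unfolding C1_grad_def by (blast intro: GDERIV_DERIV_compose)
  show "continuous_on A (\<lambda>x. \<theta>' (u x) *\<^sub>R g x)"
    using assms C1_grad_continuous[OF assms(1)] unfolding C1_grad_def
    by (intro continuous_on_scaleR continuous_on_compose2[OF assms(3)]) auto
qed

lemma C1_grad_prod:
  assumes "finite I" "\<And>i. i \<in> I \<Longrightarrow> C1_grad A (u i) (du i)"
  shows "C1_grad A (\<lambda>x. \<Prod>i\<in>I. u i x) (\<lambda>x. \<Sum>i\<in>I. (\<Prod>j\<in>I - {i}. u j x) *\<^sub>R du i x)"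
  unfolding C1_grad_def
proof
  show "\<forall>x\<in>A. GDERIV (\<lambda>x. \<Prod>i\<in>I. u i x) x :> (\<Sum>i\<in>I. (\<Prod>j\<in>I - {i}. u j x) *\<^sub>R du i x)"
  proof
    fix x assume "x \<in> A"
    then have "\<And>i. i \<in> I \<Longrightarrow> (u i has_derivative (\<lambda>h. h \<bullet> du i x)) (at x)"
      using assms(2) unfolding C1_grad_def gderiv_def by blast
    from has_derivative_prod[of I u "\<lambda>i h. h \<bullet> du i x", OF this]
    show "GDERIV (\<lambda>x. \<Prod>i\<in>I. u i x) x :> (\<Sum>i\<in>I. (\<Prod>j\<in>I - {i}. u j x) *\<^sub>R du i x)"
      by (simp add: gderiv_def inner_sum_right mult.commute)
  qed
  show "continuous_on A (\<lambda>x. \<Sum>i\<in>I. (\<Prod>j\<in>I - {i}. u j x) *\<^sub>R du i x)"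
    using assms C1_grad_continuous[OF assms(2)]
    by (intro continuous_on_sum continuous_on_scaleR continuous_on_prod) (auto simp: C1_grad_def)
qed

text \<open>The translates of \<open>L\<close> by multiples of \<open>2 \<delta> v\<close> are disjoint and about \<open>1 / \<delta>\<close> of them fit into a
  fixed ball.\<close>
lemma layer_measure_le:
  fixes L :: "'a::euclidean_space set"
  assumes L: "L \<in> sets borel" "L \<subseteq> cball 0 R" and \<delta>: "0 < \<delta>" and v: "norm v \<le> 1"
    and tr: "\<And>x \<tau>. x \<in> L \<Longrightarrow> x + \<tau> *\<^sub>R v \<in> L \<Longrightarrow> \<bar>\<tau>\<bar> \<le> \<delta>"
  shows "measure lborel L \<le> measure lborel (cball (0::'a) (R + 2)) * \<delta>"
proof -
  \<comment> \<open>For \<open>j < N\<close> one has \<open>j < 1 / \<delta>\<close>, so no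
    translate is shifted by more than 2. This is the origin of the radius
    \<open>R + 2\<close>.\<close>
  define N where "N = nat \<lceil>1 / \<delta>\<rceil>"
  have N: "1 / \<delta> \<le> real N" "real N < 1 / \<delta> + 1"
    using \<delta> by (auto simp: N_def) linarith
  define T where "T j = (+) ((2 * real j * \<delta>) *\<^sub>R v) ` L" for j :: nat
  have bd: "bounded (cball (0::'a) (R + 2))" by simp
  have Tsets: "T j \<in> sets lborel" for j
  proof -
    have "T j = (\<lambda>x. x - (2 * real j * \<delta>) *\<^sub>R v) -` L \<inter> space borel"
      by (force simp: T_def algebra_simps)
    also have "\<dots> \<in> sets borel"
      by (rule measurable_sets[OF _ L(1)]) simp
    finally show ?thesis by simp
  qed
  have Tm: "measure lborel (T j) = measure lborel L" for j
    using measure_translation[of "(2 * real j * \<delta>) *\<^sub>R v" L] Tsets[of j] L(1) by (simp add: T_def)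
  have Tsub: "T j \<subseteq> cball 0 (R + 2)" if "j < N" for j
  proof
    fix z assume "z \<in> T j"
    then obtain x where x: "x \<in> L" "z = (2 * real j * \<delta>) *\<^sub>R v + x" by (auto simp: T_def)
    have "real j \<le> 1 / \<delta>" using that N(2) by linarith
    then have "2 * real j * \<delta> \<le> 2" using \<delta> by (simp add: field_simps)
    then have "norm ((2 * real j * \<delta>) *\<^sub>R v) \<le> 2 * 1"
      unfolding norm_scaleR using \<delta> v by (intro mult_mono) auto
    moreover have "norm x \<le> R" using x(1) L(2) by auto
    ultimately show "z \<in> cball 0 (R + 2)"
      using norm_triangle_ineq[of "(2 * real j * \<delta>) *\<^sub>R v" x] by (simp add: x(2))
  qed
  have disj: "disjoint_family_on T {..<N}"
    unfolding disjoint_family_on_def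
  proof (intro ballI impI equals0I)
    fix i j :: nat and z assume "i \<noteq> j" "z \<in> T i \<inter> T j"
    then obtain x y where xy: "x \<in> L" "y \<in> L" "z = (2 * real i * \<delta>) *\<^sub>R v + x" "z = (2 * real j * \<delta>) *\<^sub>R v + y"
      by (auto simp: T_def)
    then have "y = x + (2 * (real i - real j) * \<delta>) *\<^sub>R v" by (simp add: algebra_simps)
    then have "\<bar>2 * (real i - real j) * \<delta>\<bar> \<le> \<delta>" using tr[of x] xy(1,2) by metis
    then have "\<bar>real i - real j\<bar> \<le> 1/2" using \<delta> by (simp add: abs_mult)
    then show False using \<open>i \<noteq> j\<close> by linarith
  qed
  have fin: "emeasure lborel (T j) \<noteq> \<infinity>" if "j < N" for j
    using emeasure_bounded_finite[OF bounded_subset[OF bd Tsub[OF that]]] by auto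
  have "real N * measure lborel L = measure lborel (\<Union>j<N. T j)"
    by (subst measure_finite_Union) (use Tsets disj fin Tm in auto)
  also have "\<dots> \<le> measure lborel (cball (0::'a) (R + 2))"
    using Tsub emeasure_bounded_finite[OF bd]
    by (intro measure_mono_fmeasurable) (auto simp: fmeasurable_def intro!: sets.finite_UN Tsets[simplified])
  finally have "real N * measure lborel L \<le> measure lborel (cball (0::'a) (R + 2))" .
  moreover have "1 / \<delta> * measure lborel L \<le> real N * measure lborel L"
    using N by (intro mult_right_mono) auto
  ultimately have "1 / \<delta> * measure lborel L \<le> measure lborel (cball (0::'a) (R + 2))" by linarith
  then show ?thesis using \<delta> by (simp add: field_simps)
qed

section \<open>Uniform bounds and signs from pointwise boundary limits\<close>

lemma set_integrable_bounded_continuous: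
  fixes d :: "'a::euclidean_space \<Rightarrow> real"
  assumes "open A" "bounded A" "continuous_on A d" "bounded (d ` A)"
  shows "set_integrable lborel A d"
proof -
  obtain B where B: "\<And>x. x \<in> A \<Longrightarrow> \<bar>d x\<bar> \<le> B"
    using assms(4) by (auto simp: bounded_iff)
  have "integrable lborel (\<lambda>x. indicator A x * B)"
    using assms(1,2) emeasure_bounded_finite[of A] by (intro integrable_mult_left integrable_real_indicator) auto
  moreover have "(\<lambda>x. indicator A x *\<^sub>R d x) \<in> borel_measurable lborel"
    using borel_measurable_continuous_on_indicator[OF _ assms(3)] assms(1) by simp
  ultimately show ?thesis
    unfolding set_integrable_def
    by (rule Bochner_Integration.integrable_bound) (auto simp: indicator_def dest: B intro!: always_eventually)
qed

text \<open>Points where \<open>u\<close> blows up would accumulate in the compact closure, at a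
  point where \<open>u\<close> has a finite limit. Boundedness of the divergences in the later
  applications comes from here.\<close>

lemma bounded_image_if_limits:
  fixes u :: "'a::heine_borel \<Rightarrow> 'b::real_normed_vector"
  assumes "bounded A" "continuous_on A u"
    and lim: "\<And>q. q \<in> closure A - A \<Longrightarrow> \<exists>l. (u \<longlongrightarrow> l) (at q within A)"
  shows "bounded (u ` A)"
proof (rule ccontr)
  assume "\<not> ?thesis"
  then have "\<forall>n::nat. \<exists>x\<in>A. norm (u x) > real n"
    by (auto simp: bounded_iff not_le)
  then obtain x where x: "\<And>n. x n \<in> A" "\<And>n. norm (u (x n)) > real n" by metis
  have "bounded (range x)" using assms(1) x(1) by (meson bounded_subset image_subsetI)
  then obtain q r where r: "strict_mono r" "(x \<circ> r) \<longlonglongrightarrow> q"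
    using bounded_imp_convergent_subsequence by blast
  have "q \<in> closure A" using r(2) x(1) by (auto simp: closure_sequential intro!: exI[of _ "x \<circ> r"])
  have "\<exists>l. (u \<longlongrightarrow> l) (at q within A) \<and> (q \<in> A \<longrightarrow> l = u q)"
  proof (cases "q \<in> A")
    case True then show ?thesis using assms(2) by (auto simp: continuous_on_def)
  next
    case False then show ?thesis using lim \<open>q \<in> closure A\<close> by blast
  qed
  then obtain l where l: "(u \<longlongrightarrow> l) (at q within A)" "q \<in> A \<Longrightarrow> l = u q" by blast
  have "\<forall>\<^sub>F y in at q within A. norm (u y) < norm l + 1"
    using tendsto_norm[OF l(1)] by (rule order_tendstoD) simp
  then have "\<forall>\<^sub>F y in nhds q. y \<in> A \<longrightarrow> norm (u y) < norm l + 1"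
    unfolding eventually_at_filter using l(2) by (auto elim!: eventually_mono)
  then have "\<forall>\<^sub>F n in sequentially. norm (u ((x \<circ> r) n)) < norm l + 1"
    by (rule eventually_mono[OF eventually_compose_filterlim[OF _ r(2)]]) (use x(1) in auto)
  moreover have "\<forall>\<^sub>F n in sequentially. norm l + 1 < real n"
    using filterlim_real_sequentially unfolding filterlim_at_top_dense by blast
  ultimately have "\<forall>\<^sub>F n in sequentially. False"
  proof eventually_elim
    case (elim n)
    have "real n \<le> real (r n)" using seq_suble[OF r(1)] by simp
    then show False using x(2)[of "r n"] elim by simp
  qed
  then show False by simp
qed

text \<open>Points with small \<open>g\<close> and \<open>u < - \<epsilon>\<close> accumulate at
  some \<open>q\<close> in \<open>K\<close>. Positivity of \<open>g\<close> excludes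
  \<open>q\<close> from \<open>A\<close>; at a boundary point the limit of \<open>g\<close> is at
  most 0, so the sign alternative forces the limit of \<open>u\<close> to be nonnegative.\<close>

lemma boundary_sign_uniform:
  fixes g u :: "'a::heine_borel \<Rightarrow> real"
  assumes "bounded A" "closed K" "continuous_on A g" "\<And>x. x \<in> A \<inter> K \<Longrightarrow> 0 < g x"
    and lim: "\<And>q. q \<in> closure A \<inter> K - A \<Longrightarrow> \<exists>a m. (g \<longlongrightarrow> a) (at q within A) \<and>
       (u \<longlongrightarrow> m) (at q within A) \<and> (0 < a \<or> 0 \<le> m)"
    and \<epsilon>: "0 < \<epsilon>"
  shows "\<exists>\<delta>>0. \<forall>x\<in>A \<inter> K. g x \<le> \<delta> \<longrightarrow> - \<epsilon> \<le> u x"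
proof (rule ccontr)
  assume neg: "\<not> ?thesis"
  have "\<exists>x\<in>A \<inter> K. g x \<le> 1 / real (Suc n) \<and> u x < - \<epsilon>" for n
    using neg[simplified, rule_format, of "1 / real (Suc n)"] by (auto simp: not_le)
  then obtain x where x: "\<And>n. x n \<in> A \<inter> K" "\<And>n. g (x n) \<le> 1 / real (Suc n)" "\<And>n. u (x n) < - \<epsilon>"
    by metis
  have "bounded (range x)" using assms(1) x(1) by (meson bounded_subset image_subsetI IntD1)
  then obtain q r where r: "strict_mono r" "(x \<circ> r) \<longlonglongrightarrow> q"
    using bounded_imp_convergent_subsequence by blast
  have qA: "q \<in> closure A" using r(2) x(1) by (auto simp: closure_sequential intro!: exI[of _ "x \<circ> r"])
  have qK: "q \<in> K" using closed_sequentially[OF assms(2) _ r(2)] x(1) by auto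
  have t: "(\<lambda>n. 1 / real (Suc (r n))) \<longlonglongrightarrow> 0"
    using LIMSEQ_subseq_LIMSEQ[OF LIMSEQ_inverse_real_of_nat r(1)] by (simp add: o_def inverse_eq_divide)
  have lim0: "a \<le> 0" if "(\<lambda>n. g ((x \<circ> r) n)) \<longlonglongrightarrow> a" for a
    by (rule LIMSEQ_le[OF that t]) (use x(2) in auto)
  show False
  proof (cases "q \<in> A")
    case True
    have "(\<lambda>n. g ((x \<circ> r) n)) \<longlonglongrightarrow> g q"
      using continuous_on_tendsto_compose[OF assms(3) r(2) True] x(1) by auto
    then show False using lim0 assms(4)[of q] True qK by force
  next
    case False
    then obtain a m where am: "(g \<longlongrightarrow> a) (at q within A)" "(u \<longlongrightarrow> m) (at q within A)" "0 < a \<or> 0 \<le> m"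
      using lim qA qK by blast
    have f: "filterlim (x \<circ> r) (at q within A) sequentially"
      unfolding filterlim_at using r(2) x(1) False by (auto intro!: always_eventually)
    have "a \<le> 0" using lim0 filterlim_compose[OF am(1) f] by simp
    moreover have "m \<le> - \<epsilon>"
      using filterlim_compose[OF am(2) f] by (rule LIMSEQ_le_const2) (use x(3) in \<open>auto intro: less_imp_le\<close>)
    ultimately show False using am(3) \<epsilon> by linarith
  qed
qed

lemma sets_borel_layer:
  fixes g :: "'a::euclidean_space \<Rightarrow> real"
  assumes "open A" "closed K" "continuous_on A g"
  shows "{x \<in> A \<inter> K. a \<le> g x \<and> g x \<le> b} \<in> sets borel"
proof -
  have "closedin (top_of_set A) (A \<inter> g -` {a..b})"
    by (rule continuous_closedin_preimage[OF assms(3)]) simp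
  then obtain T where "closed T" "A \<inter> g -` {a..b} = A \<inter> T"
    by (auto simp: closedin_closed)
  moreover have "{x \<in> A \<inter> K. a \<le> g x \<and> g x \<le> b} = (A \<inter> g -` {a..b}) \<inter> K" by auto
  ultimately show ?thesis using assms(1,2) by (simp add: sets.Int)
qed

text \<open>Multiplying \<open>V\<close> by cutoffs that vanish where some \<open>g i\<close> is at most \<open>\<delta>\<close> makes the
  support compact; the price is paid on layers of measure \<open>O(\<delta>)\<close>, where the gradient of
  the cutoff is \<open>O(1/\<delta>)\<close> times \<open>\<gamma> i\<close>.\<close>
lemma cutoff_divergence_nonpos:
  fixes V :: "'a::euclidean_space \<Rightarrow> 'a"
  assumes A: "open A" "bounded A" and V: "C1_div A V d" and d: "bounded (d ` A)"
    and K: "closed K" and V0: "\<And>x. x \<in> A - K \<Longrightarrow> V x = 0" and I: "finite I"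
    and g: "\<And>i. i \<in> I \<Longrightarrow> C1_grad A (g i) (\<gamma> i)"
    and pos: "\<And>i x. i \<in> I \<Longrightarrow> x \<in> A \<inter> K \<Longrightarrow> 0 < g i x"
    and cl: "\<And>\<delta>. 0 < \<delta> \<Longrightarrow> closed {x \<in> A \<inter> K. \<forall>i\<in>I. \<delta> \<le> g i x}"
    and sgn: "\<And>i \<epsilon>. i \<in> I \<Longrightarrow> 0 < \<epsilon> \<Longrightarrow> \<exists>\<delta>>0. \<forall>x\<in>A \<inter> K. g i x \<le> \<delta> \<longrightarrow> - \<epsilon> \<le> V x \<bullet> \<gamma> i x"
    and tr: "\<And>i. i \<in> I \<Longrightarrow> \<exists>v. norm v \<le> 1 \<and>
      (\<forall>x \<tau>. x \<in> A \<inter> K \<longrightarrow> x + \<tau> *\<^sub>R v \<in> A \<inter> K \<longrightarrow> g i (x + \<tau> *\<^sub>R v) = g i x + \<tau>)"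
  shows "(LINT x:A|lborel. d x) \<le> 0"
proof -
  obtain R where R: "A \<subseteq> cball 0 R" using A(2) bounded_subset_ballD[of A 0] by (meson ball_subset_cball order_trans)
  define C where "C = measure lborel (cball (0::'a) (R + 2))"
  define L where "L i \<delta> = {x \<in> A \<inter> K. \<delta> \<le> g i x \<and> g i x \<le> 2 * \<delta>}" for i \<delta>
  have gc: "continuous_on A (g i)" if "i \<in> I" for i using C1_grad_continuous[OF g[OF that]] .
  have Lsets: "L i \<delta> \<in> sets borel" if "i \<in> I" for i \<delta>
    unfolding L_def by (rule sets_borel_layer[OF A(1) K gc[OF that]])
  have Lm: "measure lborel (L i \<delta>) \<le> C * \<delta>" if i: "i \<in> I" and "0 < \<delta>" for i \<delta>
  proof -
    obtain v where v: "norm v \<le> 1" "\<And>x \<tau>. x \<in> A \<inter> K \<Longrightarrow> x + \<tau> *\<^sub>R v \<in> A \<inter> K \<Longrightarrow> g i (x + \<tau> *\<^sub>R v) = g i x + \<tau>"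
      using tr[OF i] by blast
    show ?thesis
      unfolding C_def
    proof (rule layer_measure_le[OF Lsets[OF i] _ that(2) v(1)])
      show "L i \<delta> \<subseteq> cball 0 R" using R by (auto simp: L_def)
      show "\<bar>\<tau>\<bar> \<le> \<delta>" if "x \<in> L i \<delta>" "x + \<tau> *\<^sub>R v \<in> L i \<delta>" for x \<tau>
        using that v(2)[of x \<tau>] by (auto simp: L_def)
    qed
  qed
  define z where "z \<delta> x = (\<Prod>i\<in>I. ramp (g i x / \<delta>))" for \<delta> x
  define P where "P \<delta> i x = (\<Prod>j\<in>I - {i}. ramp (g j x / \<delta>))" for \<delta> i x
  define Z where "Z \<delta> x = (\<Sum>i\<in>I. P \<delta> i x *\<^sub>R ((ramp' (g i x / \<delta>) * (1 / \<delta>)) *\<^sub>R \<gamma> i x))" for \<delta> x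
  have z01: "0 \<le> z \<delta> x" "z \<delta> x \<le> 1" for \<delta> x
    unfolding z_def by (auto intro!: prod_nonneg prod_le_1 simp: ramp_bounds)
  have P01: "0 \<le> P \<delta> i x" "P \<delta> i x \<le> 1" for \<delta> i x
    unfolding P_def by (auto intro!: prod_nonneg prod_le_1 simp: ramp_bounds)
  have zC: "C1_grad A (z \<delta>) (Z \<delta>)" if "0 < \<delta>" for \<delta>
  proof -
    have "C1_grad A (\<lambda>x. ramp (g i x / \<delta>)) (\<lambda>x. (ramp' (g i x / \<delta>) * (1 / \<delta>)) *\<^sub>R \<gamma> i x)" if "i \<in> I" for i
    proof (rule C1_grad_compose[OF g[OF that], where \<theta> = "\<lambda>s. ramp (s / \<delta>)" and \<theta>' = "\<lambda>s. ramp' (s / \<delta>) * (1 / \<delta>)"])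
      show "((\<lambda>s. ramp (s / \<delta>)) has_real_derivative ramp' (g i x / \<delta>) * (1 / \<delta>)) (at (g i x))" for x
        using \<open>0 < \<delta>\<close> by (intro DERIV_chain2[OF DERIV_ramp]) (auto intro!: derivative_eq_intros)
      show "continuous_on (g i ` A) (\<lambda>s. ramp' (s / \<delta>) * (1 / \<delta>))"
        using \<open>0 < \<delta>\<close> by (intro continuous_intros) auto
    qed
    from C1_grad_prod[OF I this] show ?thesis unfolding z_def Z_def P_def .
  qed
  have dc: "continuous_on A d" using C1_div_continuous[OF V] .
  obtain B where B: "\<And>x. x \<in> A \<Longrightarrow> \<bar>d x\<bar> \<le> B" using d by (auto simp: bounded_iff)
  have d_int: "set_integrable lborel A d"
    by (rule set_integrable_bounded_continuous[OF A dc d])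
  have zd_int: "set_integrable lborel A (\<lambda>x. z \<delta> x * d x)" if "0 < \<delta>" for \<delta>
  proof (rule set_integrable_bounded_continuous[OF A])
    show "continuous_on A (\<lambda>x. z \<delta> x * d x)"
      using C1_grad_continuous[OF zC[OF that]] dc by (rule continuous_on_mult)
    have "\<bar>z \<delta> x * d x\<bar> \<le> 1 * B" if "x \<in> A" for x
      unfolding abs_mult using z01[of \<delta> x] B[OF that] by (intro mult_mono) auto
    then show "bounded ((\<lambda>x. z \<delta> x * d x) ` A)" by (auto simp: bounded_iff)
  qed
  \<comment> \<open>The product of \<open>V\<close> and the cutoff is supported where every
    \<open>g i\<close> is at least \<open>\<delta>\<close>, so its divergence integrates to zero,
    and the term with the gradient of the cutoff is all that balances
    \<open>z \<delta> x * d x\<close>.\<close>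
  have zero: "set_integrable lborel A (\<lambda>x. V x \<bullet> Z \<delta> x)"
    "(LINT x:A|lborel. z \<delta> x * d x) = - (LINT x:A|lborel. V x \<bullet> Z \<delta> x)" if \<delta>: "0 < \<delta>" for \<delta>
  proof -
    define K' where "K' = {x \<in> A \<inter> K. \<forall>i\<in>I. \<delta> \<le> g i x}"
    have K': "compact K'" "K' \<subseteq> A"
      using cl[OF \<delta>] A(2) by (auto simp: K'_def compact_eq_bounded_closed intro: bounded_subset)
    have "z \<delta> x *\<^sub>R V x = 0" if x: "x \<in> A - K'" for x
    proof (cases "x \<in> K")
      case True
      then obtain i where "i \<in> I" "g i x < \<delta>" using x by (force simp: K'_def)
      then have "z \<delta> x = 0" unfolding z_def using \<delta> I
        by (intro prod_zero) (auto intro!: bexI[of _ i] ramp_eq_0)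
      then show ?thesis by simp
    next
      case False
      then show ?thesis using V0 x by simp
    qed
    from integral_div_compact_support[OF A(1) C1_div_scale[OF zC[OF \<delta>] V] K' this]
    have i: "set_integrable lborel A (\<lambda>x. z \<delta> x * d x + V x \<bullet> Z \<delta> x)"
      "(LINT x:A|lborel. z \<delta> x * d x + V x \<bullet> Z \<delta> x) = 0" by auto
    have "set_integrable lborel A (\<lambda>x. (z \<delta> x * d x + V x \<bullet> Z \<delta> x) - z \<delta> x * d x)"
      by (rule set_integral_diff(1)[OF i(1) zd_int[OF \<delta>]])
    then show i2: "set_integrable lborel A (\<lambda>x. V x \<bullet> Z \<delta> x)" by simp
    show "(LINT x:A|lborel. z \<delta> x * d x) = - (LINT x:A|lborel. V x \<bullet> Z \<delta> x)"
      using i(2) set_integral_add(2)[OF zd_int[OF \<delta>] i2] by simp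
  qed
  \<comment> \<open>The factor 2 bounds \<open>ramp'\<close>. A layer has measure at most
    \<open>C * \<delta>\<close> and the cutoff has slope of order \<open>1 / \<delta>\<close>, so
    the powers of \<open>\<delta>\<close> cancel and \<open>\<epsilon>\<close> remains.\<close>
  have upper: "(LINT x:A|lborel. d x) \<le> 2 * \<epsilon> * C * real (card I)" if \<epsilon>: "0 < \<epsilon>" for \<epsilon>
  proof -
    have "\<forall>i\<in>I. \<exists>\<delta>>0. \<forall>x\<in>A \<inter> K. g i x \<le> \<delta> \<longrightarrow> - \<epsilon> \<le> V x \<bullet> \<gamma> i x" using sgn \<epsilon> by blast
    then obtain \<delta>i where \<delta>i: "\<And>i. i \<in> I \<Longrightarrow> 0 < \<delta>i i"
      "\<And>i x. i \<in> I \<Longrightarrow> x \<in> A \<inter> K \<Longrightarrow> g i x \<le> \<delta>i i \<Longrightarrow> - \<epsilon> \<le> V x \<bullet> \<gamma> i x"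
      by metis
    \<comment> \<open>The inserted 1 keeps \<open>Min\<close> meaningful when \<open>I\<close> is
      empty.\<close>
    define \<delta>0 where "\<delta>0 = Min (insert 1 (\<delta>i ` I))"
    have \<delta>0: "0 < \<delta>0" "\<And>i. i \<in> I \<Longrightarrow> \<delta>0 \<le> \<delta>i i"
      using I \<delta>i(1) by (auto simp: \<delta>0_def)
    have key: "(LINT x:A|lborel. z \<delta> x * d x) \<le> 2 * \<epsilon> * C * real (card I)" if \<delta>: "0 < \<delta>" "2 * \<delta> \<le> \<delta>0" for \<delta>
    proof -
      \<comment> \<open>Only the layer between \<open>\<delta>\<close> and
        \<open>2 * \<delta>\<close> contributes, because \<open>ramp'\<close> vanishes elsewhere;
        \<open>2 * \<delta> \<le> \<delta>0\<close> places that layer where the sign estimate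
        holds.\<close>
      have low: "- (\<Sum>i\<in>I. 2 * \<epsilon> / \<delta> * indicator (L i \<delta>) x) \<le> V x \<bullet> Z \<delta> x" if x: "x \<in> A" for x
      proof (cases "x \<in> K")
        case False
        then have "V x = 0" using V0 x by simp
        then show ?thesis using \<epsilon> \<delta> by (auto intro!: sum_nonneg)
      next
        case True
        have "- (2 * \<epsilon> / \<delta> * indicator (L i \<delta>) x) \<le>
            P \<delta> i x * (ramp' (g i x / \<delta>) * (1 / \<delta>) * (V x \<bullet> \<gamma> i x))" if i: "i \<in> I" for i
        proof (cases "x \<in> L i \<delta>")
          case True
          then have "- \<epsilon> \<le> V x \<bullet> \<gamma> i x"
            using \<delta>i(2)[OF i, of x] \<delta>0(2)[OF i] \<delta>(2) by (auto simp: L_def)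
          then have "(P \<delta> i x * (ramp' (g i x / \<delta>) * (1 / \<delta>))) * (- \<epsilon>) \<le>
              (P \<delta> i x * (ramp' (g i x / \<delta>) * (1 / \<delta>))) * (V x \<bullet> \<gamma> i x)"
            using P01(1) ramp'_bounds(1) \<delta> by (intro mult_left_mono mult_nonneg_nonneg) auto
          moreover have "P \<delta> i x * (ramp' (g i x / \<delta>) * (1 / \<delta>)) \<le> 1 * (2 * (1 / \<delta>))"
            using P01 ramp'_bounds \<delta> by (intro mult_mono mult_nonneg_nonneg) auto
          then have "P \<delta> i x * (ramp' (g i x / \<delta>) * (1 / \<delta>)) * \<epsilon> \<le> 1 * (2 * (1 / \<delta>)) * \<epsilon>"
            using \<epsilon> by (intro mult_right_mono) auto
          ultimately show ?thesis using True by (simp add: mult.assoc)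
        next
          case False
          then have "g i x < \<delta> \<or> 2 * \<delta> < g i x" using x \<open>x \<in> K\<close> by (auto simp: L_def)
          then have "ramp' (g i x / \<delta>) = 0" using \<delta>(1) by (intro ramp'_eq_0) (auto simp: field_simps)
          then show ?thesis using False by simp
        qed
        then have "(\<Sum>i\<in>I. - (2 * \<epsilon> / \<delta> * indicator (L i \<delta>) x)) \<le>
            (\<Sum>i\<in>I. P \<delta> i x * (ramp' (g i x / \<delta>) * (1 / \<delta>) * (V x \<bullet> \<gamma> i x)))" by (rule sum_mono)
        then show ?thesis by (simp add: Z_def inner_sum_right sum_negf mult.assoc)
      qed
      have Lfin: "emeasure lborel (L i \<delta>) < \<infinity>" for i
        using A(2) by (intro emeasure_bounded_finite) (auto simp: L_def intro: bounded_subset)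
      have Lint: "integrable lborel (\<lambda>x. 2 * \<epsilon> / \<delta> * indicator (L i \<delta>) x)" if "i \<in> I" for i
        using Lfin[of i] Lsets[OF that] by (intro integrable_mult_right integrable_real_indicator) auto
      have "- (LINT x:A|lborel. V x \<bullet> Z \<delta> x) \<le> (LINT x|lborel. (\<Sum>i\<in>I. 2 * \<epsilon> / \<delta> * indicator (L i \<delta>) x))"
        unfolding set_lebesgue_integral_def Bochner_Integration.integral_minus[symmetric]
      proof (rule integral_mono)
        show "integrable lborel (\<lambda>x. - (indicator A x *\<^sub>R (V x \<bullet> Z \<delta> x)))"
          using zero(1)[OF \<delta>(1)] unfolding set_integrable_def by simp
        show "integrable lborel (\<lambda>x. (\<Sum>i\<in>I. 2 * \<epsilon> / \<delta> * indicator (L i \<delta>) x))"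
          using Lint by auto
        show "- (indicator A x *\<^sub>R (V x \<bullet> Z \<delta> x)) \<le> (\<Sum>i\<in>I. 2 * \<epsilon> / \<delta> * indicator (L i \<delta>) x)" for x
          using low[of x] \<epsilon> \<delta> by (cases "x \<in> A") (auto intro!: sum_nonneg)
      qed
      also have "\<dots> = (\<Sum>i\<in>I. 2 * \<epsilon> / \<delta> * measure lborel (L i \<delta>))"
        using Lint Lsets by (subst Bochner_Integration.integral_sum) auto
      also have "\<dots> \<le> (\<Sum>i\<in>I. 2 * \<epsilon> / \<delta> * (C * \<delta>))"
        using Lm \<delta> \<epsilon> by (intro sum_mono mult_left_mono) auto
      also have "\<dots> = 2 * \<epsilon> * C * real (card I)" using \<delta> by (simp add: field_simps)
      finally show ?thesis using zero(2)[OF \<delta>(1)] by simp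
    qed
    define \<delta> where "\<delta> n = \<delta>0 / 2 / real (Suc n)" for n
    have \<delta>: "0 < \<delta> n" "2 * \<delta> n \<le> \<delta>0" for n
      using \<delta>0(1) by (auto simp: \<delta>_def field_simps)
    have \<delta>lim: "\<delta> \<longlonglongrightarrow> 0"
      unfolding \<delta>_def using tendsto_mult_right_zero[OF LIMSEQ_inverse_real_of_nat, of "\<delta>0 / 2"]
      by (simp add: field_simps)
    have "(\<lambda>n. LINT x:A|lborel. z (\<delta> n) x * d x) \<longlonglongrightarrow> (LINT x:A|lborel. d x)"
      unfolding set_lebesgue_integral_def
    proof (rule integral_dominated_convergence[where w = "\<lambda>x. indicator A x *\<^sub>R B"])
      show "(\<lambda>x. indicator A x *\<^sub>R d x) \<in> borel_measurable lborel"
        using d_int unfolding set_integrable_def by (rule borel_measurable_integrable)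
      show "(\<lambda>x. indicator A x *\<^sub>R (z (\<delta> n) x * d x)) \<in> borel_measurable lborel" for n
        using zd_int[OF \<delta>(1)] unfolding set_integrable_def by (rule borel_measurable_integrable)
      show "integrable lborel (\<lambda>x. indicator A x *\<^sub>R B)"
        using set_integrable_bounded_continuous[OF A continuous_on_const[of A B]]
        unfolding set_integrable_def by (auto simp: bounded_iff)
      show "AE x in lborel. norm (indicator A x *\<^sub>R (z (\<delta> n) x * d x)) \<le> indicator A x *\<^sub>R B" for n
      proof (rule AE_I2)
        fix x
        have "\<bar>z (\<delta> n) x * d x\<bar> \<le> 1 * B" if "x \<in> A"
          unfolding abs_mult using z01[of "\<delta> n" x] B[OF that] by (intro mult_mono) auto
        then show "norm (indicator A x *\<^sub>R (z (\<delta> n) x * d x)) \<le> indicator A x *\<^sub>R B"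
          by (cases "x \<in> A") auto
      qed
      show "AE x in lborel. (\<lambda>n. indicator A x *\<^sub>R (z (\<delta> n) x * d x)) \<longlonglongrightarrow> indicator A x *\<^sub>R d x"
      proof (rule AE_I2)
        fix x
        show "(\<lambda>n. indicator A x *\<^sub>R (z (\<delta> n) x * d x)) \<longlonglongrightarrow> indicator A x *\<^sub>R d x"
        proof (cases "x \<in> A \<and> x \<in> K")
          case True
          have "\<forall>\<^sub>F n in sequentially. ramp (g i x / \<delta> n) = 1" if "i \<in> I" for i
          proof -
            have gp: "0 < g i x / 2" using pos[OF that, of x] True by simp
            have "\<forall>\<^sub>F n in sequentially. \<delta> n < g i x / 2" by (rule order_tendstoD(2)[OF \<delta>lim gp])
            then show ?thesis
            proof eventually_elim
              case (elim n)
              then show ?case using \<delta>(1)[of n] by (intro ramp_eq_1) (simp add: field_simps)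
            qed
          qed
          then have "\<forall>\<^sub>F n in sequentially. \<forall>i\<in>I. ramp (g i x / \<delta> n) = 1"
            using I by (simp add: eventually_ball_finite)
          then have "\<forall>\<^sub>F n in sequentially. indicator A x *\<^sub>R (z (\<delta> n) x * d x) = indicator A x *\<^sub>R d x"
            by eventually_elim (simp add: z_def)
          then show ?thesis by (rule tendsto_eventually)
        next
          case False
          \<comment> \<open>Off \<open>K\<close> the functions \<open>g i\<close> may be nonpositive
            and the cutoffs may stay away from 1; pointwise convergence is saved by the vanishing of
            \<open>d\<close>.\<close>
          have "d x = 0" if "x \<in> A"
            by (rule C1_div_zero_interior[OF V A(1), of "- K"]) (use that False K V0 in auto)
          then show ?thesis by (cases "x \<in> A") auto
        qed
      qed
    qed
    then show ?thesis
      by (rule LIMSEQ_le_const2) (use key \<delta> in blast)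
  qed
  show ?thesis
  proof (rule ccontr)
    assume neg: "\<not> ?thesis"
    \<comment> \<open>The integral is at most \<open>\<epsilon> * D\<close> for every positive
      \<open>\<epsilon>\<close>. A positive integral is refuted by the choice of
      \<open>\<epsilon>\<close> as that integral over \<open>2 * (D + 1)\<close>, where the added 1
      covers \<open>D = 0\<close>.\<close>
    define D where "D = 2 * C * real (card I)"
    have "0 \<le> D" by (simp add: D_def C_def)
    have "(LINT x:A|lborel. d x) \<le> (LINT x:A|lborel. d x) / (2 * (D + 1)) * D"
      using upper[of "(LINT x:A|lborel. d x) / (2 * (D + 1))"] neg \<open>0 \<le> D\<close> by (simp add: D_def mult.assoc mult.left_commute)
    also have "\<dots> < (LINT x:A|lborel. d x)"
      using neg \<open>0 \<le> D\<close> by (simp add: field_simps add_nonneg_pos)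
    finally show False by simp
  qed
qed

section \<open>The divergence inequality in a duct with a graph boundary\<close>

text \<open>The sign \<open>\<sigma>\<close> treats both sides of the shock at once:
  \<open>\<sigma> = 1\<close> is the part between the inlet and the graph,
  \<open>\<sigma> = -1\<close> the part between the graph and the outlet. The flat end always lies
  at \<open>x1 = - \<sigma>\<close>.\<close>

definition duct_part :: "real \<Rightarrow> pt2 set \<Rightarrow> (pt2 \<Rightarrow> real) \<Rightarrow> pt3 set" where
  "duct_part \<sigma> \<Omega> f = {x. snd x \<in> \<Omega> \<and> 0 < 1 + \<sigma> * fst x \<and> 0 < \<sigma> * (f (snd x) - fst x)}"

lemma GDERIV_snd:
  fixes u :: "'b::euclidean_space \<Rightarrow> real"
  assumes "GDERIV u (snd x) :> g"
  shows "GDERIV (\<lambda>x::'a::euclidean_space \<times> 'b. u (snd x)) x :> (0, g)"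
proof -
  have "(snd has_derivative snd) (at x)" by (rule has_derivative_snd[OF has_derivative_ident])
  from has_derivative_compose[OF this] assms
  have "((\<lambda>x. u (snd x)) has_derivative (\<lambda>h. snd h \<bullet> g)) (at x)" unfolding gderiv_def by blast
  then show ?thesis by (simp add: gderiv_def inner_prod_def)
qed

lemma GDERIV_fst: "GDERIV (fst :: pt3 \<Rightarrow> real) x :> (1, 0)"
proof -
  have "(fst has_derivative fst) (at x)" by (rule has_derivative_fst[OF has_derivative_ident])
  then show ?thesis by (simp add: gderiv_def inner_prod_def)
qed

lemma C1_grad_snd:
  fixes u :: "pt2 \<Rightarrow> real"
  assumes "C1_grad \<Omega> u g" "\<And>x. x \<in> A \<Longrightarrow> snd x \<in> \<Omega>"
  shows "C1_grad (A :: pt3 set) (\<lambda>x. u (snd x)) (\<lambda>x. (0, g (snd x)))"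
  using assms unfolding C1_grad_def
  by (auto intro!: GDERIV_snd continuous_on_Pair continuous_on_compose2[of \<Omega> g] continuous_on_snd continuous_on_id)

lemma GDERIV_closure_interior:
  fixes f :: "'a::euclidean_space \<Rightarrow> real"
  assumes "open \<Omega>" "y \<in> \<Omega>" "(f has_derivative (\<lambda>h. Df \<bullet> h)) (at y within closure \<Omega>)"
  shows "GDERIV f y :> Df"
proof -
  have "y \<in> interior (closure \<Omega>)"
    using interior_maximal[OF closure_subset assms(1)] assms(2) by blast
  then have "(f has_derivative (\<lambda>h. Df \<bullet> h)) (at y)" using assms(3) at_within_interior by metis
  moreover have "(\<lambda>h. Df \<bullet> h) = (\<lambda>h. h \<bullet> Df)" by (intro ext inner_commute)
  ultimately show ?thesis unfolding gderiv_def by (simp only:)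
qed

lemma closure_duct_part:
  assumes "continuous_on (closure \<Omega>) f" "q \<in> closure (duct_part \<sigma> \<Omega> f)"
  shows "snd q \<in> closure \<Omega>" "0 \<le> 1 + \<sigma> * fst q" "0 \<le> \<sigma> * (f (snd q) - fst q)"
proof -
  let ?C = "{x \<in> UNIV \<times> closure \<Omega>. 0 \<le> 1 + \<sigma> * fst x} \<inter> {x \<in> UNIV \<times> closure \<Omega>. 0 \<le> \<sigma> * (f (snd x) - fst x)}"
  have c: "continuous_on (UNIV \<times> closure \<Omega>) (\<lambda>x. f (snd x))"
    by (rule continuous_on_compose2[OF assms(1)]) (auto intro!: continuous_intros)
  have "closed ?C"
    by (intro closed_Int continuous_on_closed_Collect_le closed_Times) (auto intro!: continuous_intros c)
  moreover have "duct_part \<sigma> \<Omega> f \<subseteq> ?C"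
    by (auto simp: duct_part_def intro: closure_subset[THEN subsetD])
  ultimately have "closure (duct_part \<sigma> \<Omega> f) \<subseteq> ?C" by (rule closure_minimal[rotated])
  then show "snd q \<in> closure \<Omega>" "0 \<le> 1 + \<sigma> * fst q" "0 \<le> \<sigma> * (f (snd q) - fst q)" using assms(2) by auto
qed

lemma tendsto_snd_within_duct_part:
  assumes "continuous_on (closure \<Omega>) u" "q \<in> UNIV \<times> closure \<Omega>"
  shows "((\<lambda>x. u (snd x)) \<longlongrightarrow> u (snd q)) (at q within duct_part \<sigma> \<Omega> f)"
proof -
  have c: "continuous_on (UNIV \<times> closure \<Omega>) (\<lambda>x. u (snd x))"
    by (rule continuous_on_compose2[OF assms(1)]) (auto intro!: continuous_intros)
  then have "((\<lambda>x. u (snd x)) \<longlongrightarrow> u (snd q)) (at q within UNIV \<times> closure \<Omega>)"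
    using assms(2) unfolding continuous_on_def by blast
  then show ?thesis
    by (rule tendsto_within_subset) (auto simp: duct_part_def intro: closure_subset[THEN subsetD])
qed

lemma open_duct_part:
  assumes "open \<Omega>" "continuous_on \<Omega> f"
  shows "open (duct_part \<sigma> \<Omega> f)"
proof -
  have c: "continuous_on (UNIV \<times> \<Omega>) (\<lambda>x. f (snd x))"
    by (rule continuous_on_compose2[OF assms(2)]) (auto intro!: continuous_intros)
  have "open ((UNIV \<times> \<Omega>) \<inter> (\<lambda>x. 1 + \<sigma> * fst x) -` {0<..})"
    by (rule continuous_open_preimage) (auto intro!: continuous_intros open_Times assms)
  moreover have "open ((UNIV \<times> \<Omega>) \<inter> (\<lambda>x. \<sigma> * (f (snd x) - fst x)) -` {0<..})"
    by (rule continuous_open_preimage) (auto intro!: continuous_intros open_Times assms c)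
  moreover have "duct_part \<sigma> \<Omega> f = ((UNIV \<times> \<Omega>) \<inter> (\<lambda>x. 1 + \<sigma> * fst x) -` {0<..}) \<inter>
      ((UNIV \<times> \<Omega>) \<inter> (\<lambda>x. \<sigma> * (f (snd x) - fst x)) -` {0<..})"
    by (auto simp: duct_part_def)
  ultimately show ?thesis by auto
qed

lemma bounded_duct_part:
  assumes "bounded \<Omega>" "continuous_on (closure \<Omega>) f" "\<sigma> = 1 \<or> \<sigma> = -1"
  shows "bounded (duct_part \<sigma> \<Omega> f)"
proof -
  have "bounded (f ` closure \<Omega>)"
    using assms by (intro compact_imp_bounded compact_continuous_image) (auto simp: compact_eq_bounded_closed)
  then obtain B where "\<And>y. y \<in> closure \<Omega> \<Longrightarrow> \<bar>f y\<bar> \<le> B" by (auto simp: bounded_iff)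
  then have B: "\<bar>f y\<bar> \<le> B" if "y \<in> \<Omega>" for y using that closure_subset by blast
  have "duct_part \<sigma> \<Omega> f \<subseteq> cbox (- (1 + \<bar>B\<bar>)) (1 + \<bar>B\<bar>) \<times> \<Omega>"
  proof
    fix x assume x: "x \<in> duct_part \<sigma> \<Omega> f"
    then have "snd x \<in> \<Omega>" by (simp add: duct_part_def)
    moreover have "\<bar>fst x\<bar> \<le> 1 + \<bar>B\<bar>"
      using assms(3) B[OF \<open>snd x \<in> \<Omega>\<close>] x by (auto simp: duct_part_def)
    ultimately show "x \<in> cbox (- (1 + \<bar>B\<bar>)) (1 + \<bar>B\<bar>) \<times> \<Omega>" by (auto simp: mem_Times_iff)
  qed
  moreover have "bounded (cbox (- (1 + \<bar>B\<bar>)) (1 + \<bar>B\<bar>) \<times> \<Omega>)"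
    by (intro bounded_Times bounded_cbox assms(1))
  ultimately show ?thesis by (rule bounded_subset[rotated])
qed

text \<open>The unit growth of \<open>k\<close> in a fixed direction bounds the measure of the layers where \<open>k\<close> is
  between \<open>\<delta>\<close> and \<open>2 \<delta>\<close>.\<close>
definition wall_chart :: "pt2 set \<Rightarrow> pt2 \<Rightarrow> real \<Rightarrow> (pt2 \<Rightarrow> real) \<Rightarrow> (pt2 \<Rightarrow> pt2) \<Rightarrow> bool" where
  "wall_chart \<Omega> p r k k' \<longleftrightarrow> 0 < r \<and> C1_grad UNIV k k' \<and>
     (\<exists>v. norm v \<le> 1 \<and> (\<forall>y \<tau>. k (y + \<tau> *\<^sub>R v) = k y + \<tau>)) \<and>
     (\<forall>y\<in>cball p r. y \<in> \<Omega> \<longleftrightarrow> 0 < k y) \<and>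
     (\<forall>y\<in>cball p r \<inter> frontier \<Omega>. \<exists>\<nu> c. outward_unit_normal \<Omega> y \<nu> \<and> 0 \<le> c \<and> k' y = - c *\<^sub>R \<nu>)"

text \<open>Three boundary functions describe the end, the graph and the wall, and each condition on
  \<open>l\<close> is its sign against the gradient of one of them. On an edge several boundary
  functions vanish, and each cutoff uses only its own sign.\<close>

lemma duct_divergence_nonpos_local:
  assumes \<Omega>: "open \<Omega>" "bounded \<Omega>" and \<sigma>: "\<sigma> = 1 \<or> \<sigma> = -1"
    and Df: "continuous_on (closure \<Omega>) Df"
    and f: "\<And>y. y \<in> closure \<Omega> \<Longrightarrow> (f has_derivative (\<lambda>h. Df y \<bullet> h)) (at y within closure \<Omega>)"
    and V: "C1_div (duct_part \<sigma> \<Omega> f) V d" and d: "bounded (d ` duct_part \<sigma> \<Omega> f)"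
    and lim: "\<And>q. q \<in> closure (duct_part \<sigma> \<Omega> f) - duct_part \<sigma> \<Omega> f \<Longrightarrow>
      \<exists>l. (V \<longlongrightarrow> l) (at q within duct_part \<sigma> \<Omega> f) \<and> (1 + \<sigma> * fst q = 0 \<longrightarrow> 0 \<le> \<sigma> * fst l) \<and>
        (fst q = f (snd q) \<longrightarrow> \<sigma> * (l \<bullet> (1, - Df (snd q))) \<le> 0) \<and>
        (\<forall>\<nu>. snd q \<in> frontier \<Omega> \<longrightarrow> outward_unit_normal \<Omega> (snd q) \<nu> \<longrightarrow> l \<bullet> (0, \<nu>) \<le> 0)"
    and chart: "wall_chart \<Omega> p r k k'"
    and supp: "\<And>x. x \<in> duct_part \<sigma> \<Omega> f \<Longrightarrow> snd x \<notin> cball p r \<Longrightarrow> V x = 0"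
  shows "(LINT x:duct_part \<sigma> \<Omega> f|lborel. d x) \<le> 0"
proof -
  let ?A = "duct_part \<sigma> \<Omega> f"
  define K where "K = (UNIV :: real set) \<times> cball p r"
  have fc: "continuous_on (closure \<Omega>) f"
    using f has_derivative_continuous continuous_on_eq_continuous_within by blast
  have A: "open ?A" "bounded ?A"
    using open_duct_part[OF \<Omega>(1) continuous_on_subset[OF fc closure_subset]] bounded_duct_part[OF \<Omega>(2) fc \<sigma>] by auto
  have kC: "C1_grad UNIV k k'" and r: "0 < r"
    and k\<Omega>: "\<And>y. y \<in> cball p r \<Longrightarrow> y \<in> \<Omega> \<longleftrightarrow> 0 < k y"
    and kn: "\<And>y. y \<in> cball p r \<Longrightarrow> y \<in> frontier \<Omega> \<Longrightarrow> \<exists>\<nu> c. outward_unit_normal \<Omega> y \<nu> \<and> 0 \<le> c \<and> k' y = - c *\<^sub>R \<nu>"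
    using chart unfolding wall_chart_def by auto
  obtain v where v: "norm v \<le> 1" "\<And>y \<tau>. k (y + \<tau> *\<^sub>R v) = k y + \<tau>"
    using chart unfolding wall_chart_def by auto
  have kc: "continuous_on UNIV k" "continuous_on UNIV k'"
    using C1_grad_continuous[OF kC] kC by (auto simp: C1_grad_def)
  define g :: "nat \<Rightarrow> pt3 \<Rightarrow> real" where
    "g i x = (if i = 0 then 1 + \<sigma> * fst x else if i = 1 then \<sigma> * (f (snd x) - fst x) else k (snd x))" for i x
  define \<gamma> :: "nat \<Rightarrow> pt3 \<Rightarrow> pt3" where
    "\<gamma> i x = (if i = 0 then (\<sigma>, 0) else if i = 1 then \<sigma> *\<^sub>R (-1, Df (snd x)) else (0, k' (snd x)))" for i x
  define I where "I = {0, 1, 2::nat}"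
  have g0: "g 0 = (\<lambda>x. 1 + \<sigma> * fst x)" and g1: "g (Suc 0) = (\<lambda>x. \<sigma> * (f (snd x) - fst x))" and g2: "g 2 = (\<lambda>x. k (snd x))"
    and \<gamma>0: "\<gamma> 0 = (\<lambda>x. (\<sigma>, 0))" and \<gamma>1: "\<gamma> (Suc 0) = (\<lambda>x. \<sigma> *\<^sub>R (-1, Df (snd x)))" and \<gamma>2: "\<gamma> 2 = (\<lambda>x. (0, k' (snd x)))"
    by (auto simp: g_def \<gamma>_def)
  have fC: "C1_grad ?A (\<lambda>x. f (snd x)) (\<lambda>x. (0, Df (snd x)))"
  proof (rule C1_grad_snd[of \<Omega>])
    show "C1_grad \<Omega> f Df"
      unfolding C1_grad_def
    proof
      show "\<forall>x\<in>\<Omega>. GDERIV f x :> Df x"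
        using GDERIV_closure_interior[OF \<Omega>(1)] f closure_subset[of \<Omega>] by blast
      show "continuous_on \<Omega> Df" by (rule continuous_on_subset[OF Df closure_subset])
    qed
  qed (auto simp: duct_part_def)
  have gC: "C1_grad ?A (g i) (\<gamma> i)" if "i \<in> I" for i
  proof -
    have "C1_grad ?A (g 0) (\<gamma> 0)"
    proof -
      have "GDERIV (\<lambda>x. 1 + \<sigma> * fst x) x :> 0 + (\<sigma> *\<^sub>R (1, 0) + fst x *\<^sub>R 0)" for x :: pt3
        by (intro GDERIV_add GDERIV_const GDERIV_mult GDERIV_fst)
      then show ?thesis unfolding C1_grad_def g0 \<gamma>0 by auto
    qed
    moreover have "C1_grad ?A (g (Suc 0)) (\<gamma> (Suc 0))"
    proof -
      have "GDERIV (\<lambda>x. \<sigma> * (f (snd x) - fst x)) x :>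
          \<sigma> *\<^sub>R ((0, Df (snd x)) - (1, 0)) + (f (snd x) - fst x) *\<^sub>R 0" if "x \<in> ?A" for x :: pt3
        using fC that unfolding C1_grad_def
        by (intro GDERIV_diff GDERIV_const GDERIV_mult GDERIV_fst) auto
      moreover have "continuous_on ?A (\<lambda>x. Df (snd x))"
        by (rule continuous_on_compose2[OF Df]) (auto simp: duct_part_def intro!: continuous_intros intro: closure_subset[THEN subsetD])
      ultimately show ?thesis unfolding C1_grad_def g1 \<gamma>1 by (auto intro!: continuous_intros)
    qed
    moreover have "C1_grad ?A (g 2) (\<gamma> 2)"
      unfolding g2 \<gamma>2 by (rule C1_grad_snd[OF kC]) simp
    ultimately show ?thesis using that by (auto simp: I_def)
  qed
  have pos: "0 < g i x" if "i \<in> I" "x \<in> ?A \<inter> K" for i x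
    using that k\<Omega>[of "snd x"] by (auto simp: g_def I_def duct_part_def K_def)
  \<comment> \<open>The bound \<open>\<delta> \<le> k\<close> inside the ball keeps the
    cross-section point in \<open>\<Omega>\<close>, where \<open>f\<close> is continuous, so the
    remaining inequalities cut out a closed subset of a closed set.\<close>
  have cl: "closed {x \<in> ?A \<inter> K. \<forall>i\<in>I. \<delta> \<le> g i x}" if "0 < \<delta>" for \<delta>
  proof -
    define T where "T = (UNIV :: real set) \<times> {y \<in> cball p r. \<delta> \<le> k y}"
    have "closed {y \<in> cball p r. \<delta> \<le> k y}"
      by (intro continuous_on_closed_Collect_le continuous_intros continuous_on_subset[OF kc(1)]) auto
    then have T: "closed T" by (simp add: T_def closed_Times)
    have T\<Omega>: "snd x \<in> \<Omega>" if "x \<in> T" for x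
      using that k\<Omega>[of "snd x"] \<open>0 < \<delta>\<close> by (auto simp: T_def)
    have c: "continuous_on T (\<lambda>x. f (snd x))"
      by (rule continuous_on_compose2[OF fc]) (use T\<Omega> closure_subset[of \<Omega>] in \<open>force intro!: continuous_intros\<close>)+
    have "{x \<in> ?A \<inter> K. \<forall>i\<in>I. \<delta> \<le> g i x} = {x\<in>T. \<delta> \<le> 1 + \<sigma> * fst x} \<inter> {x \<in> T. \<delta> \<le> \<sigma> * (f (snd x) - fst x)}"
      using T\<Omega> that by (auto simp: g_def I_def duct_part_def K_def T_def)
    moreover have "closed \<dots>"
      by (intro closed_Int continuous_on_closed_Collect_le T) (auto intro!: continuous_intros c)
    ultimately show ?thesis by simp
  qed
  have sgn: "\<exists>\<delta>>0. \<forall>x\<in>?A \<inter> K. g i x \<le> \<delta> \<longrightarrow> - \<epsilon> \<le> V x \<bullet> \<gamma> i x" if i: "i \<in> I" and \<epsilon>: "0 < \<epsilon>" for i \<epsilon>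
  proof (rule boundary_sign_uniform[OF A(2) _ C1_grad_continuous[OF gC[OF i]] pos[OF i] _ \<epsilon>])
    show "closed K" by (simp add: K_def closed_Times)
    fix q assume q: "q \<in> closure ?A \<inter> K - ?A"
    then obtain l where l: "(V \<longlongrightarrow> l) (at q within ?A)" "1 + \<sigma> * fst q = 0 \<Longrightarrow> 0 \<le> \<sigma> * fst l"
      "fst q = f (snd q) \<Longrightarrow> \<sigma> * (l \<bullet> (1, - Df (snd q))) \<le> 0"
      "\<And>\<nu>. snd q \<in> frontier \<Omega> \<Longrightarrow> outward_unit_normal \<Omega> (snd q) \<nu> \<Longrightarrow> l \<bullet> (0, \<nu>) \<le> 0"
      using lim[of q] by blast
    have qc: "snd q \<in> closure \<Omega>" "0 \<le> 1 + \<sigma> * fst q" "0 \<le> \<sigma> * (f (snd q) - fst q)"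
      using closure_duct_part[OF fc, of q \<sigma>] q by auto
    then have qU: "q \<in> UNIV \<times> closure \<Omega>" by (auto simp: mem_Times_iff)
    have kl: "((\<lambda>x. k (snd x)) \<longlongrightarrow> k (snd q)) (at q within ?A)" "((\<lambda>x. k' (snd x)) \<longlongrightarrow> k' (snd q)) (at q within ?A)"
      using tendsto_snd_within_duct_part[OF continuous_on_subset[OF kc(1)] qU]
        tendsto_snd_within_duct_part[OF continuous_on_subset[OF kc(2)] qU] by auto
    have "\<exists>a m. (g 0 \<longlongrightarrow> a) (at q within ?A) \<and> ((\<lambda>x. V x \<bullet> \<gamma> 0 x) \<longlongrightarrow> m) (at q within ?A) \<and> (0 < a \<or> 0 \<le> m)"
    proof (intro exI conjI)
      show "(g 0 \<longlongrightarrow> 1 + \<sigma> * fst q) (at q within ?A)"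
        unfolding g0 by (intro tendsto_intros)
      show "((\<lambda>x. V x \<bullet> \<gamma> 0 x) \<longlongrightarrow> l \<bullet> (\<sigma>, 0)) (at q within ?A)"
        unfolding \<gamma>0 by (intro tendsto_intros l)
      show "0 < 1 + \<sigma> * fst q \<or> 0 \<le> l \<bullet> (\<sigma>, 0)"
        using qc(2) l(2) by (cases l; cases "1 + \<sigma> * fst q = 0") (auto simp: mult.commute)
    qed
    moreover have "\<exists>a m. (g (Suc 0) \<longlongrightarrow> a) (at q within ?A) \<and>
      ((\<lambda>x. V x \<bullet> \<gamma> (Suc 0) x) \<longlongrightarrow> m) (at q within ?A) \<and> (0 < a \<or> 0 \<le> m)"
    proof (intro exI conjI)
      show "(g (Suc 0) \<longlongrightarrow> \<sigma> * (f (snd q) - fst q)) (at q within ?A)"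
        unfolding g1 by (intro tendsto_intros tendsto_snd_within_duct_part[OF fc qU])
      show "((\<lambda>x. V x \<bullet> \<gamma> (Suc 0) x) \<longlongrightarrow> l \<bullet> (\<sigma> *\<^sub>R (-1, Df (snd q)))) (at q within ?A)"
        unfolding \<gamma>1 by (intro tendsto_intros l tendsto_snd_within_duct_part[OF Df qU])
      have "l \<bullet> (\<sigma> *\<^sub>R (-1, Df (snd q))) = - (\<sigma> * (l \<bullet> (1, - Df (snd q))))"
        by (cases l) (simp add: algebra_simps inner_minus_right)
      then show "0 < \<sigma> * (f (snd q) - fst q) \<or> 0 \<le> l \<bullet> (\<sigma> *\<^sub>R (-1, Df (snd q)))"
        using qc(3) l(3) \<sigma> by (cases "fst q = f (snd q)") auto
    qed
    moreover have "\<exists>a m. (g 2 \<longlongrightarrow> a) (at q within ?A) \<and>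
      ((\<lambda>x. V x \<bullet> \<gamma> 2 x) \<longlongrightarrow> m) (at q within ?A) \<and> (0 < a \<or> 0 \<le> m)"
    proof (intro exI conjI)
      show "(g 2 \<longlongrightarrow> k (snd q)) (at q within ?A)"
        unfolding g2 by (rule kl)
      show "((\<lambda>x. V x \<bullet> \<gamma> 2 x) \<longlongrightarrow> l \<bullet> (0, k' (snd q))) (at q within ?A)"
        unfolding \<gamma>2 by (intro tendsto_intros l kl)
      show "0 < k (snd q) \<or> 0 \<le> l \<bullet> (0, k' (snd q))"
      proof (cases "snd q \<in> \<Omega>")
        case True
        then show ?thesis using k\<Omega>[of "snd q"] q by (auto simp: K_def mem_Times_iff)
      next
        case False
        then have fr: "snd q \<in> frontier \<Omega>" using qc(1) \<Omega>(1) by (simp add: frontier_def interior_open)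
        then obtain \<nu> c where \<nu>: "outward_unit_normal \<Omega> (snd q) \<nu>" "0 \<le> c" "k' (snd q) = - c *\<^sub>R \<nu>"
          using kn[of "snd q"] q by (auto simp: K_def mem_Times_iff)
        have "l \<bullet> (0, k' (snd q)) = - (c * (l \<bullet> (0, \<nu>)))"
          using \<nu>(3) by (cases l) simp
        moreover have "c * (l \<bullet> (0, \<nu>)) \<le> 0"
          using l(4)[OF fr \<nu>(1)] \<nu>(2) by (simp add: mult_nonneg_nonpos)
        ultimately show ?thesis by simp
      qed
    qed
    ultimately show "\<exists>a m. (g i \<longlongrightarrow> a) (at q within ?A) \<and> ((\<lambda>x. V x \<bullet> \<gamma> i x) \<longlongrightarrow> m) (at q within ?A) \<and> (0 < a \<or> 0 \<le> m)"
      using i unfolding I_def by auto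
  qed
  \<comment> \<open>Unit growth is found along \<open>x1\<close> towards the interior, in opposite
    senses for the end and the graph, and along the direction supplied by the chart for the
    wall.\<close>
  have tr: "\<exists>v. norm v \<le> 1 \<and> (\<forall>x \<tau>. x \<in> ?A \<inter> K \<longrightarrow> x + \<tau> *\<^sub>R v \<in> ?A \<inter> K \<longrightarrow> g i (x + \<tau> *\<^sub>R v) = g i x + \<tau>)" if "i \<in> I" for i
  proof -
    have "g 0 (x + \<tau> *\<^sub>R (\<sigma>, 0)) = g 0 x + \<tau>" "g (Suc 0) (x + \<tau> *\<^sub>R (-\<sigma>, 0)) = g (Suc 0) x + \<tau>"
      "g 2 (x + \<tau> *\<^sub>R (0, v)) = g 2 x + \<tau>" for x \<tau>
      using \<sigma> v(2) by (auto simp: g0 g1 g2 algebra_simps)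
    moreover have "norm ((\<sigma>, 0) :: pt3) \<le> 1" "norm ((-\<sigma>, 0) :: pt3) \<le> 1" "norm ((0, v) :: pt3) \<le> 1"
      using \<sigma> v(1) by (auto simp: norm_Pair)
    ultimately have "\<exists>v. norm v \<le> 1 \<and> (\<forall>x \<tau>. g i (x + \<tau> *\<^sub>R v) = g i x + \<tau>)"
      using that unfolding I_def
      by (intro exI[of _ "if i = 0 then (\<sigma>, 0) else if i = 1 then (- \<sigma>, 0) else (0, v)"]) (elim insertE; simp)
    then show ?thesis by blast
  qed
  show ?thesis
    by (rule cutoff_divergence_nonpos[where K = K and I = I and g = g and \<gamma> = \<gamma>, OF A V d _ _ _ gC pos cl sgn tr])
      (auto simp: K_def closed_Times I_def intro: supp)
qed

section \<open>Charts of the cross-section\<close>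

lemma C3_fun_C1:
  assumes "C3_fun h"
  shows "(h has_real_derivative deriv h x) (at x)" "continuous_on UNIV (deriv h)"
proof -
  have 0: "(deriv ^^ 0) h field_differentiable (at x)" and 1: "(deriv ^^ 1) h field_differentiable (at x)" for x
    using assms[unfolded C3_fun_def, THEN conjunct1, rule_format, of 0 x]
      assms[unfolded C3_fun_def, THEN conjunct1, rule_format, of 1 x] by auto
  show "(h has_real_derivative deriv h x) (at x)"
    using 0[of x] by (simp add: field_differentiable_derivI)
  show "continuous_on UNIV (deriv h)"
    using 1 by (auto intro!: continuous_at_imp_continuous_on field_differentiable_imp_continuous_at)
qed

lemma local_graph_repD:
  assumes "local_graph_rep \<Omega> p r e n h"
  shows "0 < r" "norm e = 1" "norm n = 1" "e \<bullet> n = 0"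
    "\<And>x. x \<in> ball p r \<Longrightarrow> x \<in> \<Omega> \<longleftrightarrow> (x - p) \<bullet> n < h ((x - p) \<bullet> e)"
  using assms unfolding local_graph_rep_def by blast+

text \<open>\<open>outward_unit_normal\<close> refers to a representation centred at the boundary
  point itself. A graph around \<open>p\<close> is recentred at a nearby point of the graph with the
  same frame and a smaller radius.\<close>

lemma local_graph_rep_shift:
  assumes "local_graph_rep \<Omega> p r e n h" "y \<in> ball p r" "(y - p) \<bullet> n = h ((y - p) \<bullet> e)"
  shows "local_graph_rep \<Omega> y (r - dist p y) e n (\<lambda>\<tau>. h ((y - p) \<bullet> e + \<tau>) - h ((y - p) \<bullet> e))"
proof -
  note g = local_graph_repD(2-5)[OF assms(1)]
  have "x \<in> \<Omega> \<longleftrightarrow> (x - y) \<bullet> n < h ((y - p) \<bullet> e + (x - y) \<bullet> e) - h ((y - p) \<bullet> e)"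
    if "x \<in> ball y (r - dist p y)" for x
  proof -
    have "x \<in> ball p r" using that dist_triangle[of p x y] by simp
    moreover have "(x - y) \<bullet> n = (x - p) \<bullet> n - h ((y - p) \<bullet> e)"
      unfolding assms(3)[symmetric] by (simp add: inner_diff_left)
    moreover have "(y - p) \<bullet> e + (x - y) \<bullet> e = (x - p) \<bullet> e" by (simp add: inner_diff_left)
    ultimately show ?thesis using g(4) by simp
  qed
  then have eq: "\<Omega> \<inter> ball y (r - dist p y) = {x \<in> ball y (r - dist p y).
      (x - y) \<bullet> n < h ((y - p) \<bullet> e + (x - y) \<bullet> e) - h ((y - p) \<bullet> e)}" by blast
  show ?thesis unfolding local_graph_rep_def
  proof (intro conjI)
    show "0 < r - dist p y" using assms(2) by simp
    show "h ((y - p) \<bullet> e + 0) - h ((y - p) \<bullet> e) = 0" by simp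
  qed (rule g eq)+
qed

text \<open>The height of the graph above the point is positive inside and grows at unit speed along
  \<open>- n\<close>. Its gradient is the outward normal times
  \<open>- sqrt (1 + (deriv h s)^2)\<close>. Halving the radius puts the closed ball inside the open
  one.\<close>

lemma wall_chart_boundary:
  assumes \<Omega>: "open \<Omega>" and rep: "local_graph_rep \<Omega> p r e n h" and h: "C3_fun h"
  shows "\<exists>r k k'. wall_chart \<Omega> p r k k'"
proof -
  define k where "k y = h ((y - p) \<bullet> e) - (y - p) \<bullet> n" for y
  define k' where "k' y = deriv h ((y - p) \<bullet> e) *\<^sub>R e - n" for y
  have g: "0 < r" "norm e = 1" "norm n = 1" "e \<bullet> n = 0"
    "\<And>x. x \<in> ball p r \<Longrightarrow> x \<in> \<Omega> \<longleftrightarrow> 0 < k x"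
    using local_graph_repD[OF rep] by (auto simp: k_def)
  have ball: "cball p (r / 2) \<subseteq> ball p r" using g(1) by auto
  have lin: "GDERIV (\<lambda>y. (y - p) \<bullet> a) y :> a" for a y :: pt2
    unfolding gderiv_def by (auto intro!: derivative_eq_intros)
  have kC: "C1_grad UNIV k k'"
    unfolding C1_grad_def
  proof
    show "\<forall>y\<in>UNIV. GDERIV k y :> k' y"
      unfolding k_def k'_def
      by (intro ballI GDERIV_diff lin GDERIV_DERIV_compose[of "\<lambda>y. (y - p) \<bullet> e"] C3_fun_C1(1)[OF h])
    show "continuous_on UNIV k'"
      unfolding k'_def by (intro continuous_intros continuous_on_compose2[OF C3_fun_C1(2)[OF h]]) auto
  qed
  \<comment> \<open>The representation describes only membership in \<open>\<Omega>\<close>. A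
    frontier point is not in \<open>\<Omega>\<close>, so \<open>k\<close> is at most 0; if
    \<open>k\<close> were negative, a whole neighbourhood would miss
    \<open>\<Omega>\<close>.\<close>
  have k0: "k y = 0" if y: "y \<in> ball p r" "y \<in> frontier \<Omega>" for y
  proof -
    have "y \<notin> \<Omega>" "y \<in> closure \<Omega>" using y(2) \<Omega> by (auto simp: frontier_def interior_open)
    then have "k y \<le> 0" using g(5)[OF y(1)] by simp
    moreover have "0 \<le> k y"
    proof (rule ccontr)
      assume "\<not> 0 \<le> k y"
      define U where "U = ball p r \<inter> k -` {..<0}"
      have "open U"
        unfolding U_def
        by (rule continuous_open_preimage) (auto intro: continuous_on_subset[OF C1_grad_continuous[OF kC]])
      moreover have "y \<in> U" using y(1) \<open>\<not> 0 \<le> k y\<close> by (auto simp: U_def)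
      moreover have "U \<inter> \<Omega> = {}" using g(5) by (force simp: U_def)
      ultimately show False using \<open>y \<in> closure \<Omega>\<close> open_Int_closure_eq_empty[of U \<Omega>] by blast
    qed
    ultimately show ?thesis by simp
  qed
  have nrm: "\<exists>\<nu> c. outward_unit_normal \<Omega> y \<nu> \<and> 0 \<le> c \<and> k' y = - c *\<^sub>R \<nu>" if y: "y \<in> ball p r" "y \<in> frontier \<Omega>" for y
  proof -
    define s where "s = (y - p) \<bullet> e"
    define h' where "h' = (\<lambda>\<tau>. h (s + \<tau>) - h s)"
    have rep': "local_graph_rep \<Omega> y (r - dist p y) e n h'"
      unfolding h'_def s_def by (rule local_graph_rep_shift[OF rep y(1)]) (use k0[OF y] in \<open>simp add: k_def\<close>)
    have dh: "(h' has_real_derivative deriv h s) (at 0)"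
    proof -
      have "((\<lambda>\<tau>. h (s + \<tau>)) has_real_derivative deriv h s * 1) (at 0)"
        by (rule DERIV_chain2[where f = h]) (use C3_fun_C1(1)[OF h, of s] in \<open>auto intro!: derivative_eq_intros\<close>)
      then show ?thesis unfolding h'_def by (auto intro!: derivative_eq_intros)
    qed
    then have d: "deriv h' 0 = deriv h s" "h' differentiable (at 0)"
      by (auto simp: DERIV_imp_deriv real_differentiable_def)
    define c where "c = sqrt (1 + (deriv h s)\<^sup>2)"
    have c: "0 < c" unfolding c_def by (simp add: add_pos_nonneg)
    have "outward_unit_normal \<Omega> y ((1 / c) *\<^sub>R (n - deriv h s *\<^sub>R e))"
      unfolding outward_unit_normal_def c_def using rep' d by metis
    moreover have "k' y = - c *\<^sub>R ((1 / c) *\<^sub>R (n - deriv h s *\<^sub>R e))"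
      using c by (simp add: k'_def s_def)
    ultimately show ?thesis using c less_imp_le by blast
  qed
  have "k (y + \<tau> *\<^sub>R (- n)) = k y + \<tau>" for y \<tau>
  proof -
    have "n \<bullet> n = 1" using g(3) by (simp add: norm_eq_1)
    moreover have "n \<bullet> e = 0" using g(4) by (simp add: inner_commute)
    ultimately show ?thesis by (simp add: k_def inner_diff_left inner_add_left)
  qed
  moreover have "norm (- n) \<le> 1" using g(3) by simp
  ultimately have "\<exists>v. norm v \<le> 1 \<and> (\<forall>y \<tau>. k (y + \<tau> *\<^sub>R v) = k y + \<tau>)" by blast
  moreover have "\<forall>y\<in>cball p (r / 2). y \<in> \<Omega> \<longleftrightarrow> 0 < k y" using g(5) ball by blast
  moreover have "\<forall>y\<in>cball p (r / 2) \<inter> frontier \<Omega>. \<exists>\<nu> c. outward_unit_normal \<Omega> y \<nu> \<and> 0 \<le> c \<and> k' y = - c *\<^sub>R \<nu>"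
    using nrm ball by blast
  moreover have "0 < r / 2" using g(1) by simp
  ultimately have "wall_chart \<Omega> p (r / 2) k k'" unfolding wall_chart_def using kC by blast
  then show ?thesis by blast
qed

text \<open>Away from the wall any function positive on the ball and of unit growth will do: a
  linear one, with the offset \<open>r + 1\<close> keeping it at least 1 there.\<close>

lemma wall_chart_interior:
  assumes \<Omega>: "open \<Omega>" and p: "p \<in> \<Omega>"
  shows "\<exists>r k k'. wall_chart \<Omega> p r k k'"
proof -
  obtain r where r: "0 < r" "cball p r \<subseteq> \<Omega>" using \<Omega> p open_contains_cball by blast
  define n :: pt2 where "n = (1, 0)"
  define k where "k y = (y - p) \<bullet> n + (r + 1)" for y
  have n: "norm n = 1" "n \<bullet> n = 1" by (auto simp: n_def norm_Pair)
  have "C1_grad UNIV k (\<lambda>_. n)"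
    unfolding C1_grad_def gderiv_def k_def by (auto intro!: derivative_eq_intros)
  moreover have "0 < k y" if "y \<in> cball p r" for y
    using Cauchy_Schwarz_ineq2[of "y - p" n] n that by (auto simp: k_def dist_norm norm_minus_commute)
  then have "\<forall>y\<in>cball p r. y \<in> \<Omega> \<longleftrightarrow> 0 < k y" using r(2) by blast
  moreover have "cball p r \<inter> frontier \<Omega> = {}"
    using r(2) \<Omega> by (auto simp: frontier_def interior_open)
  moreover have "k (y + \<tau> *\<^sub>R n) = k y + \<tau>" for y \<tau>
    by (simp add: k_def inner_add_left inner_diff_left n)
  then have "\<exists>v. norm v \<le> 1 \<and> (\<forall>y \<tau>. k (y + \<tau> *\<^sub>R v) = k y + \<tau>)"
    using n(1) by (intro exI[of _ n]) auto
  ultimately have "wall_chart \<Omega> p r k (\<lambda>_. n)" unfolding wall_chart_def using r(1) by blast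
  then show ?thesis by blast
qed

section \<open>Partition of unity in the cross-section\<close>

lemma C1_grad_bump: "C1_grad UNIV (\<lambda>y. pos2 (r\<^sup>2 - (y - p) \<bullet> (y - p)))
   (\<lambda>y. (2 * max 0 (r\<^sup>2 - (y - p) \<bullet> (y - p))) *\<^sub>R (- 2 *\<^sub>R (y - p)))"
proof -
  have "C1_grad UNIV (\<lambda>y. r\<^sup>2 - (y - p) \<bullet> (y - p)) (\<lambda>y. - 2 *\<^sub>R (y - p))"
    unfolding C1_grad_def gderiv_def
    by (auto intro!: derivative_eq_intros continuous_intros simp: inner_commute inner_diff_left inner_diff_right algebra_simps)
  then show ?thesis
    by (rule C1_grad_compose[where \<theta>' = "\<lambda>s. 2 * max 0 s", OF _ DERIV_pos2])
      (auto intro!: continuous_intros)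
qed

lemma bump_pos_iff:
  assumes "0 < r"
  shows "0 < pos2 (r\<^sup>2 - (y - p) \<bullet> (y - p)) \<longleftrightarrow> y \<in> ball p r"
proof -
  have "(y - p) \<bullet> (y - p) < r\<^sup>2 \<longleftrightarrow> norm (y - p) < r"
    unfolding power2_norm_eq_inner[symmetric]
    using assms power_strict_mono[of "norm (y - p)" r 2] power_less_imp_less_base[of "norm (y - p)" 2 r] by auto
  then show ?thesis
    by (auto simp: pos2_def dist_norm norm_minus_commute max_def)
qed

lemma set_integral_sum_fin:
  fixes d :: "'i \<Rightarrow> 'a::euclidean_space \<Rightarrow> real"
  assumes "finite I" "\<And>i. i \<in> I \<Longrightarrow> set_integrable lborel A (d i)"
  shows "(LINT x:A|lborel. (\<Sum>i\<in>I. d i x)) = (\<Sum>i\<in>I. LINT x:A|lborel. d i x)"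
  using assms unfolding set_lebesgue_integral_def set_integrable_def scaleR_sum_right
  by (intro Bochner_Integration.integral_sum)

text \<open>A one-sided divergence theorem for fields with pointwise limits at the boundary. The
  weights of a partition of unity depend on the cross-section variable only; being nonnegative, they
  preserve all the sign conditions, so the local inequality applies to each piece.\<close>

theorem duct_divergence_nonpos:
  assumes \<Omega>: "bounded_domain \<Omega>" "C3_boundary \<Omega>" and \<sigma>: "\<sigma> = 1 \<or> \<sigma> = -1"
    and Df: "continuous_on (closure \<Omega>) Df"
    and f: "\<And>y. y \<in> closure \<Omega> \<Longrightarrow> (f has_derivative (\<lambda>h. Df y \<bullet> h)) (at y within closure \<Omega>)"
    and V: "C1_div (duct_part \<sigma> \<Omega> f) V d" and d: "bounded (d ` duct_part \<sigma> \<Omega> f)"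
    and lim: "\<And>q. q \<in> closure (duct_part \<sigma> \<Omega> f) - duct_part \<sigma> \<Omega> f \<Longrightarrow>
      \<exists>l. (V \<longlongrightarrow> l) (at q within duct_part \<sigma> \<Omega> f) \<and> (1 + \<sigma> * fst q = 0 \<longrightarrow> 0 \<le> \<sigma> * fst l) \<and>
        (fst q = f (snd q) \<longrightarrow> \<sigma> * (l \<bullet> (1, - Df (snd q))) \<le> 0) \<and>
        (\<forall>\<nu>. snd q \<in> frontier \<Omega> \<longrightarrow> outward_unit_normal \<Omega> (snd q) \<nu> \<longrightarrow> l \<bullet> (0, \<nu>) \<le> 0)"
  shows "(LINT x:duct_part \<sigma> \<Omega> f|lborel. d x) \<le> 0"
proof -
  let ?A = "duct_part \<sigma> \<Omega> f"
  have op: "open \<Omega>" and bd: "bounded \<Omega>" using \<Omega>(1) by (auto simp: bounded_domain_def)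
  have fc: "continuous_on (closure \<Omega>) f"
    using f has_derivative_continuous continuous_on_eq_continuous_within by blast
  have A: "open ?A" "bounded ?A"
    using open_duct_part[OF op continuous_on_subset[OF fc closure_subset]] bounded_duct_part[OF bd fc \<sigma>] by auto
  have comp: "compact (closure \<Omega>)" using bounded_closure[OF bd] by (simp add: compact_eq_bounded_closed del: bounded_closure)
  have "\<exists>r k k'. wall_chart \<Omega> p r k k'" if "p \<in> closure \<Omega>" for p
  proof (cases "p \<in> \<Omega>")
    case True then show ?thesis using wall_chart_interior[OF op] by blast
  next
    case False
    then have "p \<in> frontier \<Omega>" using that op by (simp add: frontier_def interior_open)
    then show ?thesis using \<Omega>(2) wall_chart_boundary[OF op] unfolding C3_boundary_def by meson
  qed
  then obtain r k k' where chart: "\<And>p. p \<in> closure \<Omega> \<Longrightarrow> wall_chart \<Omega> p (r p) (k p) (k' p)" by metis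
  have r: "0 < r p" if "p \<in> closure \<Omega>" for p using chart[OF that] unfolding wall_chart_def by blast
  obtain P where P: "P \<subseteq> closure \<Omega>" "finite P" "closure \<Omega> \<subseteq> (\<Union>p\<in>P. ball p (r p))"
  proof (rule compactE_image[OF comp, of "closure \<Omega>" "\<lambda>p. ball p (r p)"])
    show "closure \<Omega> \<subseteq> (\<Union>p\<in>closure \<Omega>. ball p (r p))" using r by force
  qed auto
  define b where "b p y = pos2 ((r p)\<^sup>2 - (y - p) \<bullet> (y - p))" for p y :: pt2
  define b' where "b' p y = (2 * max 0 ((r p)\<^sup>2 - (y - p) \<bullet> (y - p))) *\<^sub>R (- 2 *\<^sub>R (y - p))" for p y :: pt2
  have bC: "C1_grad UNIV (b p) (b' p)" for p
    unfolding b_def b'_def by (rule C1_grad_bump)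
  have bc: "continuous_on S (b p)" "continuous_on S (b' p)" for p S
    using C1_grad_continuous[OF bC[of p]] bC[of p] continuous_on_subset[of UNIV _ S]
    unfolding C1_grad_def by blast+
  have b0: "0 \<le> b p y" for p y by (simp add: b_def)
  define s where "s y = (\<Sum>p\<in>P. b p y)" for y
  define s' where "s' y = (\<Sum>p\<in>P. b' p y)" for y
  have sc: "continuous_on S s" "continuous_on S s'" for S
    unfolding s_def s'_def by (intro continuous_on_sum bc)+
  \<comment> \<open>Positivity up to the frontier makes the normalised weights and their gradients
    continuous on the closure, as the limits at wall points require.\<close>
  have s0: "0 < s y" if "y \<in> closure \<Omega>" for y
  proof -
    obtain p where p: "p \<in> P" "y \<in> ball p (r p)" using P(3) \<open>y \<in> closure \<Omega>\<close> by blast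
    have "0 < b p y" unfolding b_def using bump_pos_iff[OF r] p P(1) by blast
    then show ?thesis unfolding s_def using P(2) p(1) b0 by (intro sum_pos2[of P p]) auto
  qed
  have s0': "s y \<noteq> 0" if "y \<in> closure \<Omega>" for y using s0[OF that] by simp
  define \<beta> where "\<beta> p y = b p y * inverse (s y)" for p y
  define \<beta>' where "\<beta>' p y = b p y *\<^sub>R (- (inverse (s y))\<^sup>2 *\<^sub>R s' y) + inverse (s y) *\<^sub>R b' p y" for p y
  have \<beta>c: "continuous_on (closure \<Omega>) (\<beta> p)" "continuous_on (closure \<Omega>) (\<beta>' p)" for p
    unfolding \<beta>_def \<beta>'_def using s0' by (auto intro!: continuous_intros bc sc)
  have sC: "C1_grad \<Omega> s s'"
    unfolding C1_grad_def
  proof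
    have "GDERIV (b p) y :> b' p y" for p y using bC[of p] unfolding C1_grad_def by blast
    then have "GDERIV s y :> s' y" for y
      unfolding s_def s'_def gderiv_def inner_sum_right by (intro has_derivative_sum)
    then show "\<forall>y\<in>\<Omega>. GDERIV s y :> s' y" by blast
  qed (rule sc)
  have cl: "y \<in> closure \<Omega>" if "y \<in> \<Omega>" for y using that closure_subset by blast
  have \<beta>C: "C1_grad \<Omega> (\<beta> p) (\<beta>' p)" for p
    unfolding C1_grad_def
  proof
    show "\<forall>y\<in>\<Omega>. GDERIV (\<beta> p) y :> \<beta>' p y"
    proof
      fix y assume y: "y \<in> \<Omega>"
      show "GDERIV (\<beta> p) y :> \<beta>' p y"
        unfolding \<beta>_def \<beta>'_def
      proof (intro GDERIV_mult GDERIV_inverse)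
        show "GDERIV (b p) y :> b' p y" using bC[of p] unfolding C1_grad_def by blast
        show "GDERIV s y :> s' y" using sC y unfolding C1_grad_def by blast
        show "s y \<noteq> 0" by (rule s0'[OF cl[OF y]])
      qed
    qed
    show "continuous_on \<Omega> (\<beta>' p)" by (rule continuous_on_subset[OF \<beta>c(2) closure_subset])
  qed
  have \<beta>0: "0 \<le> \<beta> p y" if "y \<in> closure \<Omega>" for p y
    using b0 s0[OF that] by (simp add: \<beta>_def)
  \<comment> \<open>Since the weights sum to 1, their gradients sum to 0, and the divergences of the
    pieces add up to \<open>d\<close> without a remainder.\<close>
  have \<beta>1: "(\<Sum>p\<in>P. \<beta> p y) = 1" "(\<Sum>p\<in>P. \<beta>' p y) = 0" if "y \<in> \<Omega>" for y
  proof -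
    have "s y \<noteq> 0" using s0' cl that by blast
    then show "(\<Sum>p\<in>P. \<beta> p y) = 1" by (simp add: \<beta>_def sum_distrib_right[symmetric] s_def[symmetric])
    have "(\<Sum>p\<in>P. \<beta>' p y) = s y *\<^sub>R (- (inverse (s y))\<^sup>2 *\<^sub>R s' y) + inverse (s y) *\<^sub>R s' y"
      by (simp only: \<beta>'_def sum.distrib scaleR_left.sum[symmetric] scaleR_right.sum[symmetric] s_def[symmetric] s'_def[symmetric])
    then show "(\<Sum>p\<in>P. \<beta>' p y) = 0" using \<open>s y \<noteq> 0\<close> by (simp add: power2_eq_square field_simps)
  qed
  define W where "W p x = \<beta> p (snd x) *\<^sub>R V x" for p x
  define e where "e p x = \<beta> p (snd x) * d x + V x \<bullet> (0, \<beta>' p (snd x))" for p x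
  have sndA: "snd x \<in> \<Omega>" if "x \<in> ?A" for x using that by (simp add: duct_part_def)
  have WC: "C1_div ?A (W p) (e p)" for p
    unfolding W_def e_def by (rule C1_div_scale[OF C1_grad_snd[OF \<beta>C] V]) (rule sndA)
  have "bounded (V ` ?A)"
    by (rule bounded_image_if_limits[OF A(2) C1_div_continuous_field[OF V]]) (use lim in blast)
  then obtain BV where BV: "\<And>x. x \<in> ?A \<Longrightarrow> norm (V x) \<le> BV" by (auto simp: bounded_iff)
  obtain Bd where Bd: "\<And>x. x \<in> ?A \<Longrightarrow> \<bar>d x\<bar> \<le> Bd" using d by (auto simp: bounded_iff)
  have eb: "bounded (e p ` ?A)" for p
  proof -
    have "bounded (\<beta> p ` closure \<Omega>)" "bounded (\<beta>' p ` closure \<Omega>)"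
      by (auto intro!: compact_imp_bounded compact_continuous_image \<beta>c comp)
    then obtain B1 B2 where B: "\<And>y. y \<in> closure \<Omega> \<Longrightarrow> \<bar>\<beta> p y\<bar> \<le> B1" "\<And>y. y \<in> closure \<Omega> \<Longrightarrow> norm (\<beta>' p y) \<le> B2"
      by (auto simp: bounded_iff)
    have "norm (e p x) \<le> B1 * Bd + BV * B2" if x: "x \<in> ?A" for x
    proof -
      have y: "snd x \<in> closure \<Omega>" using cl sndA[OF x] by blast
      have "\<bar>\<beta> p (snd x) * d x\<bar> \<le> B1 * Bd"
        unfolding abs_mult using B(1)[OF y] Bd[OF x] by (intro mult_mono) auto
      moreover have "\<bar>V x \<bullet> (0, \<beta>' p (snd x))\<bar> \<le> norm (V x) * norm ((0, \<beta>' p (snd x)) :: pt3)"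
        by (rule Cauchy_Schwarz_ineq2)
      moreover have "norm (V x) * norm ((0, \<beta>' p (snd x)) :: pt3) \<le> BV * B2"
        using BV[OF x] B(2)[OF y] order_trans[OF norm_ge_zero BV[OF x]] by (intro mult_mono) (auto simp: norm_Pair)
      ultimately show ?thesis by (simp add: e_def)
    qed
    then show ?thesis unfolding bounded_iff by blast
  qed
  have nonpos: "(LINT x:?A|lborel. e p x) \<le> 0" if p: "p \<in> P" for p
  proof (rule duct_divergence_nonpos_local[OF op bd \<sigma> Df f WC eb _ chart])
    show "p \<in> closure \<Omega>" using p P(1) by blast
    show "W p x = 0" if x: "x \<in> ?A" "snd x \<notin> cball p (r p)" for x
    proof -
      have "b p (snd x) = 0"
        using bump_pos_iff[OF r[of p], of "snd x" p] x(2) p P(1) b0[of p "snd x"]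
        by (force simp: b_def order_less_le)
      then show ?thesis by (simp add: W_def \<beta>_def)
    qed
    fix q assume q: "q \<in> closure ?A - ?A"
    then obtain l where l: "(V \<longlongrightarrow> l) (at q within ?A)" "1 + \<sigma> * fst q = 0 \<Longrightarrow> 0 \<le> \<sigma> * fst l"
      "fst q = f (snd q) \<Longrightarrow> \<sigma> * (l \<bullet> (1, - Df (snd q))) \<le> 0"
      "\<And>\<nu>. snd q \<in> frontier \<Omega> \<Longrightarrow> outward_unit_normal \<Omega> (snd q) \<nu> \<Longrightarrow> l \<bullet> (0, \<nu>) \<le> 0"
      using lim[of q] by blast
    have y: "snd q \<in> closure \<Omega>" using closure_duct_part(1)[OF fc, of q \<sigma>] q by blast
    then have qU: "q \<in> UNIV \<times> closure \<Omega>" by (auto simp: mem_Times_iff)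
    define c where "c = \<beta> p (snd q)"
    have c: "0 \<le> c" unfolding c_def by (rule \<beta>0[OF y])
    show "\<exists>l. (W p \<longlongrightarrow> l) (at q within ?A) \<and> (1 + \<sigma> * fst q = 0 \<longrightarrow> 0 \<le> \<sigma> * fst l) \<and>
        (fst q = f (snd q) \<longrightarrow> \<sigma> * (l \<bullet> (1, - Df (snd q))) \<le> 0) \<and>
        (\<forall>\<nu>. snd q \<in> frontier \<Omega> \<longrightarrow> outward_unit_normal \<Omega> (snd q) \<nu> \<longrightarrow> l \<bullet> (0, \<nu>) \<le> 0)"
    proof (intro exI[of _ "c *\<^sub>R l"] conjI impI allI)
      show "(W p \<longlongrightarrow> c *\<^sub>R l) (at q within ?A)"
        unfolding W_def c_def by (intro tendsto_scaleR l tendsto_snd_within_duct_part[OF \<beta>c(1) qU])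
      show "0 \<le> \<sigma> * fst (c *\<^sub>R l)" if "1 + \<sigma> * fst q = 0"
        using mult_nonneg_nonneg[OF c l(2)[OF that]] by (simp add: mult.left_commute)
      show "\<sigma> * (c *\<^sub>R l \<bullet> (1, - Df (snd q))) \<le> 0" if "fst q = f (snd q)"
        using mult_nonneg_nonpos[OF c l(3)[OF that]] unfolding inner_scaleR_left by (simp only: mult.left_commute)
      show "c *\<^sub>R l \<bullet> (0, \<nu>) \<le> 0" if "snd q \<in> frontier \<Omega>" "outward_unit_normal \<Omega> (snd q) \<nu>" for \<nu>
        using mult_nonneg_nonpos[OF c l(4)[OF that]] unfolding inner_scaleR_left .
    qed
  qed
  have "(\<Sum>p\<in>P. e p x) = d x" if x: "x \<in> ?A" for x
  proof -
    have "(\<Sum>p\<in>P. e p x) = (\<Sum>p\<in>P. \<beta> p (snd x)) * d x + V x \<bullet> (0, \<Sum>p\<in>P. \<beta>' p (snd x))"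
      by (simp add: e_def sum.distrib sum_distrib_right inner_sum_right inner_prod_def[where x = "V x"] del: inner_prod_def)
    then show ?thesis using \<beta>1[OF sndA[OF x]] by (simp add: zero_prod_def[symmetric])
  qed
  then have "(LINT x:?A|lborel. d x) = (LINT x:?A|lborel. (\<Sum>p\<in>P. e p x))"
    using A(1) by (intro set_lebesgue_integral_cong) auto
  also have "\<dots> = (\<Sum>p\<in>P. LINT x:?A|lborel. e p x)"
    by (rule set_integral_sum_fin[OF P(2)])
      (rule set_integrable_bounded_continuous[OF A C1_div_continuous[OF WC] eb])
  also have "\<dots> \<le> 0" using nonpos by (rule sum_nonpos)
  finally show ?thesis .
qed

text \<open>A positive value of \<open>d\<close> would persist on an open set, which is not
  negligible. This turns each integral inequality into a pointwise identity.\<close>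

lemma continuous_nonneg_integral_eq_0:
  fixes d :: "'a::euclidean_space \<Rightarrow> real"
  assumes "open A" "bounded A" "continuous_on A d" "bounded (d ` A)" "\<And>x. x \<in> A \<Longrightarrow> 0 \<le> d x"
    "(LINT x:A|lborel. d x) \<le> 0" "x \<in> A"
  shows "d x = 0"
proof (rule ccontr)
  assume "d x \<noteq> 0"
  then have dx: "0 < d x" using assms(5,7) by force
  have int: "set_integrable lborel A d" by (rule set_integrable_bounded_continuous) fact+
  have "0 \<le> (LINT x:A|lborel. d x)"
    unfolding set_lebesgue_integral_def using assms(5) by (intro integral_nonneg_AE AE_I2) (simp add: indicator_def)
  then have "(LINT x|lborel. indicator A x *\<^sub>R d x) = 0" using assms(6) by (simp add: set_lebesgue_integral_def)
  then have ae: "AE x in lborel. indicator A x *\<^sub>R d x = 0"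
    using int assms(5) by (subst (asm) integral_nonneg_eq_0_iff_AE) (auto simp: set_integrable_def indicator_def intro!: AE_I2)
  define U where "U = A \<inter> d -` {0<..}"
  have U: "open U" "x \<in> U"
    unfolding U_def using continuous_open_preimage[OF assms(3,1), of "{0<..}"] dx assms(7) by auto
  have "AE x in lborel. x \<notin> U" using ae by eventually_elim (auto simp: U_def indicator_def)
  then have "U \<in> null_sets lborel"
    using U(1) by (subst AE_iff_null_sets) auto
  then have "emeasure lborel U = 0" by auto
  moreover have "negligible U" using \<open>U \<in> null_sets lborel\<close> by (simp add: negligible_iff_null_sets null_sets_completionI)
  ultimately show False using open_not_negligible[OF U(1)] U(2) by blast
qed

section \<open>Gas dynamics\<close>

locale gas =
  fixes \<gamma> b0 :: real
  assumes \<gamma>: "1 \<le> \<gamma>" and b0: "1 < \<gamma> \<longrightarrow> 0 < 1 + (\<gamma> - 1) * b0"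
begin

abbreviation R :: "real \<Rightarrow> real" where "R \<equiv> rho \<gamma> b0"
abbreviation cs :: real where "cs \<equiv> c_star \<gamma> b0"

text \<open>The squared local sound speed as a function of \<open>q = |grad phi|^2\<close>.\<close>
definition c2 :: "real \<Rightarrow> real" where "c2 q = 1 + (\<gamma> - 1) * (b0 - q / 2)"

text \<open>The pressure, density to the power \<open>\<gamma>\<close> divided by
  \<open>\<gamma>\<close>, as a function of the squared speed; for \<open>\<gamma> = 1\<close> it
  coincides with the density.\<close>

definition pr :: "real \<Rightarrow> real" where
  "pr q = (if \<gamma> = 1 then exp (b0 - q / 2) else c2 q powr (\<gamma> / (\<gamma> - 1)) / \<gamma>)"

text \<open>\<open>flux\<close> is the mass flux of a velocity \<open>G\<close>, and
  \<open>flux'\<close> below is its derivative at \<open>G\<close> in direction \<open>w\<close>,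
  paired with \<open>\<nu>\<close>. Both are stated for any inner product space, so that the scalar
  mass flux is a special case.\<close>

definition flux :: "'a::real_inner \<Rightarrow> 'a" where "flux G = R ((norm G)\<^sup>2) *\<^sub>R G"

definition flux' :: "'a::real_inner \<Rightarrow> 'a \<Rightarrow> 'a \<Rightarrow> real" where
  "flux' G w \<nu> = R ((norm G)\<^sup>2) * (w \<bullet> \<nu> - (G \<bullet> w) * (G \<bullet> \<nu>) / c2 ((norm G)\<^sup>2))"

lemma rho_pos: "0 < c2 q \<Longrightarrow> 0 < R q"
  by (simp add: rho_def c2_def)

lemma DERIV_c2: "(c2 has_real_derivative - (\<gamma> - 1) / 2) (at q)"
  unfolding c2_def[abs_def] by (auto intro!: derivative_eq_intros simp: field_simps)

lemma DERIV_c2_powr: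
  assumes "0 < c2 q"
  shows "((\<lambda>q. c2 q powr r) has_real_derivative (r * c2 q powr (r - 1)) * (- (\<gamma> - 1) / 2)) (at q)"
  by (rule DERIV_chain2[where f = "\<lambda>z. z powr r" and g = c2, OF has_real_derivative_powr[OF assms] DERIV_c2])

lemma DERIV_rho:
  assumes pos: "0 < c2 q"
  shows "(R has_real_derivative - R q / (2 * c2 q)) (at q)"
proof (cases "\<gamma> = 1")
  case True
  have "((\<lambda>q. exp (b0 - q / 2)) has_real_derivative exp (b0 - q / 2) * (- 1 / 2)) (at q)"
    by (auto intro!: derivative_eq_intros)
  moreover have "R = (\<lambda>q. exp (b0 - q / 2))" "c2 q = 1"
    unfolding rho_def[abs_def] c2_def using True by auto
  ultimately show ?thesis by simp
next
  case False
  then have R: "R = (\<lambda>q. c2 q powr (1 / (\<gamma> - 1)))" by (simp add: fun_eq_iff rho_def c2_def)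
  have p: "c2 q powr (1 / (\<gamma> - 1) - 1) = c2 q powr (1 / (\<gamma> - 1)) / c2 q"
    using pos by (simp add: powr_diff)
  have eq: "(1 / (\<gamma> - 1) * c2 q powr (1 / (\<gamma> - 1) - 1)) * (- (\<gamma> - 1) / 2) =
      - (c2 q powr (1 / (\<gamma> - 1)) / c2 q) / 2"
  proof -
    have "1 / g * x * (- g / 2) = - x / 2" if "g \<noteq> 0" for g x :: real using that by (simp add: field_simps)
    then show ?thesis unfolding p using False by (metis eq_iff_diff_eq_0)
  qed
  show ?thesis unfolding R by (rule DERIV_cong[OF DERIV_c2_powr[OF pos]]) (subst eq, simp)
qed

lemma DERIV_pr:
  assumes pos: "0 < c2 q"
  shows "(pr has_real_derivative - R q / 2) (at q)"
proof (cases "\<gamma> = 1")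
  case True
  have "((\<lambda>q. exp (b0 - q / 2)) has_real_derivative exp (b0 - q / 2) * (- 1 / 2)) (at q)"
    by (auto intro!: derivative_eq_intros)
  moreover have "R = (\<lambda>q. exp (b0 - q / 2))" "pr = (\<lambda>q. exp (b0 - q / 2))"
    unfolding rho_def[abs_def] pr_def[abs_def] using True by auto
  ultimately show ?thesis by simp
next
  case False
  have g: "\<gamma> \<noteq> 0" "\<gamma> - 1 \<noteq> 0" using \<gamma> False by auto
  have R: "R q = c2 q powr (1 / (\<gamma> - 1))" and pr: "pr = (\<lambda>q. c2 q powr (\<gamma> / (\<gamma> - 1)) / \<gamma>)"
    using False by (auto simp: rho_def c2_def pr_def)
  have e: "\<gamma> / (\<gamma> - 1) - 1 = 1 / (\<gamma> - 1)" using g by (simp add: field_simps)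
  have "(\<gamma> / g * x) * (- g / 2) / \<gamma> = - x / 2" if "g \<noteq> 0" for g x :: real
    using that g(1) by (simp add: field_simps)
  from this[OF g(2)] have "(\<gamma> / (\<gamma> - 1) * x) * (- (\<gamma> - 1) / 2) / \<gamma> = - x / 2" for x .
  then show ?thesis
    unfolding pr R by (intro DERIV_cong[OF DERIV_cdivide[OF DERIV_c2_powr[OF pos]]]) (simp only: e)
qed

lemma isCont_rho: "0 < c2 q \<Longrightarrow> isCont R q"
  using DERIV_rho DERIV_isCont by blast

lemma isCont_pr: "0 < c2 q \<Longrightarrow> isCont pr q"
  using DERIV_pr DERIV_isCont by blast

lemma isCont_c2: "isCont c2 q"
  using DERIV_c2 DERIV_isCont by blast

lemma tendsto_c2 [tendsto_intros]: "(u \<longlongrightarrow> l) F \<Longrightarrow> ((\<lambda>x. c2 (u x)) \<longlongrightarrow> c2 l) F"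
  by (rule isCont_tendsto_compose[OF isCont_c2])

lemma c2_antimono: "q \<le> q' \<Longrightarrow> c2 q' \<le> c2 q"
  using \<gamma> mult_left_mono[of "b0 - q' / 2" "b0 - q / 2" "\<gamma> - 1"] by (simp add: c2_def)

text \<open>One identity covers both formulas for the critical speed, so the case
  \<open>\<gamma> = 1\<close> need not be separated in what follows.\<close>

lemma cs_sq: "cs\<^sup>2 * (\<gamma> + 1) / 2 = 1 + (\<gamma> - 1) * b0" and cs_pos: "0 < cs"
proof -
  have "0 < 1 + (\<gamma> - 1) * b0" using \<gamma> b0 by (cases "\<gamma> = 1") auto
  then have p: "0 < 2 / (\<gamma> + 1) * (1 + (\<gamma> - 1) * b0)" using \<gamma> by (intro mult_pos_pos divide_pos_pos) auto
  show "0 < cs" using p by (simp add: c_star_def)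
  have g: "\<gamma> + 1 \<noteq> 0" using \<gamma> by auto
  show "cs\<^sup>2 * (\<gamma> + 1) / 2 = 1 + (\<gamma> - 1) * b0"
  proof (cases "\<gamma> = 1")
    case False
    then have "cs\<^sup>2 = 2 / (\<gamma> + 1) * (1 + (\<gamma> - 1) * b0)" using p by (simp add: c_star_def)
    then show ?thesis using g by (simp add: field_simps)
  qed (simp add: c_star_def)
qed

text \<open>Comparison with the critical speed is comparison with the local sound speed: the two
  differences are positive multiples of each other.\<close>

lemma c2_minus: "c2 q - q = (cs\<^sup>2 - q) * (\<gamma> + 1) / 2"
  using cs_sq by (simp add: c2_def field_simps)

lemma subsonic_iff: "q < c2 q \<longleftrightarrow> q < cs\<^sup>2"
proof -
  have "0 < c2 q - q \<longleftrightarrow> 0 < cs\<^sup>2 - q"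
    unfolding c2_minus using \<gamma> by (simp add: zero_less_mult_iff zero_less_divide_iff)
  then show ?thesis by linarith
qed

text \<open>At the critical speed the sound speed equals it, hence is positive, and it only
  increases at lower speeds. Limits of subsonic states thus stay away from vacuum.\<close>

lemma c2_pos_le_cs:
  assumes "q \<le> cs\<^sup>2" shows "0 < c2 q"
proof -
  have "c2 (cs\<^sup>2) = cs\<^sup>2" using c2_minus[of "cs\<^sup>2"] by simp
  then show ?thesis using c2_antimono[OF assms] zero_less_power[OF cs_pos, of 2] by linarith
qed

lemma c2_pos_norm: "norm G \<le> cs \<Longrightarrow> 0 < c2 ((norm G)\<^sup>2)"
  by (intro c2_pos_le_cs power_mono) auto

lemma tendsto_flux:
  assumes "(G \<longlongrightarrow> l) F" "0 < c2 ((norm l)\<^sup>2)"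
  shows "((\<lambda>x. flux (G x)) \<longlongrightarrow> flux l) F"
  unfolding flux_def
  by (intro tendsto_scaleR isCont_tendsto_compose[OF isCont_rho[OF assms(2)]] tendsto_power tendsto_norm assms(1))

lemma tendsto_flux':
  assumes "(G \<longlongrightarrow> l) F" "(w \<longlongrightarrow> w0) F" "(\<nu> \<longlongrightarrow> \<nu>0) F" "0 < c2 ((norm l)\<^sup>2)"
  shows "((\<lambda>x. flux' (G x) (w x) (\<nu> x)) \<longlongrightarrow> flux' l w0 \<nu>0) F"
  unfolding flux'_def using assms(4)
  by (intro tendsto_intros isCont_tendsto_compose[OF isCont_rho[OF assms(4)]] assms(1-3)) auto

lemma flux'_scale: "flux' G (c *\<^sub>R w) \<nu> = c * flux' G w \<nu>" "flux' G w (c *\<^sub>R \<nu>) = c * flux' G w \<nu>"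
  by (simp_all add: flux'_def algebra_simps)

lemma DERIV_norm_sq_line:
  fixes A w :: "'a::real_inner"
  shows "((\<lambda>\<tau>. (norm (A + \<tau> *\<^sub>R w))\<^sup>2) has_real_derivative 2 * ((A + \<tau> *\<^sub>R w) \<bullet> w)) (at \<tau>)"
  unfolding power2_norm_eq_inner has_field_derivative_def
  by (auto intro!: derivative_eq_intros simp: inner_add_left inner_add_right inner_commute algebra_simps)

lemma DERIV_flux_line:
  fixes A w \<nu> :: "'a::real_inner"
  assumes "0 < c2 ((norm (A + \<tau> *\<^sub>R w))\<^sup>2)"
  shows "((\<lambda>\<tau>. flux (A + \<tau> *\<^sub>R w) \<bullet> \<nu>) has_real_derivative flux' (A + \<tau> *\<^sub>R w) w \<nu>) (at \<tau>)"
proof -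
  let ?G = "A + \<tau> *\<^sub>R w"
  have 1: "((\<lambda>\<tau>. R ((norm (A + \<tau> *\<^sub>R w))\<^sup>2)) has_real_derivative
      (- R ((norm ?G)\<^sup>2) / (2 * c2 ((norm ?G)\<^sup>2))) * (2 * (?G \<bullet> w))) (at \<tau>)"
    by (rule DERIV_chain2[OF DERIV_rho[OF assms] DERIV_norm_sq_line])
  have 2: "((\<lambda>\<tau>. (A + \<tau> *\<^sub>R w) \<bullet> \<nu>) has_real_derivative w \<bullet> \<nu>) (at \<tau>)"
    unfolding has_field_derivative_def by (auto intro!: derivative_eq_intros)
  show ?thesis
    unfolding flux_def inner_scaleR_left
    by (rule DERIV_cong[OF DERIV_mult[OF 1 2]]) (use assms in \<open>simp add: flux'_def field_simps\<close>)
qed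

lemma DERIV_pr_line:
  fixes A w :: "'a::real_inner"
  assumes "0 < c2 ((norm (A + \<tau> *\<^sub>R w))\<^sup>2)"
  shows "((\<lambda>\<tau>. pr ((norm (A + \<tau> *\<^sub>R w))\<^sup>2)) has_real_derivative - (flux (A + \<tau> *\<^sub>R w) \<bullet> w)) (at \<tau>)"
  by (rule DERIV_cong[OF DERIV_chain2[OF DERIV_pr[OF assms] DERIV_norm_sq_line]]) (simp add: flux_def)

text \<open>Ellipticity: by Cauchy-Schwarz the negative term is at most
  \<open>(norm G)^2 / c2\<close> times \<open>w \<bullet> w\<close>, and that ratio is below
  1.\<close>

lemma flux'_subsonic_pos:
  assumes "norm G < cs" "w \<noteq> 0"
  shows "0 < flux' G w w"
proof -
  have q: "(norm G)\<^sup>2 < cs\<^sup>2" using assms(1) by (simp add: power_strict_mono)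
  then have c: "(norm G)\<^sup>2 < c2 ((norm G)\<^sup>2)" by (simp add: subsonic_iff)
  have pos: "0 < c2 ((norm G)\<^sup>2)" by (rule c2_pos_le_cs) (use q in simp)
  have "(G \<bullet> w) * (G \<bullet> w) \<le> (norm G)\<^sup>2 * (norm w)\<^sup>2"
    using Cauchy_Schwarz_ineq[of G w] by (simp add: power2_norm_eq_inner power2_eq_square[of "G \<bullet> w"])
  also have "\<dots> < c2 ((norm G)\<^sup>2) * (norm w)\<^sup>2" using c assms(2) by simp
  finally have "(G \<bullet> w) * (G \<bullet> w) / c2 ((norm G)\<^sup>2) < w \<bullet> w"
    using pos by (simp add: divide_less_eq power2_norm_eq_inner mult.commute)
  then show ?thesis unfolding flux'_def using rho_pos[OF pos] by simp
qed

text \<open>The subsonic states form a convex ball, so the segment from \<open>H\<close> to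
  \<open>G\<close> stays subsonic and the flux increases along it.\<close>

lemma flux_strict_mono:
  fixes G H :: "'a::real_inner"
  assumes "norm G < cs" "norm H < cs" "G \<noteq> H"
  shows "0 < (flux G - flux H) \<bullet> (G - H)"
proof -
  define w where "w = G - H"
  have seg: "norm (H + \<tau> *\<^sub>R w) < cs" if "0 \<le> \<tau>" "\<tau> \<le> 1" for \<tau>
  proof -
    have "H + \<tau> *\<^sub>R w = (1 - \<tau>) *\<^sub>R H + \<tau> *\<^sub>R G" by (simp add: w_def algebra_simps)
    then have "norm (H + \<tau> *\<^sub>R w) \<le> (1 - \<tau>) * norm H + \<tau> * norm G"
      using norm_triangle_ineq[of "(1 - \<tau>) *\<^sub>R H" "\<tau> *\<^sub>R G"] that by simp
    also have "\<dots> < cs" by (rule convex_bound_lt) (use assms that in auto)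
    finally show ?thesis .
  qed
  have "flux (H + 0 *\<^sub>R w) \<bullet> w < flux (H + 1 *\<^sub>R w) \<bullet> w"
  proof (rule DERIV_pos_imp_increasing[of 0 1 "\<lambda>\<tau>. flux (H + \<tau> *\<^sub>R w) \<bullet> w"])
    fix \<tau> :: real assume \<tau>: "0 \<le> \<tau>" "\<tau> \<le> 1"
    have "((\<lambda>\<tau>. flux (H + \<tau> *\<^sub>R w) \<bullet> w) has_real_derivative flux' (H + \<tau> *\<^sub>R w) w w) (at \<tau>)"
      using seg[OF \<tau>] by (intro DERIV_flux_line c2_pos_norm) simp
    moreover have "0 < flux' (H + \<tau> *\<^sub>R w) w w"
      using seg[OF \<tau>] assms(3) by (intro flux'_subsonic_pos) (auto simp: w_def)
    ultimately show "\<exists>y. ((\<lambda>\<tau>. flux (H + \<tau> *\<^sub>R w) \<bullet> w) has_real_derivative y) (at \<tau>) \<and> 0 < y" by blast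
  qed simp
  then show ?thesis by (simp add: w_def inner_diff_left)
qed

lemma mass_flux_strict_mono:
  assumes "0 \<le> u" "u < v" "v < cs"
  shows "R (u\<^sup>2) * u < R (v\<^sup>2) * v"
  using flux_strict_mono[of v u] assms by (simp add: flux_def zero_less_mult_iff)

end

section \<open>The incoming supersonic state\<close>

locale supersonic_gas = gas +
  fixes um :: real
  assumes um: "cs < um" and c2um: "0 < c2 (um\<^sup>2)"
begin

abbreviation m0 :: real where "m0 \<equiv> R (um\<^sup>2) * um"
abbreviation up :: real where "up \<equiv> u_plus \<gamma> b0 um"

lemma um_pos: "0 < um" using um cs_pos by linarith

text \<open>The scalar mass flux strictly decreases from \<open>cs\<close> to \<open>um\<close>, so
  its value at \<open>um\<close> lies strictly between 0 and its value at \<open>cs\<close>. The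
  intermediate value theorem gives a subsonic preimage and strict monotonicity its uniqueness, which
  justifies the definite description.\<close>

lemma u_plus_props: "0 < up" "up < cs" "R (up\<^sup>2) * up = m0"
proof -
  have pos: "0 < c2 (u\<^sup>2)" if "0 \<le> u" "u \<le> um" for u
    using c2um c2_antimono[of "u\<^sup>2" "um\<^sup>2"] that by (simp add: power_mono order_less_le_trans)
  have D: "((\<lambda>u. R (u\<^sup>2) * u) has_real_derivative flux' u 1 1) (at u)" if "0 \<le> u" "u \<le> um" for u
    using DERIV_flux_line[of 0 u "1::real" 1] pos[OF that] by (simp add: flux_def)
  have "R (um\<^sup>2) * um < R (cs\<^sup>2) * cs"
  proof (rule DERIV_neg_imp_decreasing_open[OF um])
    fix u assume u: "cs < u" "u < um"
    have u0: "0 \<le> u" using u cs_pos by linarith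
    have "\<not> u\<^sup>2 < cs\<^sup>2" using u cs_pos by (simp add: power_mono not_less)
    moreover have "u\<^sup>2 \<noteq> cs\<^sup>2" using u cs_pos by (auto simp: power2_eq_iff)
    ultimately have "c2 (u\<^sup>2) - u\<^sup>2 < 0" unfolding c2_minus using \<gamma> by (simp add: mult_less_0_iff)
    then have "flux' u 1 1 < 0"
      using rho_pos[OF pos] pos[of u] u u0
      by (simp add: flux'_def mult_less_0_iff power2_eq_square)
    then show "\<exists>y. ((\<lambda>u. R (u\<^sup>2) * u) has_real_derivative y) (at u) \<and> y < 0"
      using D[of u] u0 u by auto
  next
    show "continuous_on {cs..um} (\<lambda>u. R (u\<^sup>2) * u)"
      using cs_pos by (intro continuous_at_imp_continuous_on ballI DERIV_isCont[OF D]) auto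
  qed
  moreover have "0 < m0" using rho_pos[OF c2um] um_pos by simp
  ultimately have "\<exists>u\<ge>0. u \<le> cs \<and> R (u\<^sup>2) * u = m0"
    using cs_pos um by (intro IVT2'[of "\<lambda>u. - (R (u\<^sup>2) * u)" cs "- m0" 0, simplified]
        continuous_at_imp_continuous_on ballI continuous_intros DERIV_isCont[OF D]) auto
  then obtain u where u: "0 \<le> u" "u \<le> cs" "R (u\<^sup>2) * u = m0" by blast
  then have u': "0 < u" "u < cs"
    using \<open>R (um\<^sup>2) * um < R (cs\<^sup>2) * cs\<close> \<open>0 < m0\<close> by (auto simp: order_less_le)
  have "up = u"
    unfolding u_plus_def
  proof (rule the_equality)
    fix v assume v: "0 < v \<and> v < cs \<and> R (v\<^sup>2) * v = m0"
    show "v = u"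
      using mass_flux_strict_mono[of u v] mass_flux_strict_mono[of v u] v u u'
      by (cases u v rule: linorder_cases) auto
  qed (use u u' in auto)
  then show "0 < up" "up < cs" "R (up\<^sup>2) * up = m0" using u u' by auto
qed

abbreviation G0 :: pt3 where "G0 \<equiv> (um, 0)"

text \<open>The squared Mach number of the incoming state. A surface with normal
  \<open>(1, - a)\<close> is spacelike for that state when the squared norm of \<open>a\<close> is
  below \<open>mach2 - 1\<close>.\<close>

definition mach2 :: real where "mach2 = um\<^sup>2 / c2 (um\<^sup>2)"

lemma norm_G0 [simp]: "norm G0 = um" using um_pos by (simp add: norm_Pair)

lemma mach2_gt1: "1 < mach2"
proof -
  have "\<not> um\<^sup>2 < cs\<^sup>2" "um\<^sup>2 \<noteq> cs\<^sup>2" using um cs_pos by (auto simp: power2_eq_iff power_mono not_less)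
  then have "c2 (um\<^sup>2) - um\<^sup>2 < 0" unfolding c2_minus using \<gamma> by (simp add: mult_less_0_iff)
  then show ?thesis using c2um by (simp add: mach2_def)
qed

text \<open>The flux, across a surface with normal \<open>(1, -a)\<close>, of the conserved \<open>x1\<close>-momentum relative to
  the incoming state. It vanishes to second order at \<open>G0\<close>, so it acts as an energy of the
  perturbation \<open>G - G0\<close>.\<close>
definition rel_energy :: "pt3 \<Rightarrow> pt2 \<Rightarrow> real" where
  "rel_energy G a = (flux G \<bullet> (1, - a)) * (fst G - um) + (pr ((norm G)\<^sup>2) - pr (um\<^sup>2))"

text \<open>The expression is the quadratic part of \<open>rel_energy\<close> at \<open>G0\<close>.
  Completing the square in the transverse component leaves a negative multiple of
  \<open>(mach2 - 1 - (norm a)^2) * w1^2\<close> plus the squared norm of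
  \<open>v + w1 a\<close>.\<close>

lemma flux'_G0_neg:
  assumes "(norm a)\<^sup>2 < mach2 - 1" "w \<noteq> 0"
  shows "flux' G0 w (1, - a) * fst w - flux' G0 w w / 2 < 0"
proof -
  obtain w1 v where w: "w = (w1, v)" by (cases w)
  define R0 where "R0 = R (um\<^sup>2)"
  have R0: "0 < R0" using rho_pos[OF c2um] by (simp add: R0_def)
  have 1: "flux' G0 w (1, - a) = R0 * (w1 - v \<bullet> a - mach2 * w1)"
    unfolding flux'_def norm_G0 by (simp add: w R0_def mach2_def power2_eq_square)
  have 2: "flux' G0 w w = R0 * (w1\<^sup>2 + v \<bullet> v - mach2 * w1\<^sup>2)"
    unfolding flux'_def norm_G0 by (simp add: w R0_def mach2_def power2_eq_square)
  have 3: "(v + w1 *\<^sub>R a) \<bullet> (v + w1 *\<^sub>R a) = v \<bullet> v + 2 * w1 * (v \<bullet> a) + w1\<^sup>2 * (norm a)\<^sup>2"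
    by (simp add: power2_norm_eq_inner power2_eq_square[of w1] inner_add_left inner_add_right inner_commute algebra_simps)
  have "flux' G0 w (1, - a) * fst w - flux' G0 w w / 2 =
      - (R0 / 2) * ((mach2 - 1 - (norm a)\<^sup>2) * w1\<^sup>2 + (v + w1 *\<^sub>R a) \<bullet> (v + w1 *\<^sub>R a))"
    unfolding 1 2 3 by (simp add: w power2_eq_square field_simps)
  moreover have "0 < (mach2 - 1 - (norm a)\<^sup>2) * w1\<^sup>2 + (v + w1 *\<^sub>R a) \<bullet> (v + w1 *\<^sub>R a)"
  proof (cases "w1 = 0")
    case True
    then show ?thesis using assms(2) by (simp add: w zero_prod_def)
  next
    case False
    then show ?thesis using assms(1) by (intro add_pos_nonneg) auto
  qed
  ultimately show ?thesis using R0 by (simp add: mult_neg_pos)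
qed

lemma c2_pos_near: "\<exists>\<epsilon>>0. \<forall>G. norm (G - G0) < \<epsilon> \<longrightarrow> 0 < c2 ((norm G)\<^sup>2)"
proof -
  have "((\<lambda>G. c2 ((norm G)\<^sup>2)) \<longlongrightarrow> c2 ((norm G0)\<^sup>2)) (nhds G0)"
    by (intro tendsto_intros filterlim_ident)
  then have "\<forall>\<^sub>F G in nhds G0. 0 < c2 ((norm G)\<^sup>2)"
    by (rule order_tendstoD(1)) (use c2um in simp)
  then show ?thesis by (simp add: eventually_nhds_metric dist_norm)
qed

text \<open>The linear terms cancel because \<open>flux G0\<close> is horizontal. What remains is a
  mean value term for the flux and a Taylor remainder for the pressure, evaluated at two unrelated
  points of the segment.\<close>

lemma rel_energy_expand:
  assumes \<epsilon>: "\<And>G. norm (G - G0) < \<epsilon> \<Longrightarrow> 0 < c2 ((norm G)\<^sup>2)" and G: "norm (G - G0) < \<epsilon>"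
  shows "\<exists>s t. 0 < s \<and> s < 1 \<and> 0 < t \<and> t < 1 \<and> rel_energy G a =
    flux' (G0 + s *\<^sub>R (G - G0)) (G - G0) (1, - a) * fst (G - G0)
      - flux' (G0 + t *\<^sub>R (G - G0)) (G - G0) (G - G0) / 2"
proof -
  define w where "w = G - G0"
  have seg: "0 < c2 ((norm (G0 + \<tau> *\<^sub>R w))\<^sup>2)" if "0 \<le> \<tau>" "\<tau> \<le> 1" for \<tau>
  proof (rule \<epsilon>)
    have "\<tau> * norm w \<le> 1 * norm w" using that by (intro mult_right_mono) auto
    then show "norm (G0 + \<tau> *\<^sub>R w - G0) < \<epsilon>" using that G by (simp add: w_def)
  qed
  obtain s where s: "0 < s" "s < 1"
    "flux (G0 + 1 *\<^sub>R w) \<bullet> (1, - a) - flux (G0 + 0 *\<^sub>R w) \<bullet> (1, - a) = (1 - 0) * flux' (G0 + s *\<^sub>R w) w (1, - a)"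
    using MVT2[of 0 1 "\<lambda>\<tau>. flux (G0 + \<tau> *\<^sub>R w) \<bullet> (1, - a)" "\<lambda>\<tau>. flux' (G0 + \<tau> *\<^sub>R w) w (1, - a)"]
      DERIV_flux_line[OF seg] by auto
  \<comment> \<open>The pressure along the segment and its first two derivatives, indexed as the
    Maclaurin expansion of order 2 expects.\<close>
  define p :: "nat \<Rightarrow> real \<Rightarrow> real" where "p n \<tau> = (if n = 0 then pr ((norm (G0 + \<tau> *\<^sub>R w))\<^sup>2)
     else if n = 1 then - (flux (G0 + \<tau> *\<^sub>R w) \<bullet> w) else - flux' (G0 + \<tau> *\<^sub>R w) w w)" for n \<tau>
  have "\<exists>t>0. t < 1 \<and> p 0 1 = (\<Sum>m<2. p m 0 / fact m * 1 ^ m) + p 2 t / fact 2 * 1 ^ 2"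
  proof (rule Maclaurin)
    show "\<forall>m t. m < 2 \<and> 0 \<le> t \<and> t \<le> 1 \<longrightarrow> DERIV (p m) t :> p (Suc m) t"
    proof (intro allI impI)
      fix m :: nat and t :: real assume mt: "m < 2 \<and> 0 \<le> t \<and> t \<le> 1"
      then have c: "0 < c2 ((norm (G0 + t *\<^sub>R w))\<^sup>2)" using seg by blast
      have "m = 0 \<or> m = 1" using mt by linarith
      then show "DERIV (p m) t :> p (Suc m) t"
        using DERIV_pr_line[OF c] DERIV_minus[OF DERIV_flux_line[OF c, of w]]
        by (auto simp: p_def[abs_def])
    qed
  qed auto
  then obtain t where t: "0 < t" "t < 1" "p 0 1 = (\<Sum>m<2. p m 0 / fact m * 1 ^ m) + p 2 t / fact 2 * 1 ^ 2"
    by blast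
  have p: "pr ((norm G)\<^sup>2) = pr (um\<^sup>2) - flux G0 \<bullet> w - flux' (G0 + t *\<^sub>R w) w w / 2"
  proof -
    have "p 0 1 = pr ((norm G)\<^sup>2)" "p 0 0 = pr (um\<^sup>2)" "p 2 t = - flux' (G0 + t *\<^sub>R w) w w"
      by (simp_all add: p_def w_def)
    moreover have "p 1 0 = - (flux G0 \<bullet> w)" by (simp add: p_def)
    moreover have "(\<Sum>m<2. p m 0 / fact m * 1 ^ m) = p 0 0 + p 1 0" by (simp add: numeral_2_eq_2)
    ultimately show ?thesis using t(3) by simp
  qed
  have f0: "flux G0 = (R (um\<^sup>2) * um, 0)" by (simp only: flux_def norm_G0) simp
  have "flux G \<bullet> (1, - a) = R (um\<^sup>2) * um + flux' (G0 + s *\<^sub>R w) w (1, - a)"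
    using s(3) by (simp add: w_def f0)
  then have "rel_energy G a = flux' (G0 + s *\<^sub>R w) w (1, - a) * fst w - flux' (G0 + t *\<^sub>R w) w w / 2"
    unfolding rel_energy_def p f0 by (simp add: w_def inner_prod_def algebra_simps)
  then show ?thesis using s t unfolding w_def by blast
qed

text \<open>After division by the squared size of the perturbation, a sequence of counterexamples
  converges to a unit direction and a slope still within \<open>\<mu>\<close>, at which the
  quadratic form would be nonnegative. The margin \<open>\<mu> < mach2 - 1\<close> is what makes the
  bound uniform in the slope.\<close>

lemma rel_energy_neg:
  assumes \<mu>: "\<mu> < mach2 - 1"
  shows "\<exists>\<epsilon>>0. \<forall>G a. norm (G - G0) < \<epsilon> \<longrightarrow> (norm a)\<^sup>2 \<le> \<mu> \<longrightarrow> G \<noteq> G0 \<longrightarrow> rel_energy G a < 0"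
proof (rule ccontr)
  assume neg: "\<not> ?thesis"
  obtain \<epsilon>0 where \<epsilon>0: "0 < \<epsilon>0" "\<And>G. norm (G - G0) < \<epsilon>0 \<Longrightarrow> 0 < c2 ((norm G)\<^sup>2)"
    using c2_pos_near by blast
  have "\<exists>G a. norm (G - G0) < min \<epsilon>0 (1 / real (Suc n)) \<and> (norm a)\<^sup>2 \<le> \<mu> \<and> G \<noteq> G0 \<and> 0 \<le> rel_energy G a" for n
  proof -
    have "0 < min \<epsilon>0 (1 / real (Suc n))" using \<epsilon>0(1) by simp
    then show ?thesis using neg by (meson not_less)
  qed
  then obtain G a where G: "\<And>n. norm (G n - G0) < min \<epsilon>0 (1 / real (Suc n))" "\<And>n. (norm (a n))\<^sup>2 \<le> \<mu>"
    "\<And>n. G n \<noteq> G0" "\<And>n. 0 \<le> rel_energy (G n) (a n)" by metis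
  have Ge: "norm (G n - G0) < \<epsilon>0" "norm (G n - G0) < 1 / real (Suc n)" for n using G(1)[of n] by auto
  have "\<exists>s t. 0 < s \<and> s < 1 \<and> 0 < t \<and> t < 1 \<and> rel_energy (G n) (a n) =
      flux' (G0 + s *\<^sub>R (G n - G0)) (G n - G0) (1, - a n) * fst (G n - G0)
      - flux' (G0 + t *\<^sub>R (G n - G0)) (G n - G0) (G n - G0) / 2" for n
    by (rule rel_energy_expand[of \<epsilon>0]) (use \<epsilon>0(2) Ge(1) in blast)+
  then obtain s t where st: "\<And>n. 0 < s n" "\<And>n. s n < 1" "\<And>n. 0 < t n" "\<And>n. t n < (1::real)"
    "\<And>n. rel_energy (G n) (a n) = flux' (G0 + s n *\<^sub>R (G n - G0)) (G n - G0) (1, - a n) * fst (G n - G0)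
      - flux' (G0 + t n *\<^sub>R (G n - G0)) (G n - G0) (G n - G0) / 2"
    by metis
  define w where "w n = G n - G0" for n
  define u where "u n = (1 / norm (w n)) *\<^sub>R w n" for n
  have wn: "norm (w n) \<noteq> 0" "0 < norm (w n)" for n using G(3) by (auto simp: w_def)
  have un: "norm (u n) = 1" for n using wn[of n] by (simp add: u_def)
  have wu: "w n = norm (w n) *\<^sub>R u n" for n using wn[of n] by (simp add: u_def)
  \<comment> \<open>The energy divided by the squared length of the perturbation: both remainders
    are homogeneous of degree two, so only the unit direction \<open>u n\<close> is left in
    them.\<close>
  define Z where "Z n = flux' (G0 + s n *\<^sub>R w n) (u n) (1, - a n) * fst (u n) - flux' (G0 + t n *\<^sub>R w n) (u n) (u n) / 2" for n
  have Z: "0 \<le> Z n" for n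
  proof -
    have f: "fst (w n) = norm (w n) * fst (u n)" using arg_cong[OF wu[of n], of fst] by simp
    have "rel_energy (G n) (a n) = flux' (G0 + s n *\<^sub>R w n) (norm (w n) *\<^sub>R u n) (1, - a n) * fst (w n)
      - flux' (G0 + t n *\<^sub>R w n) (norm (w n) *\<^sub>R u n) (norm (w n) *\<^sub>R u n) / 2"
      using st(5)[of n] wu[of n] by (simp only: w_def[symmetric])
    also have "\<dots> = (norm (w n))\<^sup>2 * Z n"
      unfolding flux'_scale f Z_def by (simp add: power2_eq_square algebra_simps)
    finally show ?thesis using G(4)[of n] wn[of n] by (simp add: zero_le_mult_iff)
  qed
  have an: "norm (a n) \<le> sqrt \<mu>" for n using G(2)[of n] by (simp add: real_le_rsqrt)
  have "bounded (range (\<lambda>n. (u n, a n)))"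
  proof (rule boundedI)
    fix x assume "x \<in> range (\<lambda>n. (u n, a n))"
    then obtain n where "x = (u n, a n)" by blast
    then show "norm x \<le> 1 + sqrt \<mu>" using norm_Pair_le[of "u n" "a n"] un[of n] an[of n] by simp
  qed
  then obtain l r where r: "strict_mono r" "((\<lambda>n. (u n, a n)) \<circ> r) \<longlonglongrightarrow> l"
    using bounded_imp_convergent_subsequence by blast
  define u0 where "u0 = fst l" define a0 where "a0 = snd l"
  have ul: "(\<lambda>n. u (r n)) \<longlonglongrightarrow> u0" and al: "(\<lambda>n. a (r n)) \<longlonglongrightarrow> a0"
    using tendsto_fst[OF r(2)] tendsto_snd[OF r(2)] by (auto simp: o_def u0_def a0_def)
  have wl: "w \<longlonglongrightarrow> 0"
  proof (rule Lim_null_comparison)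
    show "\<forall>\<^sub>F n in sequentially. norm (w n) \<le> 1 / real (Suc n)"
      using Ge(2) by (intro always_eventually) (auto simp: w_def intro: less_imp_le)
    show "(\<lambda>n. 1 / real (Suc n)) \<longlonglongrightarrow> 0" using LIMSEQ_inverse_real_of_nat by (simp add: inverse_eq_divide)
  qed
  have sw: "(\<lambda>n. G0 + c n *\<^sub>R w n) \<longlonglongrightarrow> G0" if "\<And>n. 0 < c n" "\<And>n. c n < (1::real)" for c
  proof -
    have "(\<lambda>n. c n *\<^sub>R w n) \<longlonglongrightarrow> 0"
    proof (rule Lim_null_comparison[OF _ tendsto_norm_zero[OF wl]], rule always_eventually, rule allI)
      fix n show "norm (c n *\<^sub>R w n) \<le> norm (w n)"
        using that[of n] by (simp add: mult_left_le_one_le less_imp_le)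
    qed
    from tendsto_add[OF tendsto_const this, of G0] show ?thesis by simp
  qed
  have c: "0 < c2 ((norm G0)\<^sup>2)" using c2um by simp
  have "(\<lambda>n. Z (r n)) \<longlonglongrightarrow> flux' G0 u0 (1, - a0) * fst u0 - flux' G0 u0 u0 / 2"
    unfolding Z_def
    using LIMSEQ_subseq_LIMSEQ[OF sw r(1), of s] LIMSEQ_subseq_LIMSEQ[OF sw r(1), of t] st ul al c
    by (intro tendsto_intros tendsto_flux') (auto simp: o_def)
  then have "0 \<le> flux' G0 u0 (1, - a0) * fst u0 - flux' G0 u0 u0 / 2"
    by (rule LIMSEQ_le_const) (use Z in blast)
  moreover have "norm u0 = 1"
    using tendsto_norm[OF ul] un by (simp add: LIMSEQ_const_iff)
  moreover have "(norm a0)\<^sup>2 \<le> \<mu>"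
    using tendsto_power[OF tendsto_norm[OF al], of 2] by (rule LIMSEQ_le_const2) (use G(2) in blast)
  ultimately show False using flux'_G0_neg[of a0 u0] \<mu> by force
qed

text \<open>The normal mass flux is monotone as long as the normal speed is below the sound speed, so a
  jump to a slower state with the same normal mass flux needs a supersonic normal speed upstream.\<close>
lemma shock_spacelike_G0:
  assumes gp: "norm (G0 - k *\<^sub>R (1, - a)) \<le> cs"
    and rh: "flux (G0 - k *\<^sub>R (1, - a)) \<bullet> (1, - a) = flux G0 \<bullet> (1, - a)"
  shows "(norm a)\<^sup>2 < mach2 - 1"
proof (rule ccontr)
  assume neg: "\<not> ?thesis"
  define \<nu> :: pt3 where "\<nu> = (1, - a)"
  define N where "N = 1 + (norm a)\<^sup>2"
  have N: "1 \<le> N" by (simp add: N_def)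
  have \<nu>: "\<nu> \<bullet> \<nu> = N" "G0 \<bullet> \<nu> = um" "\<nu> \<bullet> G0 = um" by (auto simp: \<nu>_def N_def power2_norm_eq_inner)
  have q: "(norm (G0 + s *\<^sub>R (- \<nu>)))\<^sup>2 = um\<^sup>2 - s * (2 * um - s * N)" for s
    unfolding power2_norm_eq_inner
    by (simp add: inner_diff_left inner_diff_right \<nu> power2_eq_square algebra_simps)
  have d: "(G0 + s *\<^sub>R (- \<nu>)) \<bullet> \<nu> = um - s * N" for s by (simp add: inner_diff_left \<nu>)
  \<comment> \<open>The negated claim says that the upstream speed normal to the surface does not
    exceed the sound speed.\<close>
  have umN: "um\<^sup>2 \<le> c2 (um\<^sup>2) * N"
    using neg c2um by (simp add: mach2_def N_def field_simps)
  have "(norm (G0 + k *\<^sub>R (- \<nu>)))\<^sup>2 \<le> cs\<^sup>2" using gp by (intro power_mono) (auto simp: \<nu>_def)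
  also have "\<dots> < um\<^sup>2" using um cs_pos by (intro power_strict_mono) auto
  \<comment> \<open>The state behind is slower than \<open>G0\<close>, which confines
    \<open>k\<close> strictly between 0 and \<open>2 * um / N\<close>. All states up to
    \<open>k\<close> on the path are then no faster than \<open>G0\<close>, so their sound speed is
    at least that of \<open>G0\<close>.\<close>
  finally have kk: "0 < k * (2 * um - k * N)" unfolding q by simp
  have k: "0 < k" "k * N < 2 * um"
  proof -
    show "0 < k"
    proof (rule ccontr)
      assume "\<not> 0 < k"
      then have "0 \<le> 2 * um - k * N"
        using um_pos N by (simp add: mult_nonpos_nonneg order_trans[of "k * N" 0])
      then have "k * (2 * um - k * N) \<le> 0" using \<open>\<not> 0 < k\<close> by (intro mult_nonpos_nonneg) auto
      then show False using kk by simp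
    qed
    then show "k * N < 2 * um" using kk by (simp add: zero_less_mult_iff)
  qed
  have sN: "0 \<le> s * (2 * um - s * N) \<and> s * N < 2 * um" if "0 \<le> s" "s \<le> k" for s
  proof -
    have "s * N \<le> k * N" using that N by (intro mult_right_mono) auto
    then have "s * N < 2 * um" using k(2) by linarith
    then show ?thesis using that by (intro conjI mult_nonneg_nonneg) auto
  qed
  have cpos: "c2 (um\<^sup>2) \<le> c2 ((norm (G0 + s *\<^sub>R (- \<nu>)))\<^sup>2)" if "0 \<le> s" "s \<le> k" for s
    using sN[OF that] unfolding q by (intro c2_antimono) simp
  have D: "((\<lambda>s. flux (G0 + s *\<^sub>R (- \<nu>)) \<bullet> \<nu>) has_real_derivative flux' (G0 + s *\<^sub>R (- \<nu>)) (- \<nu>) \<nu>) (at s)"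
    if "0 \<le> s" "s \<le> k" for s
    using cpos[OF that] c2um by (intro DERIV_flux_line) linarith
  have "flux (G0 + k *\<^sub>R (- \<nu>)) \<bullet> \<nu> < flux (G0 + 0 *\<^sub>R (- \<nu>)) \<bullet> \<nu>"
  proof (rule DERIV_neg_imp_decreasing_open[OF k(1), where f = "\<lambda>s. flux (G0 + s *\<^sub>R (- \<nu>)) \<bullet> \<nu>"])
    fix s assume s: "0 < s" "s < k"
    let ?c = "c2 ((norm (G0 + s *\<^sub>R (- \<nu>)))\<^sup>2)"
    have c: "c2 (um\<^sup>2) \<le> ?c" using cpos s by simp
    have "0 < s * N" "s * N < 2 * um" using s N sN[of s] by auto
    \<comment> \<open>Along the path the normal component drops in modulus while the sound speed
      does not, so the normal speed stays below the sound speed and the normal flux strictly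
      decreases. Equal fluxes at the two ends are then impossible.\<close>
    then have "\<bar>um - s * N\<bar> < um" by linarith
    then have "(um - s * N)\<^sup>2 < um\<^sup>2" using abs_square_less_1 power_strict_mono[of "\<bar>um - s * N\<bar>" um 2] by simp
    also have "\<dots> \<le> ?c * N" using umN c N mult_right_mono[OF c, of N] by linarith
    finally have "(um - s * N)\<^sup>2 / ?c < N" using c c2um by (simp add: divide_less_eq mult.commute)
    moreover have "0 < R ((norm (G0 + s *\<^sub>R (- \<nu>)))\<^sup>2)" using c c2um by (intro rho_pos) linarith
    moreover have "flux' (G0 + s *\<^sub>R (- \<nu>)) (- \<nu>) \<nu> =
        R ((norm (G0 + s *\<^sub>R (- \<nu>)))\<^sup>2) * ((um - s * N)\<^sup>2 / ?c - N)"
    proof -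
      have "(G0 + s *\<^sub>R (- \<nu>)) \<bullet> (- \<nu>) = - (um - s * N)" by (simp only: inner_minus_right d)
      moreover have "x * (- N - (- z) * z / c) = x * (z\<^sup>2 / c - N)" for x z c :: real
        by (simp add: power2_eq_square)
      ultimately show ?thesis unfolding flux'_def inner_minus_left d \<nu> by presburger
    qed
    ultimately have "flux' (G0 + s *\<^sub>R (- \<nu>)) (- \<nu>) \<nu> < 0" by (simp add: mult_pos_neg)
    then show "\<exists>y. ((\<lambda>s. flux (G0 + s *\<^sub>R (- \<nu>)) \<bullet> \<nu>) has_real_derivative y) (at s) \<and> y < 0"
      using D[of s] s by auto
  next
    show "continuous_on {0..k} (\<lambda>s. flux (G0 + s *\<^sub>R (- \<nu>)) \<bullet> \<nu>)"
      by (intro continuous_at_imp_continuous_on ballI DERIV_isCont[OF D]) auto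
  qed
  then show False using rh by (simp add: \<nu>_def)
qed

text \<open>Compactness turns the strict inequality at \<open>G0\<close> into a uniform margin
  nearby: violating slopes and jump strengths stay bounded, and their limit would be a shock at
  \<open>G0\<close> that is not spacelike.\<close>

lemma shock_spacelike:
  "\<exists>\<epsilon>>0. \<exists>\<mu><mach2 - 1. \<forall>G a k. norm (G - G0) < \<epsilon> \<longrightarrow> norm a \<le> L \<longrightarrow>
     norm (G - k *\<^sub>R (1, - a)) \<le> cs \<longrightarrow>
     flux (G - k *\<^sub>R (1, - a)) \<bullet> (1, - a) = flux G \<bullet> (1, - a) \<longrightarrow> (norm a)\<^sup>2 \<le> \<mu>"
proof (rule ccontr)
  assume neg: "\<not> ?thesis"
  have "\<exists>G a k. norm (G - G0) < 1 / real (Suc n) \<and> norm a \<le> L \<and> norm (G - k *\<^sub>R (1, - a)) \<le> cs \<and>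
     flux (G - k *\<^sub>R (1, - a)) \<bullet> (1, - a) = flux G \<bullet> (1, - a) \<and> mach2 - 1 - 1 / real (Suc n) < (norm a)\<^sup>2" for n
  proof -
    have "0 < 1 / real (Suc n)" "mach2 - 1 - 1 / real (Suc n) < mach2 - 1" by auto
    then show ?thesis using neg by (meson not_le)
  qed
  then obtain G a k where G: "\<And>n. norm (G n - G0) < 1 / real (Suc n)" "\<And>n. norm (a n) \<le> L"
    "\<And>n. norm (G n - k n *\<^sub>R (1, - a n)) \<le> cs"
    "\<And>n. flux (G n - k n *\<^sub>R (1, - a n)) \<bullet> (1, - a n) = flux (G n) \<bullet> (1, - a n)"
    "\<And>n. mach2 - 1 - 1 / real (Suc n) < (norm (a n))\<^sup>2" by metis
  have t: "(\<lambda>n. 1 / real (Suc n)) \<longlonglongrightarrow> 0" using LIMSEQ_inverse_real_of_nat by (simp add: inverse_eq_divide)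
  have "(\<lambda>n. G n - G0) \<longlonglongrightarrow> 0"
    by (rule Lim_null_comparison[OF _ t]) (use G(1) in \<open>auto intro!: always_eventually less_imp_le\<close>)
  then have Gl: "G \<longlonglongrightarrow> G0" by (simp add: LIM_zero_iff)
  \<comment> \<open>The normal \<open>(1, - a n)\<close> has length at least 1, so the strength of
    the jump is bounded by the sizes of the two states.\<close>
  have kb: "\<bar>k n\<bar> \<le> um + 1 + cs" for n
  proof -
    have "\<bar>k n\<bar> * 1 \<le> \<bar>k n\<bar> * norm ((1, - a n) :: pt3)"
      by (intro mult_left_mono) (auto simp: norm_Pair)
    also have "\<dots> = norm (k n *\<^sub>R ((1, - a n) :: pt3))" by (simp only: norm_scaleR)
    also have "\<dots> = norm (G n - (G n - k n *\<^sub>R (1, - a n)))" by (simp only: diff_diff_eq2 add_diff_cancel_left')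
    also have "\<dots> \<le> norm (G n) + cs" using norm_triangle_ineq4[of "G n"] G(3)[of n] by (meson add_left_mono order_trans)
    also have "norm (G n) \<le> norm G0 + norm (G n - G0)" by (rule norm_triangle_sub)
    also have "norm (G n - G0) \<le> 1" using G(1)[of n] by (rule less_imp_le[OF less_le_trans]) simp
    finally show ?thesis using um_pos by simp
  qed
  have "bounded (range (\<lambda>n. (a n, k n)))"
  proof (rule boundedI)
    fix x assume "x \<in> range (\<lambda>n. (a n, k n))"
    then obtain n where "x = (a n, k n)" by blast
    then show "norm x \<le> L + (um + 1 + cs)" using norm_Pair_le[of "a n" "k n"] G(2)[of n] kb[of n] by simp
  qed
  then obtain l r where r: "strict_mono r" "((\<lambda>n. (a n, k n)) \<circ> r) \<longlonglongrightarrow> l"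
    using bounded_imp_convergent_subsequence by blast
  define a0 where "a0 = fst l" define k0 where "k0 = snd l"
  have al: "(\<lambda>n. a (r n)) \<longlonglongrightarrow> a0" and kl: "(\<lambda>n. k (r n)) \<longlonglongrightarrow> k0"
    using tendsto_fst[OF r(2)] tendsto_snd[OF r(2)] by (auto simp: o_def a0_def k0_def)
  have Gr: "(\<lambda>n. G (r n)) \<longlonglongrightarrow> G0" using LIMSEQ_subseq_LIMSEQ[OF Gl r(1)] by (simp add: o_def)
  have gpl: "(\<lambda>n. G (r n) - k (r n) *\<^sub>R (1, - a (r n))) \<longlonglongrightarrow> G0 - k0 *\<^sub>R (1, - a0)"
    by (intro tendsto_intros Gr al kl)
  have gp: "norm (G0 - k0 *\<^sub>R (1, - a0)) \<le> cs"
    using tendsto_norm[OF gpl] by (rule LIMSEQ_le_const2) (use G(3) in blast)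
  have "(\<lambda>n. flux (G (r n) - k (r n) *\<^sub>R (1, - a (r n))) \<bullet> (1, - a (r n))) \<longlonglongrightarrow> flux (G0 - k0 *\<^sub>R (1, - a0)) \<bullet> (1, - a0)"
    by (intro tendsto_intros tendsto_flux gpl al c2_pos_norm gp)
  moreover have "(\<lambda>n. flux (G (r n)) \<bullet> (1, - a (r n))) \<longlonglongrightarrow> flux G0 \<bullet> (1, - a0)"
    by (intro tendsto_intros tendsto_flux Gr al) (use c2um in simp)
  ultimately have "flux (G0 - k0 *\<^sub>R (1, - a0)) \<bullet> (1, - a0) = flux G0 \<bullet> (1, - a0)"
    unfolding G(4) by (rule LIMSEQ_unique)
  then have "(norm a0)\<^sup>2 < mach2 - 1" by (rule shock_spacelike_G0[OF gp])
  moreover have "mach2 - 1 - 0 \<le> (norm a0)\<^sup>2"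
  proof (rule LIMSEQ_le)
    show "(\<lambda>n. mach2 - 1 - 1 / real (Suc (r n))) \<longlonglongrightarrow> mach2 - 1 - 0"
      using LIMSEQ_subseq_LIMSEQ[OF t r(1)] by (intro tendsto_intros) (simp add: o_def)
    show "(\<lambda>n. (norm (a (r n)))\<^sup>2) \<longlonglongrightarrow> (norm a0)\<^sup>2" by (intro tendsto_intros al)
  qed (use G(5) less_imp_le in blast)
  ultimately show False by simp
qed

end

section \<open>Second derivatives and boundary limits of gradients\<close>

lemma GDERIV_grad:
  assumes "\<phi> differentiable (at x)"
  shows "GDERIV \<phi> x :> grad \<phi> x"
proof -
  let ?D = "frechet_derivative \<phi> (at x)"
  have D: "(\<phi> has_derivative ?D) (at x)" using assms unfolding frechet_derivative_works .
  have lin: "linear ?D" using D has_derivative_linear by blast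
  have "?D h = h \<bullet> grad \<phi> x" for h
  proof -
    have "?D h = ?D (\<Sum>b\<in>Basis. (h \<bullet> b) *\<^sub>R b)" by (simp add: euclidean_representation)
    also have "\<dots> = (\<Sum>b\<in>Basis. (h \<bullet> b) * ?D b)"
      by (simp add: linear_sum[OF lin] linear_scale[OF lin])
    finally show ?thesis by (simp add: grad_def inner_sum_right mult.commute)
  qed
  then have "?D = (\<lambda>h. h \<bullet> grad \<phi> x)" by (rule ext)
  then show ?thesis using D unfolding gderiv_def by (simp only:)
qed

lemma grad_eqI:
  assumes "GDERIV \<phi> x :> g"
  shows "grad \<phi> x = g"
proof -
  have "\<phi> differentiable (at x)" using assms unfolding gderiv_def differentiable_def by blast
  then show ?thesis using GDERIV_grad assms GDERIV_unique by blast
qed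

text \<open>The gradient of the component of \<open>grad \<phi>\<close> along \<open>b\<close>; its
  symmetry in the two directions is proved below and not built in.\<close>

definition hess :: "('a::euclidean_space \<Rightarrow> real) \<Rightarrow> 'a \<Rightarrow> 'a \<Rightarrow> 'a" where
  "hess \<phi> b x = (\<Sum>b'\<in>Basis. (frechet_derivative (grad \<phi>) (at x) b' \<bullet> b) *\<^sub>R b')"

lemma C2_on_C1_grad:
  assumes "C2_on U \<phi>"
  shows "C1_grad U \<phi> (grad \<phi>)" "C1_grad U (\<lambda>x. grad \<phi> x \<bullet> b) (hess \<phi> b)"
proof -
  have d: "\<phi> differentiable (at x)" "grad \<phi> differentiable (at x)" if "x \<in> U" for x
    using assms that unfolding C2_on_def by blast+
  have c: "continuous_on U (\<lambda>x. frechet_derivative (grad \<phi>) (at x) b')" if "b' \<in> Basis" for b'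
    using assms that unfolding C2_on_def by blast
  have "continuous_on U (grad \<phi>)"
    using d(2) by (intro continuous_at_imp_continuous_on ballI differentiable_imp_continuous_within)
  then show "C1_grad U \<phi> (grad \<phi>)"
    unfolding C1_grad_def using d(1) GDERIV_grad by blast
  have "GDERIV (\<lambda>x. grad \<phi> x \<bullet> b) x :> hess \<phi> b x" if "x \<in> U" for x
  proof -
    let ?D = "frechet_derivative (grad \<phi>) (at x)"
    have D: "(grad \<phi> has_derivative ?D) (at x)" using d(2)[OF that] unfolding frechet_derivative_works .
    have lin: "linear ?D" using D has_derivative_linear by blast
    have "?D h \<bullet> b = h \<bullet> hess \<phi> b x" for h
    proof -
      have "?D h = ?D (\<Sum>b\<in>Basis. (h \<bullet> b) *\<^sub>R b)" by (simp add: euclidean_representation)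
      also have "\<dots> = (\<Sum>b\<in>Basis. (h \<bullet> b) *\<^sub>R ?D b)"
        by (simp add: linear_sum[OF lin] linear_scale[OF lin])
      finally show ?thesis by (simp add: hess_def inner_sum_right inner_sum_left mult.commute)
    qed
    moreover have "((\<lambda>x. grad \<phi> x \<bullet> b) has_derivative (\<lambda>h. ?D h \<bullet> b)) (at x)"
      by (rule has_derivative_inner_left[OF D])
    ultimately show ?thesis by (simp add: gderiv_def)
  qed
  moreover have "continuous_on U (hess \<phi> b)"
    unfolding hess_def by (intro continuous_on_sum continuous_on_scaleR continuous_on_inner continuous_on_const c)
  ultimately show "C1_grad U (\<lambda>x. grad \<phi> x \<bullet> b) (hess \<phi> b)" unfolding C1_grad_def by blast
qed

lemma DERIV_along_line:
  assumes "GDERIV f (x + t *\<^sub>R v) :> g"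
  shows "((\<lambda>t. f (x + t *\<^sub>R v)) has_real_derivative g \<bullet> v) (at t)"
proof -
  have "((\<lambda>t. f (x + t *\<^sub>R v)) has_derivative (\<lambda>h. h *\<^sub>R v \<bullet> g)) (at t)"
    by (rule has_derivative_compose[where g = f and f = "\<lambda>t. x + t *\<^sub>R v"])
      (use assms in \<open>auto intro!: derivative_eq_intros simp: gderiv_def\<close>)
  moreover have "(\<lambda>h. h *\<^sub>R v \<bullet> g) = (*) (g \<bullet> v)" by (simp add: fun_eq_iff inner_commute mult.commute)
  ultimately show ?thesis unfolding has_field_derivative_def by simp
qed

text \<open>The mean value theorem is applied along \<open>b\<close> to a difference in direction
  \<open>c\<close>, then along \<open>c\<close>. The left side is symmetric in \<open>b\<close> and
  \<open>c\<close>, which is what Schwarz's theorem uses.\<close>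

lemma second_difference:
  fixes \<phi> :: "'a::euclidean_space \<Rightarrow> real"
  assumes s: "0 < s" and U: "cball x (s * (norm b + norm c)) \<subseteq> U"
    and g: "\<And>y. y \<in> U \<Longrightarrow> GDERIV \<phi> y :> g y" and h: "\<And>y. y \<in> U \<Longrightarrow> GDERIV (\<lambda>y. g y \<bullet> b) y :> h y"
  shows "\<exists>y\<in>cball x (s * (norm b + norm c)).
    \<phi> (x + s *\<^sub>R b + s *\<^sub>R c) - \<phi> (x + s *\<^sub>R b) - \<phi> (x + s *\<^sub>R c) + \<phi> x = s * (s * (h y \<bullet> c))"
proof -
  have box: "x + t *\<^sub>R b + r *\<^sub>R c \<in> cball x (s * (norm b + norm c))" if "0 \<le> t" "t \<le> s" "0 \<le> r" "r \<le> s" for t r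
  proof -
    have "norm (t *\<^sub>R b + r *\<^sub>R c) \<le> t * norm b + r * norm c"
      using norm_triangle_ineq[of "t *\<^sub>R b" "r *\<^sub>R c"] that by simp
    also have "\<dots> \<le> s * norm b + s * norm c" using that by (intro add_mono mult_right_mono) auto
    finally show ?thesis
      by (metis (no_types) ab_semigroup_add_class.add_ac(1) add_diff_cancel_left' dist_commute dist_norm distrib_left mem_cball)
  qed
  have boxU: "x + t *\<^sub>R b + r *\<^sub>R c \<in> U" if "0 \<le> t" "t \<le> s" "0 \<le> r" "r \<le> s" for t r
    using box[OF that] U by blast
  define F where "F t = \<phi> ((x + s *\<^sub>R c) + t *\<^sub>R b) - \<phi> (x + t *\<^sub>R b)" for t
  have "\<exists>t. 0 < t \<and> t < s \<and> F s - F 0 = (s - 0) * (g ((x + s *\<^sub>R c) + t *\<^sub>R b) \<bullet> b - g (x + t *\<^sub>R b) \<bullet> b)"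
  proof (rule MVT2[OF s])
    fix t assume t: "0 \<le> t" "t \<le> s"
    have "x + s *\<^sub>R c + t *\<^sub>R b \<in> U" using boxU[of t s] t s by (simp add: add.commute add.left_commute)
    moreover have "x + t *\<^sub>R b \<in> U" using boxU[of t 0] t s by simp
    ultimately show "(F has_real_derivative g ((x + s *\<^sub>R c) + t *\<^sub>R b) \<bullet> b - g (x + t *\<^sub>R b) \<bullet> b) (at t)"
      unfolding F_def by (intro DERIV_diff DERIV_along_line g)
  qed
  then obtain t where t: "0 < t" "t < s" "F s - F 0 = s * (g ((x + t *\<^sub>R b) + s *\<^sub>R c) \<bullet> b - g ((x + t *\<^sub>R b) + 0 *\<^sub>R c) \<bullet> b)"
    by (auto simp: add.commute add.left_commute)
  have "\<exists>r. 0 < r \<and> r < s \<and> g ((x + t *\<^sub>R b) + s *\<^sub>R c) \<bullet> b - g ((x + t *\<^sub>R b) + 0 *\<^sub>R c) \<bullet> b =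
      (s - 0) * (h ((x + t *\<^sub>R b) + r *\<^sub>R c) \<bullet> c)"
    using boxU t s by (intro MVT2[of 0 s "\<lambda>r. g ((x + t *\<^sub>R b) + r *\<^sub>R c) \<bullet> b"] DERIV_along_line[where f = "\<lambda>y. g y \<bullet> b"] h) auto
  then obtain r where r: "0 < r" "r < s" "g ((x + t *\<^sub>R b) + s *\<^sub>R c) \<bullet> b - g ((x + t *\<^sub>R b) + 0 *\<^sub>R c) \<bullet> b =
      s * (h ((x + t *\<^sub>R b) + r *\<^sub>R c) \<bullet> c)" by auto
  have "x + s *\<^sub>R c + s *\<^sub>R b = x + s *\<^sub>R b + s *\<^sub>R c" by (simp add: add.commute add.left_commute)
  then have "\<phi> (x + s *\<^sub>R b + s *\<^sub>R c) - \<phi> (x + s *\<^sub>R b) - \<phi> (x + s *\<^sub>R c) + \<phi> x = F s - F 0"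
    unfolding F_def by (simp only: scaleR_zero_left add_0_right)
  also have "\<dots> = s * (s * (h ((x + t *\<^sub>R b) + r *\<^sub>R c) \<bullet> c))" unfolding t(3) r(3) ..
  finally show ?thesis using box[of t r] t r by (intro bexI) auto
qed

text \<open>Second differences in the two orders agree; as the step shrinks, continuity carries this
  to the derivatives at \<open>x\<close>. The cancellation in the divergence of \<open>E\<close>
  depends on it.\<close>

lemma mixed_partials_eq:
  fixes \<phi> :: "'a::euclidean_space \<Rightarrow> real"
  assumes U: "open U" "x \<in> U" and g: "\<And>y. y \<in> U \<Longrightarrow> GDERIV \<phi> y :> g y"
    and hb: "C1_grad U (\<lambda>y. g y \<bullet> b) hb" and hc: "C1_grad U (\<lambda>y. g y \<bullet> c) hc"
  shows "hb x \<bullet> c = hc x \<bullet> b"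
proof (rule ccontr)
  assume ne: "hb x \<bullet> c \<noteq> hc x \<bullet> b"
  define \<epsilon> where "\<epsilon> = \<bar>hb x \<bullet> c - hc x \<bullet> b\<bar> / 2"
  have \<epsilon>: "0 < \<epsilon>" using ne by (simp add: \<epsilon>_def)
  have "continuous_on U (\<lambda>y. hb y \<bullet> c)" "continuous_on U (\<lambda>y. hc y \<bullet> b)"
    using hb hc unfolding C1_grad_def by (auto intro!: continuous_intros)
  then have "isCont (\<lambda>y. hb y \<bullet> c) x" "isCont (\<lambda>y. hc y \<bullet> b) x"
    using U continuous_on_eq_continuous_at by blast+
  then obtain d1 d2 where d1: "0 < d1" "\<And>y. dist y x < d1 \<Longrightarrow> dist (hb y \<bullet> c) (hb x \<bullet> c) < \<epsilon>"
    and d2: "0 < d2" "\<And>y. dist y x < d2 \<Longrightarrow> dist (hc y \<bullet> b) (hc x \<bullet> b) < \<epsilon>"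
    unfolding continuous_at_eps_delta using \<epsilon> by metis
  obtain d3 where d3: "0 < d3" "ball x d3 \<subseteq> U" using U open_contains_ball by blast
  define s where "s = min d1 (min d2 d3) / (norm b + norm c + 1)"
  have n: "0 < norm b + norm c + 1" by (simp add: add_nonneg_pos)
  have s: "0 < s" using d1(1) d2(1) d3(1) n by (simp add: s_def)
  have "s * (norm b + norm c + 1) = min d1 (min d2 d3)" using n by (simp add: s_def)
  then have sb: "s * (norm b + norm c) < min d1 (min d2 d3)" using s unfolding distrib_left by linarith
  have sub: "cball x (s * (norm b + norm c)) \<subseteq> U" "cball x (s * (norm c + norm b)) \<subseteq> U"
    using sb d3(2) by (auto simp: subset_iff add.commute)
  obtain y where y: "y \<in> cball x (s * (norm b + norm c))"
    "\<phi> (x + s *\<^sub>R b + s *\<^sub>R c) - \<phi> (x + s *\<^sub>R b) - \<phi> (x + s *\<^sub>R c) + \<phi> x = s * (s * (hb y \<bullet> c))"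
    using second_difference[OF s sub(1) g, where h = hb] hb unfolding C1_grad_def by blast
  obtain z where z: "z \<in> cball x (s * (norm c + norm b))"
    "\<phi> (x + s *\<^sub>R c + s *\<^sub>R b) - \<phi> (x + s *\<^sub>R c) - \<phi> (x + s *\<^sub>R b) + \<phi> x = s * (s * (hc z \<bullet> b))"
    using second_difference[OF s sub(2) g, where h = hc] hc unfolding C1_grad_def by blast
  have "x + s *\<^sub>R c + s *\<^sub>R b = x + s *\<^sub>R b + s *\<^sub>R c" by (simp add: add.commute add.left_commute)
  then have "\<phi> (x + s *\<^sub>R c + s *\<^sub>R b) = \<phi> (x + s *\<^sub>R b + s *\<^sub>R c)" by (rule arg_cong)
  then have "s * (s * (hb y \<bullet> c)) = s * (s * (hc z \<bullet> b))" using y(2) z(2) by linarith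
  then have "hb y \<bullet> c = hc z \<bullet> b" using s by simp
  moreover have "dist (hb y \<bullet> c) (hb x \<bullet> c) < \<epsilon>"
    using y(1) sb by (intro d1(2)) (simp add: dist_commute)
  moreover have "dist (hc z \<bullet> b) (hc x \<bullet> b) < \<epsilon>"
    using z(1) sb by (intro d2(2)) (simp add: dist_commute add.commute)
  ultimately show False by (simp add: \<epsilon>_def dist_real_def) (use \<epsilon> in \<open>auto simp: \<epsilon>_def abs_if split: if_splits\<close>)
qed

text \<open>The gradient need not exist on the boundary; its limit \<open>g\<close> still governs the continuous
  extension along any boundary curve that can be pushed inside by small translations.\<close>
lemma boundary_curve_derivative:
  fixes \<phi> \<psi> :: "'a::euclidean_space \<Rightarrow> real" and c c' :: "real \<Rightarrow> 'a"
  assumes \<phi>: "\<And>x. x \<in> A \<Longrightarrow> GDERIV \<phi> x :> G x" and q: "(G \<longlongrightarrow> g) (at q within A)" "q \<notin> A"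
    and \<psi>: "continuous_on (closure A) \<psi>" "\<And>x. x \<in> A \<Longrightarrow> \<psi> x = \<phi> x"
    and s0: "0 < s0" and c: "c 0 = q" "continuous_on {0..s0} c"
    and c': "\<And>s. 0 < s \<Longrightarrow> s < s0 \<Longrightarrow> (c has_vector_derivative c' s) (at s)" "(c' \<longlongrightarrow> T) (at_right 0)"
    and v: "v \<longlonglongrightarrow> 0" "\<And>n s. 0 \<le> s \<Longrightarrow> s \<le> s0 \<Longrightarrow> c s + v n \<in> A"
  shows "((\<lambda>s. (\<psi> (c s) - \<psi> q) / s) \<longlongrightarrow> g \<bullet> T) (at_right 0)"
proof (rule tendstoI)
  fix \<epsilon> :: real assume \<epsilon>: "0 < \<epsilon>"
  have "((\<lambda>p. fst p \<bullet> snd p) \<longlongrightarrow> g \<bullet> T) (nhds (g, T))"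
    using tendsto_inner[OF tendsto_fst[OF filterlim_ident] tendsto_snd[OF filterlim_ident], of "(g, T)"] by simp
  then have "\<forall>\<^sub>F p in nhds (g, T). dist (fst p \<bullet> snd p) (g \<bullet> T) < \<epsilon> / 2"
    using \<epsilon> by (intro tendstoD) auto
  then obtain \<rho> where \<rho>: "0 < \<rho>" "\<And>p. dist p (g, T) < \<rho> \<Longrightarrow> dist (fst p \<bullet> snd p) (g \<bullet> T) < \<epsilon> / 2"
    unfolding eventually_nhds_metric by blast
  have near: "\<bar>a \<bullet> b - g \<bullet> T\<bar> < \<epsilon> / 2" if "dist a g < \<rho> / 2" "dist b T < \<rho> / 2" for a b
  proof -
    have "dist (a, b) (g, T) < \<rho>"
      using norm_Pair_le[of "a - g" "b - T"] that by (simp add: dist_norm)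
    then show ?thesis using \<rho>(2)[of "(a, b)"] by (simp add: dist_real_def)
  qed
  obtain \<eta> where \<eta>: "0 < \<eta>" "\<And>x. x \<in> A \<Longrightarrow> dist x q < \<eta> \<Longrightarrow> dist (G x) g < \<rho> / 2"
    using tendstoD[OF q(1), of "\<rho> / 2"] \<rho>(1) q(2) unfolding eventually_at by (metis half_gt_zero)
  have "\<forall>\<^sub>F s in at_right 0. dist (c' s) T < \<rho> / 2" using tendstoD[OF c'(2), of "\<rho> / 2"] half_gt_zero[OF \<rho>(1)] by blast
  then obtain s1 where s1: "0 < s1" "\<And>s. 0 < s \<Longrightarrow> s < s1 \<Longrightarrow> dist (c' s) T < \<rho> / 2"
    unfolding eventually_at_right_field by auto
  obtain s2 where s2: "0 < s2" "\<And>s. 0 \<le> s \<Longrightarrow> s \<le> s0 \<Longrightarrow> s < s2 \<Longrightarrow> dist (c s) q < \<eta> / 2"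
  proof -
    have "\<exists>d>0. \<forall>s\<in>{0..s0}. dist s 0 < d \<longrightarrow> dist (c s) (c 0) < \<eta> / 2"
      using c(2) s0 \<eta>(1) unfolding continuous_on_iff by (meson atLeastAtMost_iff half_gt_zero less_imp_le order_refl)
    then obtain d where "0 < d" "\<forall>s\<in>{0..s0}. dist s 0 < d \<longrightarrow> dist (c s) (c 0) < \<eta> / 2" by blast
    then show thesis using that[of d] c(1) by auto
  qed
  define s3 where "s3 = min s0 (min s1 s2)"
  have s3: "0 < s3" using s0 s1 s2 by (simp add: s3_def)
  have est: "\<bar>\<psi> (c s) - \<psi> q - s * (g \<bullet> T)\<bar> \<le> s * (\<epsilon> / 2)" if s: "0 < s" "s < s3" for s
  proof -
    have sle: "s \<le> s0" "s < s1" "s < s2" using s by (auto simp: s3_def)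
    \<comment> \<open>On the curve shifted into \<open>A\<close> the mean value theorem holds with a
      gradient close to \<open>g\<close>. The bound is uniform in \<open>n\<close> and passes to the
      curve itself by continuity of \<open>\<psi>\<close>.\<close>
    have ev: "\<forall>\<^sub>F n in sequentially. \<bar>\<psi> (c s + v n) - \<psi> (c 0 + v n) - s * (g \<bullet> T)\<bar> \<le> s * (\<epsilon> / 2)"
    proof -
      have "\<forall>\<^sub>F n in sequentially. dist (v n) 0 < \<eta> / 2" using tendstoD[OF v(1), of "\<eta> / 2"] half_gt_zero[OF \<eta>(1)] by blast
      then show ?thesis
      proof eventually_elim
        case (elim n)
        have "\<exists>\<xi>\<in>{0<..<s}. \<phi> (c s + v n) - \<phi> (c 0 + v n) = (\<lambda>h. h * (G (c \<xi> + v n) \<bullet> c' \<xi>)) (s - 0)"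
        proof (rule mvt[of 0 s "\<lambda>t. \<phi> (c t + v n)"])
          have cc: "continuous_on {0..s} c" by (rule continuous_on_subset[OF c(2)]) (use sle in auto)
          have "continuous_on A \<phi>"
            using \<phi> GDERIV_isCont continuous_at_imp_continuous_on by blast
          then show "continuous_on {0..s} (\<lambda>t. \<phi> (c t + v n))"
            by (rule continuous_on_compose2[OF _ continuous_on_add[OF cc continuous_on_const]]) (use v(2) sle in auto)
          fix t assume t: "0 < t" "t < s"
          have "((\<lambda>t. c t + v n) has_derivative (\<lambda>h. h *\<^sub>R c' t)) (at t)"
            using c'(1)[of t] t sle unfolding has_vector_derivative_def by (auto intro!: derivative_eq_intros)
          moreover have "(\<phi> has_derivative (\<lambda>h. h \<bullet> G (c t + v n))) (at (c t + v n))"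
            using \<phi>[OF v(2), of t n] t sle unfolding gderiv_def by simp
          ultimately have "((\<lambda>t. \<phi> (c t + v n)) has_derivative (\<lambda>h. h *\<^sub>R c' t \<bullet> G (c t + v n))) (at t)"
            by (rule has_derivative_compose)
          then show "((\<lambda>t. \<phi> (c t + v n)) has_derivative (\<lambda>h. h * (G (c t + v n) \<bullet> c' t))) (at t)"
            by (simp add: inner_commute)
        qed (use s in auto)
        then obtain \<xi> where \<xi>: "0 < \<xi>" "\<xi> < s" "\<phi> (c s + v n) - \<phi> (c 0 + v n) = s * (G (c \<xi> + v n) \<bullet> c' \<xi>)" by auto
        have "dist (c \<xi> + v n) q \<le> dist (c \<xi>) q + dist (v n) 0"
          using norm_triangle_ineq[of "c \<xi> - q" "v n"] by (simp add: dist_norm algebra_simps)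
        then have "dist (c \<xi> + v n) q < \<eta>" using s2(2)[of \<xi>] \<xi> sle elim by simp
        then have "\<bar>G (c \<xi> + v n) \<bullet> c' \<xi> - g \<bullet> T\<bar> < \<epsilon> / 2"
          using \<xi> sle by (intro near \<eta>(2) v(2) s1(2)) auto
        then have "s * \<bar>G (c \<xi> + v n) \<bullet> c' \<xi> - g \<bullet> T\<bar> \<le> s * (\<epsilon> / 2)" using s by (intro mult_left_mono) auto
        moreover have "\<psi> (c s + v n) = \<phi> (c s + v n)" "\<psi> (c 0 + v n) = \<phi> (c 0 + v n)"
          using \<psi>(2) v(2) s sle by auto
        ultimately show ?case
          using \<xi>(3) s by (simp add: right_diff_distrib[symmetric] abs_mult)
      qed
    qed
    have lim: "(\<lambda>n. \<psi> (c t + v n)) \<longlonglongrightarrow> \<psi> (c t)" if t: "0 \<le> t" "t \<le> s0" for t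
    proof -
      have l: "(\<lambda>n. c t + v n) \<longlonglongrightarrow> c t" using tendsto_add[OF tendsto_const v(1), of "c t"] by simp
      have inA: "c t + v n \<in> closure A" for n using v(2)[OF t] closure_subset by blast
      have "c t \<in> closure A" by (rule closed_sequentially[OF closed_closure inA l])
      then show ?thesis
        by (rule continuous_on_tendsto_compose[OF \<psi>(1) l]) (use inA in auto)
    qed
    have "(\<lambda>n. \<bar>\<psi> (c s + v n) - \<psi> (c 0 + v n) - s * (g \<bullet> T)\<bar>) \<longlonglongrightarrow> \<bar>\<psi> (c s) - \<psi> (c 0) - s * (g \<bullet> T)\<bar>"
      using lim[of s] lim[of 0] s sle s0 by (intro tendsto_intros) auto
    then show ?thesis using ev unfolding c(1) by (rule tendsto_upperbound) simp
  qed
  show "\<forall>\<^sub>F s in at_right 0. dist ((\<psi> (c s) - \<psi> q) / s) (g \<bullet> T) < \<epsilon>"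
    unfolding eventually_at_right_field
  proof (intro exI[of _ s3] conjI s3 allI impI)
    fix s assume s: "0 < s" "s < s3"
    have "(\<psi> (c s) - \<psi> q) / s - g \<bullet> T = (\<psi> (c s) - \<psi> q - s * (g \<bullet> T)) / s" using s by (simp add: field_simps)
    then have "\<bar>(\<psi> (c s) - \<psi> q) / s - g \<bullet> T\<bar> \<le> \<epsilon> / 2"
      using est[OF s] s by (simp add: abs_divide divide_le_eq mult.commute)
    then show "dist ((\<psi> (c s) - \<psi> q) / s) (g \<bullet> T) < \<epsilon>" using \<epsilon> by (simp add: dist_real_def)
  qed
qed

section \<open>Transonic shock solutions\<close>

text \<open>Limits at the single points of the closure suffice: closeness of \<open>G\<close> to
  \<open>H q\<close> on a ball carries over to \<open>H\<close> at the other points of that ball, as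
  these values are limits of \<open>G\<close> too.\<close>

lemma continuous_on_closure_extension:
  fixes G :: "'a::metric_space \<Rightarrow> 'b::metric_space"
  assumes ext: "\<And>x. x \<in> A \<Longrightarrow> H x = G x" and lim: "\<And>q. q \<in> closure A \<Longrightarrow> (G \<longlongrightarrow> H q) (at q within A)"
  shows "continuous_on (closure A) H"
  unfolding continuous_on_iff
proof (intro ballI allI impI)
  fix q and \<epsilon> :: real assume q: "q \<in> closure A" and \<epsilon>: "0 < \<epsilon>"
  have near: "\<exists>\<delta>>0. \<forall>x\<in>A. dist x q < \<delta> \<longrightarrow> dist (G x) (H q) < \<epsilon> / 2" if qc: "q \<in> closure A" for q
  proof -
    obtain \<delta> where \<delta>: "0 < \<delta>" "\<And>x. x \<in> A \<Longrightarrow> x \<noteq> q \<Longrightarrow> dist x q < \<delta> \<Longrightarrow> dist (G x) (H q) < \<epsilon> / 2"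
      using tendstoD[OF lim[OF qc] half_gt_zero[OF \<epsilon>]] unfolding eventually_at by blast
    have "dist (G x) (H q) < \<epsilon> / 2" if "x \<in> A" "dist x q < \<delta>" for x
      using \<delta>(2)[of x] that ext[of q] \<epsilon> by (cases "x = q") auto
    then show ?thesis using \<delta>(1) by blast
  qed
  obtain \<delta> where \<delta>: "0 < \<delta>" "\<And>x. x \<in> A \<Longrightarrow> dist x q < \<delta> \<Longrightarrow> dist (G x) (H q) < \<epsilon> / 2"
    using near[OF q] by blast
  show "\<exists>\<delta>>0. \<forall>y\<in>closure A. dist y q < \<delta> \<longrightarrow> dist (H y) (H q) < \<epsilon>"
  proof (intro exI[of _ "\<delta> / 2"] conjI ballI impI)
    fix y assume y: "y \<in> closure A" "dist y q < \<delta> / 2"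
    obtain \<eta> where \<eta>: "0 < \<eta>" "\<And>x. x \<in> A \<Longrightarrow> dist x y < \<eta> \<Longrightarrow> dist (G x) (H y) < \<epsilon> / 2"
      using near[OF y(1)] by blast
    obtain x where x: "x \<in> A" "dist x y < min \<eta> (\<delta> / 2)"
      using y(1) \<eta>(1) \<delta>(1) unfolding closure_approachable by (metis half_gt_zero min_less_iff_conj)
    have "dist (G x) (H q) < \<epsilon> / 2" using x y(2) dist_triangle[of x q y] by (intro \<delta>(2)) auto
    moreover have "dist (G x) (H y) < \<epsilon> / 2" using x by (intro \<eta>(2)) auto
    ultimately show "dist (H y) (H q) < \<epsilon>" using dist_triangle2[of "H y" "H q" "G x"] by (simp add: dist_commute)
  qed (use \<delta> in simp)
qed

lemma within_nontrivial: "q \<in> closure A - A \<Longrightarrow> at q within A \<noteq> bot"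
  by (simp add: trivial_limit_within islimpt_in_closure)

lemma eventually_along_ray:
  fixes y :: "'a::real_normed_vector"
  assumes "\<forall>\<^sub>F z in nhds y. P z"
  shows "\<exists>s0>0. \<forall>s. 0 \<le> s \<longrightarrow> s \<le> s0 \<longrightarrow> P (y + s *\<^sub>R d)"
proof -
  have "((\<lambda>s. y + s *\<^sub>R d) \<longlongrightarrow> y + 0 *\<^sub>R d) (nhds 0)" by (intro tendsto_intros filterlim_ident)
  then have "\<forall>\<^sub>F s in nhds (0::real). P (y + s *\<^sub>R d)"
    using eventually_compose_filterlim[OF assms] by simp
  then obtain e where "0 < e" "\<And>s. dist s (0::real) < e \<Longrightarrow> P (y + s *\<^sub>R d)"
    unfolding eventually_nhds_metric by blast
  then show ?thesis by (intro exI[of _ "e / 2"]) auto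
qed

locale shock_solution = supersonic_gas +
  fixes \<Omega> :: "pt2 set" and c1 :: real and f :: "pt2 \<Rightarrow> real" and \<phi> :: "pt3 \<Rightarrow> real"
  assumes \<Omega>: "bounded_domain \<Omega>" "C3_boundary \<Omega>" and c1: "0 < c1" "c1 < cs"
    and sol: "transonic_shock_solution \<gamma> b0 um c1 \<Omega> f \<phi>"
begin

lemma op: "open \<Omega>" and bd: "bounded \<Omega>" and conn: "connected \<Omega>" and ne: "\<Omega> \<noteq> {}"
  using \<Omega>(1) by (auto simp: bounded_domain_def)

lemmas sol_unfolded = sol[unfolded transonic_shock_solution_def Let_def]

lemma f_C1: "C1_on_closure \<Omega> f" using sol_unfolded by (elim conjE)
lemma \<phi>_lipschitz: "\<exists>L. L-lipschitz_on (cyl \<Omega>) \<phi>" using sol_unfolded by (elim conjE)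
lemma \<phi>_C2: "C2_on (Dminus \<Omega> f \<union> Dplus \<Omega> f) \<phi>" using sol_unfolded by (elim conjE)
lemma \<phi>_c2: "x \<in> Dminus \<Omega> f \<union> Dplus \<Omega> f \<Longrightarrow> 0 < c2 ((norm (grad \<phi> x))\<^sup>2)"
proof -
  assume x: "x \<in> Dminus \<Omega> f \<union> Dplus \<Omega> f"
  have "\<gamma> > 1 \<longrightarrow> (\<forall>x\<in>Dminus \<Omega> f \<union> Dplus \<Omega> f. 1 + (\<gamma> - 1) * (b0 - (norm (grad \<phi> x))\<^sup>2 / 2) > 0)"
    using sol_unfolded by (elim conjE)
  then show ?thesis using x \<gamma> unfolding c2_def by (cases "1 < \<gamma>") auto
qed
lemma supersonic: "x \<in> Dminus \<Omega> f \<Longrightarrow> cs < norm (grad \<phi> x)" using sol_unfolded by (elim conjE) blast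
lemma subsonic: "x \<in> Dplus \<Omega> f \<Longrightarrow> norm (grad \<phi> x) < cs" using sol_unfolded by (elim conjE) blast
lemma flux_divg: "x \<in> Dminus \<Omega> f \<union> Dplus \<Omega> f \<Longrightarrow>
    (\<lambda>z. flux (grad \<phi> z)) differentiable (at x) \<and> divg (\<lambda>z. flux (grad \<phi> z)) x = 0"
  using sol_unfolded unfolding flux_def by (elim conjE) blast
lemma inlet_value: "y \<in> \<Omega> \<Longrightarrow> (\<phi> \<longlongrightarrow> - um) (at (-1, y) within cyl \<Omega>)"
proof -
  assume "y \<in> \<Omega>"
  then have "(-1, y) \<in> sigma (-1) \<Omega>" by (simp add: sigma_def)
  then show ?thesis using sol_unfolded by (elim conjE) blast
qed
lemma inlet_grad: "y \<in> \<Omega> \<Longrightarrow> A \<in> {Dminus \<Omega> f, Dplus \<Omega> f} \<Longrightarrow> (-1, y) \<in> closure A \<Longrightarrow>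
    \<exists>g. side_grad \<phi> A (-1, y) g \<and> fst g = um"
proof -
  assume a: "y \<in> \<Omega>" "A \<in> {Dminus \<Omega> f, Dplus \<Omega> f}" "(-1, y) \<in> closure A"
  have "\<forall>q\<in>sigma (-1) \<Omega>. \<forall>A\<in>{Dminus \<Omega> f, Dplus \<Omega> f}. q \<in> closure A \<longrightarrow>
         (\<exists>g. side_grad \<phi> A q g \<and> fst g = um \<and> fst g \<ge> 0)" using sol_unfolded by (elim conjE)
  moreover have "(-1, y) \<in> sigma (-1) \<Omega>" using a(1) by (simp add: sigma_def)
  ultimately show ?thesis using a(2,3) by blast
qed
lemma outlet_grad: "y \<in> \<Omega> \<Longrightarrow> A \<in> {Dminus \<Omega> f, Dplus \<Omega> f} \<Longrightarrow> (1, y) \<in> closure A \<Longrightarrow>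
    \<exists>g. side_grad \<phi> A (1, y) g \<and> norm g = c1 \<and> 0 \<le> fst g"
proof -
  assume a: "y \<in> \<Omega>" "A \<in> {Dminus \<Omega> f, Dplus \<Omega> f}" "(1, y) \<in> closure A"
  have "\<forall>q\<in>sigma 1 \<Omega>. \<forall>A\<in>{Dminus \<Omega> f, Dplus \<Omega> f}. q \<in> closure A \<longrightarrow>
         (\<exists>g. side_grad \<phi> A q g \<and> norm g = c1 \<and> fst g \<ge> 0)" using sol_unfolded by (elim conjE)
  moreover have "(1, y) \<in> sigma 1 \<Omega>" using a(1) by (simp add: sigma_def)
  ultimately show ?thesis using a(2,3) by blast
qed
lemma wall_grad: "q \<in> wall \<Omega> \<Longrightarrow> A \<in> {Dminus \<Omega> f, Dplus \<Omega> f} \<Longrightarrow> q \<in> closure A \<Longrightarrow>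
    \<exists>g. side_grad \<phi> A q g \<and> (\<forall>\<nu>. outward_unit_normal \<Omega> (snd q) \<nu> \<longrightarrow> g \<bullet> (0, \<nu>) = 0)"
  using sol_unfolded by (elim conjE) blast
lemma shock_grad: "y \<in> \<Omega> \<Longrightarrow> -1 < f y \<Longrightarrow> f y < 1 \<Longrightarrow>
    \<exists>gm gp. side_grad \<phi> (Dminus \<Omega> f) (f y, y) gm \<and> side_grad \<phi> (Dplus \<Omega> f) (f y, y) gp \<and>
      flux gp \<bullet> (1, - grad f y) = flux gm \<bullet> (1, - grad f y)"
proof -
  assume a: "y \<in> \<Omega>" "-1 < f y" "f y < 1"
  have "\<forall>y\<in>\<Omega>. -1 < f y \<and> f y < 1 \<longrightarrow> (\<exists>gm gp. side_grad \<phi> (Dminus \<Omega> f) (f y, y) gm \<and> side_grad \<phi> (Dplus \<Omega> f) (f y, y) gp \<and>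
      rho \<gamma> b0 ((norm gp)\<^sup>2) * (gp \<bullet> (1, - grad f y)) = rho \<gamma> b0 ((norm gm)\<^sup>2) * (gm \<bullet> (1, - grad f y)) \<and>
            norm gp < norm gm)" using sol_unfolded by (elim conjE)
  then show ?thesis using a unfolding flux_def inner_scaleR_left by blast
qed

text \<open>A continuous derivative up to the frontier, where \<open>grad\<close> of
  \<open>f\<close> is not at hand; on \<open>\<Omega>\<close> it is the gradient.\<close>

definition Df :: "pt2 \<Rightarrow> pt2" where
  "Df = (SOME D. continuous_on (closure \<Omega>) D \<and>
      (\<forall>y\<in>closure \<Omega>. (f has_derivative (\<lambda>h. D y \<bullet> h)) (at y within closure \<Omega>)))"

lemma Df: "continuous_on (closure \<Omega>) Df"
  "y \<in> closure \<Omega> \<Longrightarrow> (f has_derivative (\<lambda>h. Df y \<bullet> h)) (at y within closure \<Omega>)"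
  using someI_ex[OF f_C1[unfolded C1_on_closure_def]] unfolding Df_def[symmetric] by auto

lemma f_cont: "continuous_on (closure \<Omega>) f"
  using Df(2) has_derivative_continuous continuous_on_eq_continuous_within by blast

lemma in_closure: "y \<in> \<Omega> \<Longrightarrow> y \<in> closure \<Omega>" using closure_subset by blast

lemma GDERIV_f: "y \<in> \<Omega> \<Longrightarrow> GDERIV f y :> Df y"
  by (rule GDERIV_closure_interior[OF op _ Df(2)[OF in_closure]])

lemma isCont_f: "y \<in> \<Omega> \<Longrightarrow> isCont f y" using GDERIV_f GDERIV_isCont by blast

text \<open>A shock touching the inlet over \<open>\<Omega>\<close> would put subsonic states next
  to the velocity component \<open>um\<close>, and one touching the outlet would put supersonic
  states next to the speed \<open>c1\<close>. Over the frontier only the weak bounds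
  survive.\<close>

lemma f_range: "y \<in> \<Omega> \<Longrightarrow> -1 < f y" "y \<in> \<Omega> \<Longrightarrow> f y < 1"
proof -
  assume y: "y \<in> \<Omega>"
  show "-1 < f y"
  proof (rule ccontr)
    assume n: "\<not> -1 < f y"
    have "(\<lambda>n. (-1 + 1 / real (Suc n), y)) \<longlonglongrightarrow> (-1 + 0, y)"
      using LIMSEQ_inverse_real_of_nat by (intro tendsto_intros) (simp add: inverse_eq_divide)
    moreover have "(-1 + 1 / real (Suc n), y) \<in> Dplus \<Omega> f" for n
    proof -
      have "1 / real (Suc n) \<le> 1" "0 < 1 / real (Suc n)" by auto
      then have "f y < -1 + 1 / real (Suc n)" "-1 < -1 + 1 / real (Suc n)" "-1 + 1 / real (Suc n) < 1"
        using n by linarith+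
      then show ?thesis using y by (simp add: Dplus_def cyl_def)
    qed
    ultimately have q: "(-1, y) \<in> closure (Dplus \<Omega> f)" unfolding closure_sequential
      by (intro exI[of _ "\<lambda>n. (-1 + 1 / real (Suc n), y)"] conjI allI) (assumption | simp only: add_0_right)+
    obtain g where g: "(grad \<phi> \<longlongrightarrow> g) (at (-1, y) within Dplus \<Omega> f)" "fst g = um"
      using inlet_grad[OF y _ q] by (auto simp: side_grad_def)
    have "norm g \<le> cs"
    proof (rule tendsto_upperbound[OF tendsto_norm[OF g(1)]])
      show "\<forall>\<^sub>F x in at (-1, y) within Dplus \<Omega> f. norm (grad \<phi> x) \<le> cs"
        unfolding eventually_at_filter using subsonic by (intro always_eventually) (auto intro: less_imp_le)
      show "at (-1, y) within Dplus \<Omega> f \<noteq> bot"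
        using q by (intro within_nontrivial) (auto simp: Dplus_def cyl_def)
    qed
    moreover have "um \<le> norm g" using norm_fst_le[of um "snd g"] um_pos g(2) by (metis abs_of_pos prod.collapse real_norm_def)
    ultimately show False using um by simp
  qed
  show "f y < 1"
  proof (rule ccontr)
    assume n: "\<not> f y < 1"
    have "(\<lambda>n. (1 - 1 / real (Suc n), y)) \<longlonglongrightarrow> (1 - 0, y)"
      using LIMSEQ_inverse_real_of_nat by (intro tendsto_intros) (simp add: inverse_eq_divide)
    moreover have "(1 - 1 / real (Suc n), y) \<in> Dminus \<Omega> f" for n
    proof -
      have "1 / real (Suc n) \<le> 1" "0 < 1 / real (Suc n)" by auto
      then have "1 - 1 / real (Suc n) < f y" "-1 < 1 - 1 / real (Suc n)" "1 - 1 / real (Suc n) < 1"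
        using n by linarith+
      then show ?thesis using y by (simp add: Dminus_def cyl_def)
    qed
    ultimately have q: "(1, y) \<in> closure (Dminus \<Omega> f)" unfolding closure_sequential
      by (intro exI[of _ "\<lambda>n. (1 - 1 / real (Suc n), y)"] conjI allI) (assumption | simp only: diff_zero)+
    obtain g where g: "(grad \<phi> \<longlongrightarrow> g) (at (1, y) within Dminus \<Omega> f)" "norm g = c1"
      using outlet_grad[OF y _ q] by (auto simp: side_grad_def)
    have "cs \<le> norm g"
    proof (rule tendsto_lowerbound[OF tendsto_norm[OF g(1)]])
      show "\<forall>\<^sub>F x in at (1, y) within Dminus \<Omega> f. cs \<le> norm (grad \<phi> x)"
        unfolding eventually_at_filter using supersonic by (intro always_eventually) (auto intro: less_imp_le)
      show "at (1, y) within Dminus \<Omega> f \<noteq> bot"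
        using q by (intro within_nontrivial) (auto simp: Dminus_def cyl_def)
    qed
    then show False using g(2) c1 by simp
  qed
qed

lemma f_range_closure: "y \<in> closure \<Omega> \<Longrightarrow> -1 \<le> f y \<and> f y \<le> 1"
proof -
  assume y: "y \<in> closure \<Omega>"
  then obtain x where x: "\<And>n. x n \<in> \<Omega>" "x \<longlonglongrightarrow> y" unfolding closure_sequential by blast
  have l: "(\<lambda>n. f (x n)) \<longlonglongrightarrow> f y"
    by (rule continuous_on_tendsto_compose[OF f_cont x(2) y]) (use x(1) in_closure in auto)
  show ?thesis
    using LIMSEQ_le_const[OF l, of "-1"] LIMSEQ_le_const2[OF l, of 1] f_range[OF x(1)] by (auto intro: less_imp_le)
qed

section \<open>Continuous extensions to the closures of the two regions\<close>

abbreviation A :: "real \<Rightarrow> pt3 set" where "A \<sigma> \<equiv> duct_part \<sigma> \<Omega> f"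

lemma A_minus: "Dminus \<Omega> f = A 1"
  using f_range by (force simp: Dminus_def cyl_def duct_part_def)

lemma A_plus: "Dplus \<Omega> f = A (-1)"
  using f_range by (force simp: Dplus_def cyl_def duct_part_def)

text \<open>The continuous extension of the gradient from one side. On the shock the two signs give
  the states ahead of and behind it.\<close>

definition Gh :: "real \<Rightarrow> pt3 \<Rightarrow> pt3" where
  "Gh \<sigma> q = (if q \<in> A \<sigma> then grad \<phi> q else Lim (at q within A \<sigma>) (grad \<phi>))"

lemma A_sub: "\<sigma> = 1 \<or> \<sigma> = -1 \<Longrightarrow> A \<sigma> \<subseteq> Dminus \<Omega> f \<union> Dplus \<Omega> f"
  using A_minus A_plus by auto

lemma A_mem: "\<sigma> = 1 \<or> \<sigma> = -1 \<Longrightarrow> A \<sigma> \<in> {Dminus \<Omega> f, Dplus \<Omega> f}"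
  using A_minus A_plus by auto

lemma open_A: "open (A \<sigma>)"
  by (rule open_duct_part[OF op continuous_on_subset[OF f_cont closure_subset]])

lemma bounded_A: "\<sigma> = 1 \<or> \<sigma> = -1 \<Longrightarrow> bounded (A \<sigma>)"
  by (rule bounded_duct_part[OF bd f_cont])

lemma A_GDERIV: "\<sigma> = 1 \<or> \<sigma> = -1 \<Longrightarrow> x \<in> A \<sigma> \<Longrightarrow> GDERIV \<phi> x :> grad \<phi> x"
  using C2_on_C1_grad(1)[OF \<phi>_C2] A_sub unfolding C1_grad_def by blast

lemma closure_A_cases:
  assumes "\<sigma> = 1 \<or> \<sigma> = -1" "q \<in> closure (A \<sigma>) - A \<sigma>"
  obtains "q \<in> wall \<Omega>" "snd q \<in> frontier \<Omega>" | "snd q \<in> \<Omega>" "fst q = - \<sigma>" | "snd q \<in> \<Omega>" "fst q = f (snd q)"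
proof -
  have c: "snd q \<in> closure \<Omega>" "0 \<le> 1 + \<sigma> * fst q" "0 \<le> \<sigma> * (f (snd q) - fst q)"
    using closure_duct_part[OF f_cont, of q \<sigma>] assms(2) by auto
  show thesis
  proof (cases "snd q \<in> \<Omega>")
    case True
    then have "1 + \<sigma> * fst q \<le> 0 \<or> \<sigma> * (f (snd q) - fst q) \<le> 0"
      using assms(2) by (auto simp: duct_part_def not_less)
    then show thesis using that(2,3) c True assms(1) by auto
  next
    case False
    then have fr: "snd q \<in> frontier \<Omega>" using c(1) op by (simp add: frontier_def interior_open)
    have "-1 \<le> fst q \<and> fst q \<le> 1" using c f_range_closure[OF c(1)] assms(1) by auto
    then show thesis using that(1) fr by (simp add: wall_def)
  qed
qed

text \<open>Each kind of boundary point (wall, end, shock) has its own condition in the definition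
  of a solution, and each of these supplies a limit of the gradient.\<close>

lemma Gh_lim_boundary:
  assumes "\<sigma> = 1 \<or> \<sigma> = -1" "q \<in> closure (A \<sigma>) - A \<sigma>"
  shows "(grad \<phi> \<longlongrightarrow> Gh \<sigma> q) (at q within A \<sigma>)"
proof -
  have "\<exists>g. (grad \<phi> \<longlongrightarrow> g) (at q within A \<sigma>)"
  proof (cases rule: closure_A_cases[OF assms])
    case 1
    then show ?thesis using wall_grad[OF 1(1) A_mem[OF assms(1)]] assms(2) by (auto simp: side_grad_def)
  next
    case 2
    then have q: "q = (- \<sigma>, snd q)" by (simp add: prod_eq_iff)
    show ?thesis
    proof (cases "\<sigma> = 1")
      case True
      then show ?thesis using inlet_grad[OF 2(1) A_mem[OF assms(1)]] assms(2) q by (auto simp: side_grad_def)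
    next
      case False
      then show ?thesis using outlet_grad[OF 2(1) A_mem[OF assms(1)]] assms q by (auto simp: side_grad_def)
    qed
  next
    case 3
    then have q: "q = (f (snd q), snd q)" by (simp add: prod_eq_iff)
    show ?thesis using shock_grad[OF 3(1) f_range[OF 3(1)]] assms(1)
      unfolding A_minus A_plus q[symmetric] side_grad_def by auto
  qed
  then obtain g where g: "(grad \<phi> \<longlongrightarrow> g) (at q within A \<sigma>)" by blast
  have "Gh \<sigma> q = g"
    using assms(2) tendsto_Lim[OF within_nontrivial[OF assms(2)] g] by (simp add: Gh_def)
  then show ?thesis using g by simp
qed

lemma Gh_eqI:
  assumes "\<sigma> = 1 \<or> \<sigma> = -1" "q \<in> closure (A \<sigma>) - A \<sigma>" "(grad \<phi> \<longlongrightarrow> g) (at q within A \<sigma>)"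
  shows "Gh \<sigma> q = g"
  using tendsto_unique[OF within_nontrivial[OF assms(2)] Gh_lim_boundary[OF assms(1,2)] assms(3)] .

lemma Gh_inside: "x \<in> A \<sigma> \<Longrightarrow> Gh \<sigma> x = grad \<phi> x" by (simp add: Gh_def)

lemma grad_cont: "\<sigma> = 1 \<or> \<sigma> = -1 \<Longrightarrow> continuous_on (A \<sigma>) (grad \<phi>)"
  using C2_on_C1_grad(1)[OF \<phi>_C2] continuous_on_subset[OF _ A_sub] unfolding C1_grad_def by blast

lemma Gh_lim:
  assumes "\<sigma> = 1 \<or> \<sigma> = -1" "q \<in> closure (A \<sigma>)"
  shows "(grad \<phi> \<longlongrightarrow> Gh \<sigma> q) (at q within A \<sigma>)"
proof (cases "q \<in> A \<sigma>")
  case True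
  then show ?thesis using grad_cont[OF assms(1)] unfolding continuous_on_def by (simp add: Gh_inside)
next
  case False
  then show ?thesis using Gh_lim_boundary assms by blast
qed

lemma Gh_cont: "\<sigma> = 1 \<or> \<sigma> = -1 \<Longrightarrow> continuous_on (closure (A \<sigma>)) (Gh \<sigma>)"
  by (rule continuous_on_closure_extension[OF Gh_inside Gh_lim])

text \<open>The continuous extension of \<open>\<phi>\<close> to the closed duct, available by the
  Lipschitz bound. It gives \<open>\<phi>\<close> a single value on the shock and values on the two
  ends.\<close>

definition \<psi> :: "pt3 \<Rightarrow> real" where
  "\<psi> = (SOME h. continuous_on (closure (cyl \<Omega>)) h \<and> (\<forall>x\<in>cyl \<Omega>. h x = \<phi> x))"

lemma \<psi>: "continuous_on (closure (cyl \<Omega>)) \<psi>" "x \<in> cyl \<Omega> \<Longrightarrow> \<psi> x = \<phi> x"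
proof -
  obtain L where "L-lipschitz_on (cyl \<Omega>) \<phi>" using \<phi>_lipschitz by blast
  then have uc: "uniformly_continuous_on (cyl \<Omega>) \<phi>" by (rule lipschitz_on_uniformly_continuous)
  obtain h where "uniformly_continuous_on (closure (cyl \<Omega>)) h" "\<And>x. x \<in> cyl \<Omega> \<Longrightarrow> \<phi> x = h x"
  proof (rule uniformly_continuous_on_extension_on_closure[OF uc])
    fix g assume "uniformly_continuous_on (closure (cyl \<Omega>)) g" "\<And>x. x \<in> cyl \<Omega> \<Longrightarrow> \<phi> x = g x"
    then show thesis by (rule that)
  qed
  then have "\<exists>h. continuous_on (closure (cyl \<Omega>)) h \<and> (\<forall>x\<in>cyl \<Omega>. h x = \<phi> x)"
    using uniformly_continuous_imp_continuous by (intro exI[of _ h]) auto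
  from someI_ex[OF this] show "continuous_on (closure (cyl \<Omega>)) \<psi>" "x \<in> cyl \<Omega> \<Longrightarrow> \<psi> x = \<phi> x"
    unfolding \<psi>_def[symmetric] by auto
qed

lemma A_cyl: "\<sigma> = 1 \<or> \<sigma> = -1 \<Longrightarrow> A \<sigma> \<subseteq> cyl \<Omega>"
  using A_sub by (fastforce simp: Dminus_def Dplus_def)

lemma \<psi>_A: "\<sigma> = 1 \<or> \<sigma> = -1 \<Longrightarrow> continuous_on (closure (A \<sigma>)) \<psi>" "\<sigma> = 1 \<or> \<sigma> = -1 \<Longrightarrow> x \<in> A \<sigma> \<Longrightarrow> \<psi> x = \<phi> x"
  using continuous_on_subset[OF \<psi>(1) closure_mono[OF A_cyl]] \<psi>(2) A_cyl by blast+

end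

lemma C1_grad_sum:
  assumes "\<And>i. i \<in> I \<Longrightarrow> C1_grad A (u i) (g i)"
  shows "C1_grad A (\<lambda>x. \<Sum>i\<in>I. u i x) (\<lambda>x. \<Sum>i\<in>I. g i x)"
  unfolding C1_grad_def
proof
  show "\<forall>x\<in>A. GDERIV (\<lambda>x. \<Sum>i\<in>I. u i x) x :> (\<Sum>i\<in>I. g i x)"
  proof
    fix x assume x: "x \<in> A"
    show "GDERIV (\<lambda>x. \<Sum>i\<in>I. u i x) x :> (\<Sum>i\<in>I. g i x)"
      unfolding gderiv_def inner_sum_right
    proof (rule has_derivative_sum)
      fix i assume "i \<in> I"
      then show "(u i has_derivative (\<lambda>h. h \<bullet> g i x)) (at x)"
        using assms x unfolding C1_grad_def gderiv_def by blast
    qed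
  qed
  show "continuous_on A (\<lambda>x. \<Sum>i\<in>I. g i x)"
    using assms unfolding C1_grad_def by (intro continuous_on_sum) blast
qed

lemma C1_grad_subset: "C1_grad A u g \<Longrightarrow> B \<subseteq> A \<Longrightarrow> C1_grad B u g"
  unfolding C1_grad_def by (blast intro: continuous_on_subset)

lemma C1_div_divg:
  assumes "\<And>b. b \<in> Basis \<Longrightarrow> C1_grad U (\<lambda>x. F x \<bullet> b) (D b)" "\<And>x. x \<in> U \<Longrightarrow> F differentiable (at x)"
  shows "C1_div U F (divg F)"
  unfolding C1_div_def
proof (intro exI[of _ D] conjI ballI)
  fix x assume x: "x \<in> U"
  have F: "(F has_derivative frechet_derivative F (at x)) (at x)"
    using assms(2)[OF x] unfolding frechet_derivative_works .
  have "frechet_derivative F (at x) b \<bullet> b = D b x \<bullet> b" if b: "b \<in> Basis" for b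
  proof -
    have "((\<lambda>x. F x \<bullet> b) has_derivative (\<lambda>h. frechet_derivative F (at x) h \<bullet> b)) (at x)"
      by (rule has_derivative_inner_left[OF F])
    moreover have "((\<lambda>x. F x \<bullet> b) has_derivative (\<lambda>h. h \<bullet> D b x)) (at x)"
      using assms(1)[OF b] x unfolding C1_grad_def gderiv_def by blast
    ultimately have "(\<lambda>h. frechet_derivative F (at x) h \<bullet> b) = (\<lambda>h. h \<bullet> D b x)" by (rule has_derivative_unique)
    then show ?thesis by (metis inner_commute)
  qed
  then show "divg F x = (\<Sum>b\<in>Basis. D b x \<bullet> b)" unfolding divg_def by (intro sum.cong) auto
qed (rule assms(1))

lemma harmonic_shift_tendsto: "(\<lambda>n. (a / real (Suc n), 0 :: pt2)) \<longlonglongrightarrow> 0"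
proof -
  have "(\<lambda>n. a * inverse (real (Suc n))) \<longlonglongrightarrow> 0"
    by (rule tendsto_mult_right_zero[OF LIMSEQ_inverse_real_of_nat])
  then show ?thesis unfolding zero_prod_def by (intro tendsto_Pair tendsto_const) (simp add: divide_inverse)
qed

lemma harmonic_le:
  assumes "0 \<le> (a::real)" shows "a / real (Suc n) \<le> a"
proof -
  have "a * 1 \<le> a * real (Suc n)" using assms by (intro mult_left_mono) auto
  then show ?thesis by (simp add: divide_le_eq)
qed

section \<open>Boundary states of a solution\<close>

context shock_solution
begin

lemma Gh_wall:
  assumes \<sigma>: "\<sigma> = 1 \<or> \<sigma> = -1" and q: "q \<in> closure (A \<sigma>)" "snd q \<in> frontier \<Omega>" and \<nu>: "outward_unit_normal \<Omega> (snd q) \<nu>"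
  shows "Gh \<sigma> q \<bullet> (0, \<nu>) = 0"
proof -
  have n: "snd q \<notin> \<Omega>" using q(2) op by (simp add: frontier_def interior_open)
  then have q': "q \<in> closure (A \<sigma>) - A \<sigma>" using q(1) by (simp add: duct_part_def)
  have w: "q \<in> wall \<Omega>" by (rule closure_A_cases[OF \<sigma> q']) (use n in auto)
  obtain g where "side_grad \<phi> (A \<sigma>) q g" "g \<bullet> (0, \<nu>) = 0"
    using wall_grad[OF w A_mem[OF \<sigma>] q(1)] \<nu> by blast
  then show ?thesis using Gh_eqI[OF \<sigma> q'] by (simp add: side_grad_def)
qed

text \<open>Along a short ray a gap of width \<open>t0\<close> in the \<open>x1\<close> direction
  separates the end from the shock, so curves on either of them can be shifted horizontally into the
  region.\<close>

lemma near_end: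
  assumes \<sigma>: "\<sigma> = 1 \<or> \<sigma> = -1" and y: "y \<in> \<Omega>"
  shows "\<exists>t0>0. \<forall>d. \<exists>s0>0. \<forall>s. 0 \<le> s \<longrightarrow> s \<le> s0 \<longrightarrow> y + s *\<^sub>R d \<in> \<Omega> \<and> t0 < 1 + \<sigma> * f (y + s *\<^sub>R d)"
proof -
  define t0 where "t0 = (1 + \<sigma> * f y) / 2"
  have t0: "0 < t0" "t0 < 1 + \<sigma> * f y" using f_range[OF y] \<sigma> by (auto simp: t0_def)
  have "isCont (\<lambda>y. 1 + \<sigma> * f y) y" using isCont_f[OF y] by (intro continuous_intros)
  then have "((\<lambda>y. 1 + \<sigma> * f y) \<longlongrightarrow> 1 + \<sigma> * f y) (nhds y)"
    using tendsto_at_iff_tendsto_nhds[of "\<lambda>y. 1 + \<sigma> * f y" y] unfolding isCont_def by simp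
  then have "\<forall>\<^sub>F z in nhds y. t0 < 1 + \<sigma> * f z" using t0(2) by (rule order_tendstoD)
  moreover have "\<forall>\<^sub>F z in nhds y. z \<in> \<Omega>" using op y by (rule eventually_nhds_in_open)
  ultimately have "\<forall>\<^sub>F z in nhds y. z \<in> \<Omega> \<and> t0 < 1 + \<sigma> * f z" by (rule eventually_conj[rotated])
  from eventually_along_ray[OF this] show ?thesis using t0(1) by blast
qed

text \<open>A curve in the flat end enters the region under a small shift towards the shock, so the
  limit state gives the tangential derivatives of \<open>\<psi>\<close> along the end.\<close>

lemma end_curve:
  assumes \<sigma>: "\<sigma> = 1 \<or> \<sigma> = -1" and y: "y \<in> \<Omega>"
  shows "(- \<sigma>, y) \<in> closure (A \<sigma>) - A \<sigma>"
    "((\<lambda>s. (\<psi> (- \<sigma>, y + s *\<^sub>R d) - \<psi> (- \<sigma>, y)) / s) \<longlongrightarrow> Gh \<sigma> (- \<sigma>, y) \<bullet> (0, d)) (at_right 0)"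
proof -
  obtain t0 s0 where t0: "0 < t0" and s0: "0 < s0"
    and ray: "\<And>s. 0 \<le> s \<Longrightarrow> s \<le> s0 \<Longrightarrow> y + s *\<^sub>R d \<in> \<Omega> \<and> t0 < 1 + \<sigma> * f (y + s *\<^sub>R d)"
    using near_end[OF \<sigma> y] by metis
  define v :: "nat \<Rightarrow> pt3" where "v n = (\<sigma> * t0 / real (Suc n), 0)" for n
  have v: "v \<longlonglongrightarrow> 0" unfolding v_def by (rule harmonic_shift_tendsto)
  have inA: "(- \<sigma>, y + s *\<^sub>R d) + v n \<in> A \<sigma>" if s: "0 \<le> s" "s \<le> s0" for s n
  proof -
    define t where "t = t0 / real (Suc n)"
    have t: "0 < t" "t \<le> t0" using t0 harmonic_le[of t0 n] by (auto simp: t_def)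
    have "(- \<sigma>, y + s *\<^sub>R d) + v n = (- \<sigma> + \<sigma> * t, y + s *\<^sub>R d)" by (simp add: v_def t_def)
    then show ?thesis using ray[OF s] t \<sigma> by (auto simp: duct_part_def)
  qed
  have nA: "(- \<sigma>, y) \<notin> A \<sigma>" using \<sigma> by (auto simp: duct_part_def)
  have "(\<lambda>n. (- \<sigma>, y) + v n) \<longlonglongrightarrow> (- \<sigma>, y) + 0" by (intro tendsto_add tendsto_const v)
  moreover have "(- \<sigma>, y) + v n \<in> A \<sigma>" for n using inA[of 0 n] s0 by simp
  ultimately have "(- \<sigma>, y) \<in> closure (A \<sigma>)"
    unfolding closure_sequential by (intro exI[of _ "\<lambda>n. (- \<sigma>, y) + v n"]) (simp only: add_0_right simp_thms)
  then show q: "(- \<sigma>, y) \<in> closure (A \<sigma>) - A \<sigma>" using nA by blast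
  show "((\<lambda>s. (\<psi> (- \<sigma>, y + s *\<^sub>R d) - \<psi> (- \<sigma>, y)) / s) \<longlongrightarrow> Gh \<sigma> (- \<sigma>, y) \<bullet> (0, d)) (at_right 0)"
  proof (rule boundary_curve_derivative[where A = "A \<sigma>" and \<phi> = \<phi> and c = "\<lambda>s. (- \<sigma>, y + s *\<^sub>R d)"
        and c' = "\<lambda>_. (0, d)" and G = "grad \<phi>",
        OF A_GDERIV[OF \<sigma>] Gh_lim_boundary[OF \<sigma> q] nA \<psi>_A[OF \<sigma>] s0 _ _ _ tendsto_const v inA])
    show "continuous_on {0..s0} (\<lambda>s. (- \<sigma>, y + s *\<^sub>R d))" by (intro continuous_intros)
    show "((\<lambda>s. (- \<sigma>, y + s *\<^sub>R d)) has_vector_derivative (0, d)) (at s)" for s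
      unfolding has_vector_derivative_def by (auto intro!: derivative_eq_intros)
  qed simp_all
qed

text \<open>The curve on the shock does not depend on \<open>\<sigma>\<close>; only the direction of
  the shift does. The two instances compute one derivative from the two sides.\<close>

lemma shock_curve:
  assumes \<sigma>: "\<sigma> = 1 \<or> \<sigma> = -1" and y: "y \<in> \<Omega>"
  shows "(f y, y) \<in> closure (A \<sigma>) - A \<sigma>"
    "((\<lambda>s. (\<psi> (f (y + s *\<^sub>R d), y + s *\<^sub>R d) - \<psi> (f y, y)) / s) \<longlongrightarrow> Gh \<sigma> (f y, y) \<bullet> (Df y \<bullet> d, d)) (at_right 0)"
proof -
  obtain t0 s0 where t0: "0 < t0" and s0: "0 < s0"
    and ray: "\<And>s. 0 \<le> s \<Longrightarrow> s \<le> s0 \<Longrightarrow> y + s *\<^sub>R d \<in> \<Omega> \<and> t0 < 1 + \<sigma> * f (y + s *\<^sub>R d)"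
    using near_end[OF \<sigma> y] by metis
  define v :: "nat \<Rightarrow> pt3" where "v n = (- \<sigma> * t0 / real (Suc n), 0)" for n
  have v: "v \<longlonglongrightarrow> 0" unfolding v_def by (rule harmonic_shift_tendsto)
  have inA: "(f (y + s *\<^sub>R d), y + s *\<^sub>R d) + v n \<in> A \<sigma>" if s: "0 \<le> s" "s \<le> s0" for s n
  proof -
    define t where "t = t0 / real (Suc n)"
    have t: "0 < t" "t \<le> t0" using t0 harmonic_le[of t0 n] by (auto simp: t_def)
    have "(f (y + s *\<^sub>R d), y + s *\<^sub>R d) + v n = (f (y + s *\<^sub>R d) - \<sigma> * t, y + s *\<^sub>R d)" by (simp add: v_def t_def)
    then show ?thesis using ray[OF s] t \<sigma> by (auto simp: duct_part_def)
  qed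
  have nA: "(f y, y) \<notin> A \<sigma>" by (auto simp: duct_part_def)
  have "(\<lambda>n. (f y, y) + v n) \<longlonglongrightarrow> (f y, y) + 0" by (intro tendsto_add tendsto_const v)
  moreover have "(f y, y) + v n \<in> A \<sigma>" for n using inA[of 0 n] s0 by simp
  ultimately have "(f y, y) \<in> closure (A \<sigma>)"
    unfolding closure_sequential by (intro exI[of _ "\<lambda>n. (f y, y) + v n"]) (simp only: add_0_right simp_thms)
  then show q: "(f y, y) \<in> closure (A \<sigma>) - A \<sigma>" using nA by blast
  have lim: "((\<lambda>s. y + s *\<^sub>R d) \<longlongrightarrow> y) (at_right 0)"
    using tendsto_add[OF tendsto_const[of y] tendsto_scaleR[OF tendsto_ident_at[of 0 "{0<..}"] tendsto_const[of d]]] by simp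
  have DfC: "isCont Df y"
    using continuous_on_subset[OF Df(1) closure_subset] continuous_on_eq_continuous_at[OF op] y by blast
  show "((\<lambda>s. (\<psi> (f (y + s *\<^sub>R d), y + s *\<^sub>R d) - \<psi> (f y, y)) / s) \<longlongrightarrow> Gh \<sigma> (f y, y) \<bullet> (Df y \<bullet> d, d)) (at_right 0)"
  proof (rule boundary_curve_derivative[where A = "A \<sigma>" and \<phi> = \<phi> and c = "\<lambda>s. (f (y + s *\<^sub>R d), y + s *\<^sub>R d)"
        and c' = "\<lambda>s. (Df (y + s *\<^sub>R d) \<bullet> d, d)" and G = "grad \<phi>",
        OF A_GDERIV[OF \<sigma>] Gh_lim_boundary[OF \<sigma> q] nA \<psi>_A[OF \<sigma>] s0 _ _ _ _ v inA])
    show "continuous_on {0..s0} (\<lambda>s. (f (y + s *\<^sub>R d), y + s *\<^sub>R d))"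
    proof (intro continuous_on_Pair continuous_on_compose2[OF f_cont] continuous_intros image_subsetI)
      fix s assume "s \<in> {0..s0}"
      then show "y + s *\<^sub>R d \<in> closure \<Omega>" using ray[of s] by (intro in_closure) simp
    qed
    show "((\<lambda>s. (f (y + s *\<^sub>R d), y + s *\<^sub>R d)) has_vector_derivative (Df (y + s *\<^sub>R d) \<bullet> d, d)) (at s)" if "0 < s" "s < s0" for s
    proof (rule has_vector_derivative_Pair)
      show "((\<lambda>s. f (y + s *\<^sub>R d)) has_vector_derivative Df (y + s *\<^sub>R d) \<bullet> d) (at s)"
        using DERIV_along_line[OF GDERIV_f, of y s d] ray[of s] that
        by (simp add: has_real_derivative_iff_has_vector_derivative)
      show "((\<lambda>s. y + s *\<^sub>R d) has_vector_derivative d) (at s)"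
        unfolding has_vector_derivative_def by (auto intro!: derivative_eq_intros)
    qed
    show "((\<lambda>s. (Df (y + s *\<^sub>R d) \<bullet> d, d)) \<longlongrightarrow> (Df y \<bullet> d, d)) (at_right 0)"
      by (intro tendsto_Pair tendsto_inner tendsto_const isCont_tendsto_compose[OF DfC] lim)
  qed simp_all
qed

lemma inlet_fst: "y \<in> \<Omega> \<Longrightarrow> fst (Gh 1 (-1, y)) = um"
proof -
  assume y: "y \<in> \<Omega>"
  have q: "(-1, y) \<in> closure (A 1) - A 1" using end_curve(1)[of 1, OF _ y] by simp
  obtain g where "side_grad \<phi> (A 1) (-1, y) g" "fst g = um"
    using inlet_grad[OF y A_mem[of 1]] q by blast
  then show ?thesis using Gh_eqI[of 1, OF _ q] by (simp add: side_grad_def)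
qed

lemma outlet_state: "y \<in> \<Omega> \<Longrightarrow> norm (Gh (-1) (1, y)) = c1 \<and> 0 \<le> fst (Gh (-1) (1, y))"
proof -
  assume y: "y \<in> \<Omega>"
  have q: "(1, y) \<in> closure (A (-1)) - A (-1)" using end_curve(1)[of "-1", OF _ y] by simp
  obtain g where "side_grad \<phi> (A (-1)) (1, y) g" "norm g = c1" "0 \<le> fst g"
    using outlet_grad[OF y A_mem[of "-1"]] q by blast
  then show ?thesis using Gh_eqI[of "-1", OF _ q] by (simp add: side_grad_def)
qed

lemma \<psi>_inlet: "y \<in> \<Omega> \<Longrightarrow> \<psi> (-1, y) = - um"
proof -
  assume y: "y \<in> \<Omega>"
  have q: "(-1, y) \<in> closure (A 1) - A 1" using end_curve(1)[of 1, OF _ y] by simp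
  have sub: "A 1 \<subseteq> cyl \<Omega>" using A_cyl by simp
  have "(\<phi> \<longlongrightarrow> - um) (at (-1, y) within A 1)"
    by (rule tendsto_within_subset[OF inlet_value[OF y] sub])
  moreover have "(\<phi> \<longlongrightarrow> \<psi> (-1, y)) (at (-1, y) within A 1)"
  proof -
    have "(\<psi> \<longlongrightarrow> \<psi> (-1, y)) (at (-1, y) within closure (A 1))"
      using \<psi>_A(1)[of 1] q unfolding continuous_on_def by blast
    then have "(\<psi> \<longlongrightarrow> \<psi> (-1, y)) (at (-1, y) within A 1)" by (rule tendsto_within_subset[OF _ closure_subset])
    then show ?thesis
      by (rule Lim_transform_eventually) (simp add: eventually_at_filter \<psi>_A(2)[of 1])
  qed
  ultimately show ?thesis using tendsto_unique[OF within_nontrivial[OF q]] by blast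
qed

text \<open>\<open>\<psi>\<close> is constant on the inlet, so the limit of the gradient has no
  tangential part there, and its normal part is prescribed.\<close>

lemma inlet_state: "y \<in> \<Omega> \<Longrightarrow> Gh 1 (-1, y) = G0"
proof -
  assume y: "y \<in> \<Omega>"
  have "snd (Gh 1 (-1, y)) \<bullet> d = 0" for d
  proof -
    have "\<forall>\<^sub>F z in nhds y. z \<in> \<Omega>" using op y by (rule eventually_nhds_in_open)
    from eventually_along_ray[OF this, of d]
    obtain s0 where s0: "0 < s0" "\<And>s. 0 \<le> s \<Longrightarrow> s \<le> s0 \<Longrightarrow> y + s *\<^sub>R d \<in> \<Omega>" by blast
    have "\<forall>\<^sub>F s in at_right 0. (\<psi> (-1, y + s *\<^sub>R d) - \<psi> (-1, y)) / s = 0"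
      unfolding eventually_at_right_field using s0 \<psi>_inlet y by (intro exI[of _ s0]) auto
    then have "((\<lambda>s. (\<psi> (-1, y + s *\<^sub>R d) - \<psi> (-1, y)) / s) \<longlongrightarrow> 0) (at_right 0)" by (rule tendsto_eventually)
    moreover have "((\<lambda>s. (\<psi> (-1, y + s *\<^sub>R d) - \<psi> (-1, y)) / s) \<longlongrightarrow> Gh 1 (-1, y) \<bullet> (0, d)) (at_right 0)"
      using end_curve(2)[of 1, OF _ y, of d] by simp
    ultimately have "Gh 1 (-1, y) \<bullet> (0, d) = 0" using tendsto_unique trivial_limit_at_right_real by blast
    then show ?thesis by (simp add: inner_prod_def)
  qed
  then have "snd (Gh 1 (-1, y)) = 0" using inner_eq_zero_iff by blast
  then show ?thesis using inlet_fst[OF y] by (simp add: prod_eq_iff)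
qed

text \<open>\<open>\<psi>\<close> has the same tangential derivatives seen from both sides of the
  shock, so the jump of the gradient is a multiple of the normal.\<close>

lemma shock_jump: "y \<in> \<Omega> \<Longrightarrow> \<exists>k. Gh (-1) (f y, y) = Gh 1 (f y, y) - k *\<^sub>R (1, - Df y)"
proof -
  assume y: "y \<in> \<Omega>"
  define D where "D = Gh 1 (f y, y) - Gh (-1) (f y, y)"
  have "D \<bullet> (Df y \<bullet> d, d) = 0" for d
    using tendsto_unique[OF trivial_limit_at_right_real shock_curve(2)[of 1, OF _ y, of d] shock_curve(2)[of "-1", OF _ y, of d]]
    by (simp add: D_def inner_diff_left)
  then have "(fst D *\<^sub>R Df y + snd D) \<bullet> d = 0" for d
    by (simp add: inner_prod_def[of D] inner_add_left)
  then have "fst D *\<^sub>R Df y + snd D = 0" using inner_eq_zero_iff by blast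
  then have "snd D = fst D *\<^sub>R (- Df y)" by (simp add: add_eq_0_iff)
  then have "D = fst D *\<^sub>R (1, - Df y)" by (simp add: prod_eq_iff)
  then show ?thesis unfolding D_def by (metis diff_diff_eq2 add_diff_cancel_left')
qed

lemma shock_RH: "y \<in> \<Omega> \<Longrightarrow> flux (Gh (-1) (f y, y)) \<bullet> (1, - Df y) = flux (Gh 1 (f y, y)) \<bullet> (1, - Df y)"
proof -
  assume y: "y \<in> \<Omega>"
  obtain gm gp where g: "(grad \<phi> \<longlongrightarrow> gm) (at (f y, y) within A 1)" "(grad \<phi> \<longlongrightarrow> gp) (at (f y, y) within A (-1))"
    "flux gp \<bullet> (1, - grad f y) = flux gm \<bullet> (1, - grad f y)"
    using shock_grad[OF y f_range[OF y]] unfolding side_grad_def A_minus A_plus by blast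
  have "grad f y = Df y" by (rule grad_eqI[OF GDERIV_f[OF y]])
  moreover have "Gh 1 (f y, y) = gm" using Gh_eqI[of 1, OF _ shock_curve(1)[of 1, OF _ y] g(1)] by simp
  moreover have "Gh (-1) (f y, y) = gp" using Gh_eqI[of "-1", OF _ shock_curve(1)[of "-1", OF _ y] g(2)] by simp
  ultimately show ?thesis using g(3) by simp
qed

lemma Gh_plus_norm: "q \<in> closure (A (-1)) \<Longrightarrow> norm (Gh (-1) q) \<le> cs"
proof (cases "q \<in> A (-1)")
  case True
  then show ?thesis using subsonic[of q] by (simp add: Gh_inside A_plus)
next
  case False
  assume "q \<in> closure (A (-1))"
  then have q: "q \<in> closure (A (-1)) - A (-1)" using False by blast
  show ?thesis
  proof (rule tendsto_upperbound[OF tendsto_norm[OF Gh_lim_boundary[OF _ q]] _ within_nontrivial[OF q]])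
    show "\<forall>\<^sub>F x in at q within A (-1). norm (grad \<phi> x) \<le> cs"
      unfolding eventually_at_filter using subsonic A_plus by (intro always_eventually) (auto intro: less_imp_le)
  qed simp
qed

lemma inlet_closure: "y \<in> closure \<Omega> \<Longrightarrow> (- \<sigma>, y) \<in> closure (A \<sigma>)" if \<sigma>: "\<sigma> = 1 \<or> \<sigma> = -1"
proof -
  assume "y \<in> closure \<Omega>"
  then obtain x where x: "\<And>n. x n \<in> \<Omega>" "x \<longlonglongrightarrow> y" unfolding closure_sequential by blast
  have "(\<lambda>n. (- \<sigma>, x n)) \<longlonglongrightarrow> (- \<sigma>, y)" by (intro tendsto_Pair tendsto_const x)
  then show ?thesis
    by (rule closed_sequentially[OF closed_closure, rotated]) (use end_curve(1)[OF \<sigma> x(1)] in blast)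
qed

lemma inlet_state_closure: "y \<in> closure \<Omega> \<Longrightarrow> Gh 1 (-1, y) = G0"
proof -
  assume y: "y \<in> closure \<Omega>"
  then obtain x where x: "\<And>n. x n \<in> \<Omega>" "x \<longlonglongrightarrow> y" unfolding closure_sequential by blast
  have "(\<lambda>n. (-1, x n)) \<longlonglongrightarrow> (-1, y)" by (intro tendsto_Pair tendsto_const x)
  from continuous_on_tendsto_compose[OF Gh_cont[of 1] this]
  have "(\<lambda>n. Gh 1 (-1, x n)) \<longlonglongrightarrow> Gh 1 (-1, y)"
    using inlet_closure[of 1, OF _ y] inlet_closure[of 1, OF _ in_closure[OF x(1)]] by simp
  then show ?thesis using inlet_state[OF x(1)] by (simp add: LIMSEQ_const_iff)
qed

section \<open>The supersonic region\<close>

lemma C1_comp: "\<sigma> = 1 \<or> \<sigma> = -1 \<Longrightarrow> C1_grad (A \<sigma>) (\<lambda>x. grad \<phi> x \<bullet> b) (hess \<phi> b)"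
  by (rule C1_grad_subset[OF C2_on_C1_grad(2)[OF \<phi>_C2] A_sub])

lemma A_c2: "\<sigma> = 1 \<or> \<sigma> = -1 \<Longrightarrow> x \<in> A \<sigma> \<Longrightarrow> 0 < c2 ((norm (grad \<phi> x))\<^sup>2)"
  using \<phi>_c2 A_sub by blast

definition dq :: "pt3 \<Rightarrow> pt3" where
  "dq x = (\<Sum>b\<in>Basis. (grad \<phi> x \<bullet> b) *\<^sub>R hess \<phi> b x + (grad \<phi> x \<bullet> b) *\<^sub>R hess \<phi> b x)"

lemma C1_norm_sq: "\<sigma> = 1 \<or> \<sigma> = -1 \<Longrightarrow> C1_grad (A \<sigma>) (\<lambda>x. (norm (grad \<phi> x))\<^sup>2) dq"
proof -
  assume \<sigma>: "\<sigma> = 1 \<or> \<sigma> = -1"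
  have "C1_grad (A \<sigma>) (\<lambda>x. \<Sum>b\<in>Basis. (grad \<phi> x \<bullet> b) * (grad \<phi> x \<bullet> b)) dq"
    unfolding dq_def by (rule C1_grad_sum) (rule C1_grad_mult[OF C1_comp[OF \<sigma>] C1_comp[OF \<sigma>]])
  then show ?thesis unfolding power2_norm_eq_inner euclidean_inner[symmetric] .
qed

lemma C1_rho: "\<sigma> = 1 \<or> \<sigma> = -1 \<Longrightarrow> C1_grad (A \<sigma>) (\<lambda>x. R ((norm (grad \<phi> x))\<^sup>2))
    (\<lambda>x. (- R ((norm (grad \<phi> x))\<^sup>2) / (2 * c2 ((norm (grad \<phi> x))\<^sup>2))) *\<^sub>R dq x)"
proof -
  assume \<sigma>: "\<sigma> = 1 \<or> \<sigma> = -1"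
  show ?thesis
  proof (rule C1_grad_compose[OF C1_norm_sq[OF \<sigma>], where \<theta> = R and \<theta>' = "\<lambda>q. - R q / (2 * c2 q)"])
    show "(R has_real_derivative - R ((norm (grad \<phi> x))\<^sup>2) / (2 * c2 ((norm (grad \<phi> x))\<^sup>2))) (at ((norm (grad \<phi> x))\<^sup>2))"
      if "x \<in> A \<sigma>" for x by (rule DERIV_rho[OF A_c2[OF \<sigma> that]])
    have "isCont (\<lambda>q. - R q / (2 * c2 q)) q" if "0 < c2 q" for q
      using that by (intro continuous_intros isCont_rho isCont_c2) auto
    then show "continuous_on ((\<lambda>x. (norm (grad \<phi> x))\<^sup>2) ` A \<sigma>) (\<lambda>q. - R q / (2 * c2 q))"
      using A_c2[OF \<sigma>] by (intro continuous_at_imp_continuous_on) blast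
  qed
qed

lemma C1_pr: "\<sigma> = 1 \<or> \<sigma> = -1 \<Longrightarrow> C1_grad (A \<sigma>) (\<lambda>x. pr ((norm (grad \<phi> x))\<^sup>2) - pr (um\<^sup>2))
    (\<lambda>x. (- R ((norm (grad \<phi> x))\<^sup>2) / 2) *\<^sub>R dq x)"
proof -
  assume \<sigma>: "\<sigma> = 1 \<or> \<sigma> = -1"
  show ?thesis
  proof (rule C1_grad_compose[OF C1_norm_sq[OF \<sigma>], where \<theta> = "\<lambda>q. pr q - pr (um\<^sup>2)" and \<theta>' = "\<lambda>q. - R q / 2"])
    show "((\<lambda>q. pr q - pr (um\<^sup>2)) has_real_derivative - R ((norm (grad \<phi> x))\<^sup>2) / 2) (at ((norm (grad \<phi> x))\<^sup>2))"
      if "x \<in> A \<sigma>" for x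
      using DERIV_diff[OF DERIV_pr[OF A_c2[OF \<sigma> that]] DERIV_const] by simp
    have "isCont (\<lambda>q. - R q / 2) q" if "0 < c2 q" for q
      using that by (intro continuous_intros isCont_rho) auto
    then show "continuous_on ((\<lambda>x. (norm (grad \<phi> x))\<^sup>2) ` A \<sigma>) (\<lambda>q. - R q / 2)"
      using A_c2[OF \<sigma>] by (intro continuous_at_imp_continuous_on) blast
  qed
qed

lemma C1_div_flux: "\<sigma> = 1 \<or> \<sigma> = -1 \<Longrightarrow> C1_div (A \<sigma>) (\<lambda>x. flux (grad \<phi> x)) (\<lambda>_. 0)"
proof -
  assume \<sigma>: "\<sigma> = 1 \<or> \<sigma> = -1"
  have "C1_div (A \<sigma>) (\<lambda>x. flux (grad \<phi> x)) (divg (\<lambda>x. flux (grad \<phi> x)))"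
  proof (rule C1_div_divg)
    show "C1_grad (A \<sigma>) (\<lambda>x. flux (grad \<phi> x) \<bullet> b)
       (\<lambda>x. R ((norm (grad \<phi> x))\<^sup>2) *\<^sub>R hess \<phi> b x +
         (grad \<phi> x \<bullet> b) *\<^sub>R ((- R ((norm (grad \<phi> x))\<^sup>2) / (2 * c2 ((norm (grad \<phi> x))\<^sup>2))) *\<^sub>R dq x))" for b
      unfolding flux_def inner_scaleR_left by (rule C1_grad_mult[OF C1_rho[OF \<sigma>] C1_comp[OF \<sigma>]])
    show "(\<lambda>x. flux (grad \<phi> x)) differentiable at x" if "x \<in> A \<sigma>" for x
      using flux_divg A_sub[OF \<sigma>] that by blast
  qed
  then show ?thesis by (rule C1_div_cong) (use flux_divg A_sub[OF \<sigma>] in blast)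
qed

definition E :: "pt3 \<Rightarrow> pt3" where
  "E G = (fst G - um) *\<^sub>R flux G + (pr ((norm G)\<^sup>2) - pr (um\<^sup>2)) *\<^sub>R (1, 0)"

lemma E_inner: "E G \<bullet> (1, - a) = rel_energy G a" "E G \<bullet> (1, 0) = rel_energy G 0"
  by (simp_all add: E_def rel_energy_def inner_add_left mult.commute)

lemma E_G0: "E G0 = 0" unfolding E_def norm_G0 by (simp add: zero_prod_def)

lemma tendsto_E:
  assumes "(G \<longlongrightarrow> l) F" "0 < c2 ((norm l)\<^sup>2)"
  shows "((\<lambda>x. E (G x)) \<longlongrightarrow> E l) F"
  unfolding E_def
  by (intro tendsto_intros tendsto_flux assms isCont_tendsto_compose[OF isCont_pr[OF assms(2)]])

text \<open>Mass conservation leaves the flux paired with the gradient of the first velocity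
  component, plus the \<open>x1\<close> derivative of the pressure. By Bernoulli's law and the
  symmetry of the second derivatives the latter is the negative of the former.\<close>

lemma C1_div_E: "C1_div (A 1) (\<lambda>x. E (grad \<phi> x)) (\<lambda>_. 0)"
proof -
  have \<sigma>: "(1::real) = 1 \<or> (1::real) = -1" by simp
  have fst: "C1_grad (A 1) (\<lambda>x. fst (grad \<phi> x) - um) (hess \<phi> (1, 0))"
  proof -
    have "GDERIV (\<lambda>x. grad \<phi> x \<bullet> (1, 0) - um) x :> hess \<phi> (1, 0) x - 0" if "x \<in> A 1" for x
      using C1_comp[OF \<sigma>, of "(1, 0)"] that unfolding C1_grad_def by (intro GDERIV_diff GDERIV_const) blast
    then show ?thesis using C1_comp[OF \<sigma>, of "(1, 0)"] unfolding C1_grad_def by (simp add: inner_prod_def)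
  qed
  have "C1_div (A 1) (\<lambda>x. E (grad \<phi> x))
     (\<lambda>x. ((fst (grad \<phi> x) - um) * 0 + flux (grad \<phi> x) \<bullet> hess \<phi> (1, 0) x) +
        ((pr ((norm (grad \<phi> x))\<^sup>2) - pr (um\<^sup>2)) * 0 + (1, 0) \<bullet> ((- R ((norm (grad \<phi> x))\<^sup>2) / 2) *\<^sub>R dq x)))"
    unfolding E_def
    by (intro C1_div_add C1_div_scale[OF fst C1_div_flux[OF \<sigma>]] C1_div_scale[OF C1_pr[OF \<sigma>] C1_div_const])
  then show ?thesis
  proof (rule C1_div_cong)
    fix x assume x: "x \<in> A 1"
    let ?G = "grad \<phi> x" and ?R = "R ((norm (grad \<phi> x))\<^sup>2)"
    have sym: "hess \<phi> b x \<bullet> (1, 0) = hess \<phi> (1, 0) x \<bullet> b" for b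
      by (rule mixed_partials_eq[OF open_A x A_GDERIV[OF \<sigma>] C1_comp[OF \<sigma>] C1_comp[OF \<sigma>]])
    have "(1, 0) \<bullet> dq x = (\<Sum>b\<in>Basis. 2 * ((?G \<bullet> b) * (hess \<phi> (1, 0) x \<bullet> b)))"
      unfolding dq_def inner_sum_right inner_add_right inner_scaleR_right inner_commute[of "(1, 0)"] sym by simp
    also have "\<dots> = 2 * (?G \<bullet> hess \<phi> (1, 0) x)"
      by (simp only: sum_distrib_left[symmetric] euclidean_inner[of ?G "hess \<phi> (1, 0) x"])
    finally show "((fst ?G - um) * 0 + flux ?G \<bullet> hess \<phi> (1, 0) x) +
        ((pr ((norm ?G)\<^sup>2) - pr (um\<^sup>2)) * 0 + (1, 0) \<bullet> ((- ?R / 2) *\<^sub>R dq x)) = 0"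
      by (simp only: inner_scaleR_right) (simp add: flux_def)
  qed
qed

text \<open>With the weight \<open>pos2 (s - x1)\<close> the boundary terms have the right sign:
  \<open>E\<close> vanishes at the inlet state, has no normal component on the wall, and has
  nonpositive flux through a spacelike shock. The interior term is nonnegative, hence zero. The size
  \<open>\<epsilon>\<close> depends on neither \<open>s\<close> nor \<open>s'\<close>, as the
  continuation needs.\<close>

lemma hyperbolic_step:
  "\<exists>\<epsilon>>0. \<forall>s s'. s < s' \<longrightarrow> (\<forall>x\<in>A 1. fst x < s' \<longrightarrow> norm (grad \<phi> x - G0) < \<epsilon>) \<longrightarrow>
     (\<forall>x\<in>A 1. fst x < s \<longrightarrow> grad \<phi> x = G0)"
proof -
  have \<sigma>: "(1::real) = 1 \<or> (1::real) = -1" by simp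
  have "bounded (Df ` closure \<Omega>)"
    using bd Df(1) by (intro compact_imp_bounded compact_continuous_image) (auto simp: compact_closure)
  then obtain L where L: "\<And>y. y \<in> closure \<Omega> \<Longrightarrow> norm (Df y) \<le> L" by (auto simp: bounded_iff)
  obtain \<epsilon>1 \<mu> where \<epsilon>1: "0 < \<epsilon>1" "\<mu> < mach2 - 1"
    and sp: "\<And>G a k. norm (G - G0) < \<epsilon>1 \<Longrightarrow> norm a \<le> L \<Longrightarrow> norm (G - k *\<^sub>R (1, - a)) \<le> cs \<Longrightarrow>
       flux (G - k *\<^sub>R (1, - a)) \<bullet> (1, - a) = flux G \<bullet> (1, - a) \<Longrightarrow> (norm a)\<^sup>2 \<le> \<mu>"
    using shock_spacelike[of L] by blast
  \<comment> \<open>The maximum with 0 admits the slope 0, that is, the vertical slices met in the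
    interior term.\<close>
  define \<mu>' where "\<mu>' = max \<mu> 0"
  have \<mu>': "\<mu>' < mach2 - 1" "0 \<le> \<mu>'" "\<mu> \<le> \<mu>'" using \<epsilon>1(2) mach2_gt1 by (auto simp: \<mu>'_def)
  obtain \<epsilon>2 where \<epsilon>2: "0 < \<epsilon>2" "\<And>G a. norm (G - G0) < \<epsilon>2 \<Longrightarrow> (norm a)\<^sup>2 \<le> \<mu>' \<Longrightarrow> G \<noteq> G0 \<Longrightarrow> rel_energy G a < 0"
    using rel_energy_neg[OF \<mu>'(1)] by blast
  obtain \<epsilon>3 where \<epsilon>3: "0 < \<epsilon>3" "\<And>G. norm (G - G0) < \<epsilon>3 \<Longrightarrow> 0 < c2 ((norm G)\<^sup>2)"
    using c2_pos_near by blast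
  define \<epsilon> where "\<epsilon> = min \<epsilon>1 (min \<epsilon>2 \<epsilon>3) / 2"
  have \<epsilon>: "0 < \<epsilon>" "\<epsilon> < \<epsilon>1" "\<epsilon> < \<epsilon>2" "\<epsilon> < \<epsilon>3" using \<epsilon>1 \<epsilon>2 \<epsilon>3 by (auto simp: \<epsilon>_def)
  have neg: "rel_energy G a \<le> 0" if "norm (G - G0) \<le> \<epsilon>" "(norm a)\<^sup>2 \<le> \<mu>'" for G a
  proof (cases "G = G0")
    case True
    then show ?thesis using E_inner(1)[of G a] E_G0 by (simp only: inner_zero_left)
  next
    case False
    then show ?thesis using \<epsilon>2(2)[of G a] that \<epsilon> by force
  qed
  have "\<forall>x\<in>A 1. fst x < s \<longrightarrow> grad \<phi> x = G0"
    if ss: "s < s'" and close: "\<And>x. x \<in> A 1 \<Longrightarrow> fst x < s' \<Longrightarrow> norm (grad \<phi> x - G0) < \<epsilon>" for s s'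
  proof -
    have Gclose: "norm (Gh 1 q - G0) \<le> \<epsilon>" if q: "q \<in> closure (A 1) - A 1" "fst q < s'" for q
    proof (rule tendsto_upperbound[OF tendsto_norm[OF tendsto_diff[OF Gh_lim_boundary[OF \<sigma> q(1)] tendsto_const]] _ within_nontrivial[OF q(1)]])
      have "\<forall>\<^sub>F x in at q within A 1. fst x < s'"
        using tendsto_fst[OF tendsto_ident_at] q(2) by (rule order_tendstoD)
      moreover have "\<forall>\<^sub>F x in at q within A 1. x \<in> A 1" by (simp add: eventually_at_filter)
      ultimately show "\<forall>\<^sub>F x in at q within A 1. norm (grad \<phi> x - G0) \<le> \<epsilon>"
        by eventually_elim (use close in \<open>auto intro: less_imp_le\<close>)
    qed
    \<comment> \<open>Over \<open>\<Omega>\<close> the upstream state is close to \<open>G0\<close>,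
      the jump is normal and the state behind has speed at most \<open>cs\<close>, so
      \<open>shock_spacelike\<close> applies. Continuity of \<open>Df\<close> extends the bound to
      the frontier.\<close>
    have slope: "(norm (Df y))\<^sup>2 \<le> \<mu>'" if y: "y \<in> closure \<Omega>" "f y < s'" for y
    proof -
      have in_\<Omega>: "(norm (Df z))\<^sup>2 \<le> \<mu>'" if z: "z \<in> \<Omega>" "f z < s'" for z
      proof -
        obtain k where k: "Gh (-1) (f z, z) = Gh 1 (f z, z) - k *\<^sub>R (1, - Df z)" using shock_jump[OF z(1)] by blast
        have "norm (Gh 1 (f z, z) - G0) \<le> \<epsilon>" using Gclose shock_curve(1)[OF \<sigma> z(1)] z(2) by simp
        moreover have "norm (Gh 1 (f z, z) - k *\<^sub>R (1, - Df z)) \<le> cs"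
          unfolding k[symmetric] by (rule Gh_plus_norm) (use shock_curve(1)[of "-1", OF _ z(1)] in simp)
        ultimately have "(norm (Df z))\<^sup>2 \<le> \<mu>"
          using shock_RH[OF z(1)] L[OF in_closure[OF z(1)]] \<epsilon>(2) unfolding k by (intro sp[of "Gh 1 (f z, z)"]) auto
        then show ?thesis using \<mu>'(3) by linarith
      qed
      obtain x where x: "\<And>n. x n \<in> \<Omega>" "x \<longlonglongrightarrow> y" using y(1) unfolding closure_sequential by blast
      have fl: "(\<lambda>n. f (x n)) \<longlonglongrightarrow> f y" "(\<lambda>n. Df (x n)) \<longlonglongrightarrow> Df y"
        by (rule continuous_on_tendsto_compose[OF f_cont x(2) y(1)] continuous_on_tendsto_compose[OF Df(1) x(2) y(1)];
            simp add: in_closure x)+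
      have "\<forall>\<^sub>F n in sequentially. f (x n) < s'" using fl(1) y(2) by (rule order_tendstoD)
      then have "\<forall>\<^sub>F n in sequentially. (norm (Df (x n)))\<^sup>2 \<le> \<mu>'" by eventually_elim (use in_\<Omega> x in blast)
      then show ?thesis
        by (intro tendsto_upperbound[OF tendsto_power[OF tendsto_norm[OF fl(2)]]]) simp_all
    qed
    define w where "w x = pos2 (s - fst x)" for x :: pt3
    have wC: "C1_grad (A 1) w (\<lambda>x. (2 * max 0 (s - fst x)) *\<^sub>R (- (1, 0)))"
      unfolding w_def
    proof (rule C1_grad_compose[where \<theta> = pos2 and \<theta>' = "\<lambda>t. 2 * max 0 t", OF _ DERIV_pos2])
      have "GDERIV (\<lambda>x. s - fst x) x :> 0 - (1, 0)" for x :: pt3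
        by (intro GDERIV_diff GDERIV_const GDERIV_fst)
      then show "C1_grad (A 1) (\<lambda>x. s - fst x) (\<lambda>x. - (1, 0))" by (simp add: C1_grad_def)
    qed (intro continuous_intros)
    define V where "V x = w x *\<^sub>R E (grad \<phi> x)" for x
    define d where "d x = (2 * max 0 (s - fst x)) * (- rel_energy (grad \<phi> x) 0)" for x
    have VC: "C1_div (A 1) V d"
      unfolding V_def
      by (rule C1_div_cong[OF C1_div_scale[OF wC C1_div_E]])
        (simp only: d_def inner_scaleR_right inner_minus_right E_inner mult_zero_right add_0_left)
    have wl: "(w \<longlongrightarrow> w q) (at q within A 1)" for q
      unfolding w_def pos2_def by (intro tendsto_intros)
    have lim: "(V \<longlongrightarrow> (if fst q < s' then w q *\<^sub>R E (Gh 1 q) else 0)) (at q within A 1) \<and>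
        (\<exists>m. (d \<longlongrightarrow> m) (at q within A 1))" if q: "q \<in> closure (A 1) - A 1" for q
    proof (cases "fst q < s'")
      case True
      have c: "0 < c2 ((norm (Gh 1 q))\<^sup>2)" using le_less_trans[OF Gclose[OF q True] \<epsilon>(4)] by (rule \<epsilon>3(2))
      have El: "((\<lambda>x. E (grad \<phi> x)) \<longlongrightarrow> E (Gh 1 q)) (at q within A 1)"
        by (rule tendsto_E[OF Gh_lim_boundary[OF \<sigma> q] c])
      have "(d \<longlongrightarrow> (2 * max 0 (s - fst q)) * (- (E (Gh 1 q) \<bullet> (1, 0)))) (at q within A 1)"
        unfolding d_def E_inner(2)[symmetric] by (intro tendsto_intros El)
      moreover have "(V \<longlongrightarrow> w q *\<^sub>R E (Gh 1 q)) (at q within A 1)"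
        unfolding V_def by (intro tendsto_scaleR wl El)
      ultimately show ?thesis using True by auto
    next
      case False
      \<comment> \<open>Nothing is known about the boundary state beyond \<open>s'\<close>; the gap
        between \<open>s\<close> and \<open>s'\<close> makes the weight vanish near such
        points.\<close>
      then have "s < fst q" using ss by simp
      then have ev: "\<forall>\<^sub>F x in at q within A 1. s < fst x"
        using tendsto_fst[OF tendsto_ident_at] by (rule order_tendstoD(1)[rotated])
      then have "\<forall>\<^sub>F x in at q within A 1. V x = 0" "\<forall>\<^sub>F x in at q within A 1. d x = 0"
        by (eventually_elim, simp add: V_def w_def pos2_def d_def)+
      then show ?thesis using False by (auto intro: tendsto_eventually)
    qed
    have db: "bounded (d ` A 1)"
      by (rule bounded_image_if_limits[OF bounded_A[OF \<sigma>] C1_div_continuous[OF VC]]) (use lim in blast)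
    have int: "(LINT x:A 1|lborel. d x) \<le> 0"
    proof (rule duct_divergence_nonpos[OF \<Omega> \<sigma> Df VC db])
      fix q assume q: "q \<in> closure (A 1) - A 1"
      define l where "l = (if fst q < s' then w q *\<^sub>R E (Gh 1 q) else 0)"
      have qc: "snd q \<in> closure \<Omega>" using closure_duct_part(1)[OF f_cont, of q 1] q by blast
      have w0: "0 \<le> w q" by (simp add: w_def)
      show "\<exists>l. (V \<longlongrightarrow> l) (at q within A 1) \<and> (1 + 1 * fst q = 0 \<longrightarrow> 0 \<le> 1 * fst l) \<and>
        (fst q = f (snd q) \<longrightarrow> 1 * (l \<bullet> (1, - Df (snd q))) \<le> 0) \<and>
        (\<forall>\<nu>. snd q \<in> frontier \<Omega> \<longrightarrow> outward_unit_normal \<Omega> (snd q) \<nu> \<longrightarrow> l \<bullet> (0, \<nu>) \<le> 0)"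
      proof (intro exI[of _ l] conjI allI impI)
        show "(V \<longlongrightarrow> l) (at q within A 1)" using lim[OF q] unfolding l_def by blast
        show "0 \<le> 1 * fst l" if "1 + 1 * fst q = 0"
        proof -
          have "q = (-1, snd q)" using that by (simp add: prod_eq_iff)
          then have "Gh 1 q = G0" using inlet_state_closure[OF qc] by metis
          then show ?thesis by (simp only: l_def E_G0) simp
        qed
        show "1 * (l \<bullet> (1, - Df (snd q))) \<le> 0" if fq: "fst q = f (snd q)"
        proof (cases "fst q < s'")
          case True
          then have "rel_energy (Gh 1 q) (Df (snd q)) \<le> 0"
            using neg[OF Gclose[OF q] slope[OF qc]] fq by simp
          then show ?thesis
            using True w0 by (simp add: l_def E_inner mult_nonneg_nonpos)
        qed (simp add: l_def)
        show "l \<bullet> (0, \<nu>) \<le> 0" if "snd q \<in> frontier \<Omega>" "outward_unit_normal \<Omega> (snd q) \<nu>" for \<nu>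
          using Gh_wall[OF \<sigma> _ that] q by (simp add: l_def E_def flux_def inner_add_left)
      qed
    qed
    have d0: "0 \<le> d x" if x: "x \<in> A 1" for x
    proof (cases "fst x < s")
      case True
      then have "rel_energy (grad \<phi> x) 0 \<le> 0" using neg[of "grad \<phi> x" 0] close[OF x] ss \<mu>'(2) by force
      then show ?thesis by (simp add: d_def mult_nonneg_nonpos)
    qed (simp add: d_def)
    show ?thesis
    proof (intro ballI impI)
      fix x assume x: "x \<in> A 1" "fst x < s"
      have "d x = 0"
        by (rule continuous_nonneg_integral_eq_0[OF open_A bounded_A[OF \<sigma>] C1_div_continuous[OF VC] db d0 int x(1)])
      then have "rel_energy (grad \<phi> x) 0 = 0" using x(2) by (simp add: d_def)
      then show "grad \<phi> x = G0" using \<epsilon>2(2)[of "grad \<phi> x" 0] close[OF x(1)] x(2) ss \<mu>'(2) \<epsilon>(3) by force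
    qed
  qed
  then show ?thesis using \<epsilon>(1) by blast
qed

section \<open>Continuation up to the shock\<close>

lemma pm1: "(1::real) = 1 \<or> (1::real) = -1" "(-1::real) = 1 \<or> (-1::real) = -1" by auto

text \<open>Shifting a point to the left keeps it upstream of the shock, so points with
  \<open>x1 = s\<close> are limits of points strictly left of \<open>s\<close>. At the inlet there
  is no room for the shift, and the state is already known.\<close>

lemma upstream_closure:
  assumes P: "\<And>x. x \<in> A 1 \<Longrightarrow> fst x < s \<Longrightarrow> grad \<phi> x = G0" and q: "q \<in> closure (A 1)" "fst q \<le> s"
  shows "Gh 1 q = G0"
proof (cases "fst q = -1")
  case True
  then have "q = (-1, snd q)" by (simp add: prod_eq_iff)
  then show ?thesis using inlet_state_closure closure_duct_part(1)[OF f_cont q(1)] by metis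
next
  case False
  then have q1: "-1 < fst q" using closure_duct_part(2)[OF f_cont q(1)] by simp
  obtain x where x: "\<And>n. x n \<in> A 1" "x \<longlonglongrightarrow> q" using q(1) unfolding closure_sequential by blast
  \<comment> \<open>The first coordinate is clipped just below that of \<open>q\<close>. The
    clipping distance tends to 0 and is at most half the distance from \<open>q\<close> to the
    inlet, which keeps the points in the duct.\<close>
  define z where "z n = (min (fst (x n)) (fst q - (fst q + 1) / (2 * real (Suc n))), snd (x n))" for n
  have "(\<lambda>n. (fst q + 1) / 2 * inverse (real (Suc n))) \<longlonglongrightarrow> 0"
    by (rule tendsto_mult_right_zero[OF LIMSEQ_inverse_real_of_nat])
  then have "(\<lambda>n. (fst q + 1) / (2 * real (Suc n))) \<longlonglongrightarrow> 0" by (simp add: field_simps)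
  then have "z \<longlonglongrightarrow> (min (fst q) (fst q - 0), snd q)"
    unfolding z_def by (intro tendsto_Pair tendsto_min tendsto_diff tendsto_const tendsto_fst tendsto_snd x)
  then have zl: "z \<longlonglongrightarrow> q" by simp
  have zA: "z n \<in> A 1" "fst (z n) < s" for n
  proof -
    define a where "a = (fst q + 1) / (2 * real (Suc n))"
    have "a = (fst q + 1) / 2 / real (Suc n)" by (simp add: a_def)
    then have "a \<le> (fst q + 1) / 2" "0 < a"
      using q1 harmonic_le[of "(fst q + 1) / 2" n] by auto
    then have a: "-1 < fst q - a" "fst q - a < s" using q1 q(2) by auto
    have z: "z n = (min (fst (x n)) (fst q - a), snd (x n))" by (simp add: z_def a_def)
    show "fst (z n) < s" using a(2) by (simp add: z min_less_iff_disj)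
    show "z n \<in> A 1" using x(1)[of n] a(1) by (auto simp: duct_part_def z)
  qed
  have "(\<lambda>n. Gh 1 (z n)) \<longlonglongrightarrow> Gh 1 q"
    by (rule continuous_on_tendsto_compose[OF Gh_cont[OF pm1(1)] zl q(1)])
      (use zA(1) closure_subset[of "A 1"] in \<open>auto intro!: always_eventually\<close>)
  moreover have "Gh 1 (z n) = G0" for n using P[OF zA] Gh_inside[OF zA(1)] by simp
  ultimately show ?thesis by (simp add: LIMSEQ_const_iff)
qed

text \<open>Continuation in \<open>s\<close>: at \<open>s = -1\<close> the claim is vacuous. At the
  supremum the limit states are \<open>G0\<close>, so slightly beyond it the gradient is still
  within \<open>\<epsilon>\<close> of \<open>G0\<close>, and the energy step makes it equal to
  \<open>G0\<close>.\<close>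

lemma upstream: "x \<in> A 1 \<Longrightarrow> grad \<phi> x = G0"
proof -
  define S where "S = {s. -1 \<le> s \<and> s \<le> 1 \<and> (\<forall>x\<in>A 1. fst x < s \<longrightarrow> grad \<phi> x = G0)}"
  have m1: "-1 \<in> S" by (auto simp: S_def duct_part_def)
  have bdd: "bdd_above S" by (rule bdd_aboveI[of _ 1]) (simp add: S_def)
  define s where "s = Sup S"
  have s1: "-1 \<le> s" unfolding s_def by (rule cSup_upper[OF m1 bdd])
  have s2: "s \<le> 1" unfolding s_def by (rule cSup_least) (use m1 in blast, simp add: S_def)
  have P: "grad \<phi> x = G0" if x: "x \<in> A 1" "fst x < s" for x
  proof -
    obtain t where "t \<in> S" "fst x < t" using x(2) less_cSup_iff[OF _ bdd] m1 unfolding s_def by blast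
    then show ?thesis using x(1) by (simp add: S_def)
  qed
  obtain \<epsilon> where \<epsilon>: "0 < \<epsilon>" and step: "\<And>s s'. s < s' \<Longrightarrow> (\<And>x. x \<in> A 1 \<Longrightarrow> fst x < s' \<Longrightarrow> norm (grad \<phi> x - G0) < \<epsilon>) \<Longrightarrow>
     (\<forall>x\<in>A 1. fst x < s \<longrightarrow> grad \<phi> x = G0)"
    using hyperbolic_step by blast
  \<comment> \<open>Otherwise points at distance at least \<open>\<epsilon>\<close> from the
    incoming state accumulate at some \<open>q\<close> with \<open>x1\<close> at most
    \<open>s\<close>, where the continuous extension equals \<open>G0\<close>.\<close>
  have "\<exists>\<delta>>0. \<forall>x\<in>A 1. fst x < s + \<delta> \<longrightarrow> norm (grad \<phi> x - G0) < \<epsilon>"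
  proof (rule ccontr)
    assume neg: "\<not> ?thesis"
    have "\<exists>x\<in>A 1. fst x < s + 1 / real (Suc n) \<and> \<epsilon> \<le> norm (grad \<phi> x - G0)" for n
    proof -
      have "0 < 1 / real (Suc n)" by simp
      then show ?thesis using neg by (meson not_le)
    qed
    then obtain x where x: "\<And>n. x n \<in> A 1" "\<And>n. fst (x n) < s + 1 / real (Suc n)" "\<And>n. \<epsilon> \<le> norm (grad \<phi> (x n) - G0)"
      by metis
    have "bounded (range x)" using bounded_A[OF pm1(1)] x(1) by (meson bounded_subset image_subsetI)
    then obtain q r where r: "strict_mono r" "(x \<circ> r) \<longlonglongrightarrow> q"
      using bounded_imp_convergent_subsequence by blast
    have inc: "(x \<circ> r) n \<in> closure (A 1)" for n using x(1) closure_subset[of "A 1"] by auto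
    have q: "q \<in> closure (A 1)" by (rule closed_sequentially[OF closed_closure inc r(2)])
    have "(\<lambda>n. s + inverse (real (Suc n))) \<longlonglongrightarrow> s + 0" by (intro tendsto_intros LIMSEQ_inverse_real_of_nat)
    then have "(\<lambda>n. s + 1 / real (Suc (r n))) \<longlonglongrightarrow> s"
      using LIMSEQ_subseq_LIMSEQ[OF _ r(1)] by (fastforce simp: o_def inverse_eq_divide)
    then have "fst q \<le> s"
      by (rule LIMSEQ_le[OF tendsto_fst[OF r(2)]]) (use x(2) in \<open>auto intro: less_imp_le\<close>)
    then have "Gh 1 q = G0" using upstream_closure[OF P q] by blast
    moreover have "(\<lambda>n. Gh 1 ((x \<circ> r) n)) \<longlonglongrightarrow> Gh 1 q"
      by (rule continuous_on_tendsto_compose[OF Gh_cont[OF pm1(1)] r(2) q]) (use inc in \<open>auto intro!: always_eventually\<close>)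
    ultimately have "(\<lambda>n. norm (Gh 1 ((x \<circ> r) n) - G0)) \<longlonglongrightarrow> norm (G0 - G0)"
      by (intro tendsto_norm tendsto_diff tendsto_const) simp
    then have "\<epsilon> \<le> norm (G0 - G0)"
      by (rule LIMSEQ_le_const) (use x Gh_inside in auto)
    then show False using \<epsilon> by simp
  qed
  then obtain \<delta> where \<delta>: "0 < \<delta>" "\<And>x. x \<in> A 1 \<Longrightarrow> fst x < s + \<delta> \<Longrightarrow> norm (grad \<phi> x - G0) < \<epsilon>" by blast
  have next_s: "\<forall>x\<in>A 1. fst x < s + \<delta> / 2 \<longrightarrow> grad \<phi> x = G0"
    by (rule step[of _ "s + \<delta>"]) (use \<delta> in auto)
  have "s = 1"
  proof (rule ccontr)
    assume "s \<noteq> 1"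
    then have "min 1 (s + \<delta> / 2) \<in> S" using next_s s1 \<delta>(1) by (auto simp: S_def)
    then have "min 1 (s + \<delta> / 2) \<le> s" unfolding s_def by (rule cSup_upper[OF _ bdd])
    then show False using \<open>s \<noteq> 1\<close> s2 \<delta>(1) by linarith
  qed
  assume x: "x \<in> A 1"
  then have "fst x < 1" using f_range(2)[of "snd x"] by (simp add: duct_part_def)
  then show ?thesis using P[OF x] \<open>s = 1\<close> by simp
qed

section \<open>Integration along horizontal lines\<close>

lemma DERIV_\<psi>_line:
  assumes "\<sigma> = 1 \<or> \<sigma> = -1" "(t, y) \<in> A \<sigma>"
  shows "((\<lambda>t. \<psi> (t, y)) has_real_derivative fst (grad \<phi> (t, y))) (at t)"
proof -
  have "((\<lambda>t. \<phi> ((0, y) + t *\<^sub>R (1, 0))) has_real_derivative grad \<phi> (t, y) \<bullet> (1, 0)) (at t)"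
    by (rule DERIV_along_line) (use A_GDERIV[OF assms] in simp)
  then have D: "((\<lambda>t. \<phi> (t, y)) has_real_derivative fst (grad \<phi> (t, y))) (at t)" by (simp add: inner_prod_def)
  define U where "U = (\<lambda>t. (t, y)) -` A \<sigma>"
  have "open U" unfolding U_def
    by (rule open_vimage[OF open_A]) (intro continuous_intros)
  then show ?thesis
    by (rule has_field_derivative_transform_within_open[OF D]) (use assms \<psi>_A(2)[OF assms(1)] in \<open>auto simp: U_def\<close>)
qed

lemma line_closure:
  assumes "\<sigma> = 1 \<or> \<sigma> = -1" "y \<in> \<Omega>" "0 \<le> 1 + \<sigma> * t" "0 \<le> \<sigma> * (f y - t)"
  shows "(t, y) \<in> closure (A \<sigma>)"
proof -
  consider "t = - \<sigma>" | "t = f y" | "0 < 1 + \<sigma> * t" "0 < \<sigma> * (f y - t)"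
    using assms(1,3,4) by fastforce
  then show ?thesis
  proof cases
    case 3
    then have "(t, y) \<in> A \<sigma>" using assms(2) by (simp add: duct_part_def)
    then show ?thesis using closure_subset by blast
  qed (use end_curve(1)[OF assms(1,2)] shock_curve(1)[OF assms(1,2)] in auto)
qed

lemma \<psi>_line_cont: "\<sigma> = 1 \<or> \<sigma> = -1 \<Longrightarrow> y \<in> \<Omega> \<Longrightarrow> (\<And>t. t \<in> T \<Longrightarrow> 0 \<le> 1 + \<sigma> * t \<and> 0 \<le> \<sigma> * (f y - t)) \<Longrightarrow>
    continuous_on T (\<lambda>t. \<psi> (t, y))"
  by (rule continuous_on_compose2[OF \<psi>_A(1)]) (auto intro!: continuous_intros line_closure)

lemma \<psi>_upstream: "y \<in> \<Omega> \<Longrightarrow> -1 \<le> t \<Longrightarrow> t \<le> f y \<Longrightarrow> \<psi> (t, y) = um * t"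
proof (cases "t = -1")
  case False
  assume y: "y \<in> \<Omega>" and t: "-1 \<le> t" "t \<le> f y"
  have "\<psi> (t, y) - um * t = \<psi> (-1, y) - um * (-1)"
  proof (rule DERIV_isconst_end[of "-1" t "\<lambda>t. \<psi> (t, y) - um * t"])
    show "continuous_on {-1..t} (\<lambda>t. \<psi> (t, y) - um * t)"
      using t by (intro continuous_intros \<psi>_line_cont[OF pm1(1) y]) auto
    fix r assume r: "-1 < r" "r < t"
    then have A: "(r, y) \<in> A 1" using y t by (simp add: duct_part_def)
    show "((\<lambda>t. \<psi> (t, y) - um * t) has_real_derivative 0) (at r)"
      using DERIV_diff[OF DERIV_\<psi>_line[OF pm1(1) A] DERIV_cmult_Id[of um]] upstream[OF A] by simp
  qed (use t False in auto)
  then show ?thesis using \<psi>_inlet[OF y] by simp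
qed (use \<psi>_inlet in simp)

lemma Gh_upstream: "q \<in> closure (A 1) \<Longrightarrow> Gh 1 q = G0"
proof -
  assume q: "q \<in> closure (A 1)"
  have "fst q \<le> 1" using closure_duct_part[OF f_cont q] f_range_closure[of "snd q"] by auto
  then show ?thesis using upstream_closure[OF upstream q] by blast
qed

lemma flux_G0: "flux G0 \<bullet> (1, a) = m0"
  by (simp only: flux_def norm_G0) simp

text \<open>The jump condition together with the known upstream state; passing to the limit also
  covers the rim where the shock meets the wall.\<close>

lemma shock_flux: "y \<in> closure \<Omega> \<Longrightarrow> flux (Gh (-1) (f y, y)) \<bullet> (1, - Df y) = m0"
proof -
  assume y: "y \<in> closure \<Omega>"
  then obtain x where x: "\<And>n. x n \<in> \<Omega>" "x \<longlonglongrightarrow> y" unfolding closure_sequential by blast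
  have xc: "x n \<in> closure \<Omega>" for n using in_closure[OF x(1)] .
  have fl: "(\<lambda>n. f (x n)) \<longlonglongrightarrow> f y"
    by (rule continuous_on_tendsto_compose[OF f_cont x(2) y]) (use xc in auto)
  have Dl: "(\<lambda>n. Df (x n)) \<longlonglongrightarrow> Df y"
    by (rule continuous_on_tendsto_compose[OF Df(1) x(2) y]) (use xc in auto)
  have ql: "(\<lambda>n. (f (x n), x n)) \<longlonglongrightarrow> (f y, y)" by (intro tendsto_Pair fl x)
  have qc: "(f (x n), x n) \<in> closure (A (-1))" for n using shock_curve(1)[OF pm1(2) x(1)] by blast
  have q: "(f y, y) \<in> closure (A (-1))" by (rule closed_sequentially[OF closed_closure qc ql])
  have "(\<lambda>n. Gh (-1) (f (x n), x n)) \<longlonglongrightarrow> Gh (-1) (f y, y)"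
    by (rule continuous_on_tendsto_compose[OF Gh_cont[OF pm1(2)] ql q]) (use qc in \<open>auto intro!: always_eventually\<close>)
  then have "(\<lambda>n. flux (Gh (-1) (f (x n), x n)) \<bullet> (1, - Df (x n))) \<longlonglongrightarrow> flux (Gh (-1) (f y, y)) \<bullet> (1, - Df y)"
    by (intro tendsto_inner tendsto_flux tendsto_Pair tendsto_minus tendsto_const Dl c2_pos_norm Gh_plus_norm q)
  moreover have "flux (Gh (-1) (f (x n), x n)) \<bullet> (1, - Df (x n)) = m0" for n
  proof -
    have "Gh 1 (f (x n), x n) = G0" by (rule Gh_upstream) (use shock_curve(1)[OF pm1(1) x(1)] in blast)
    then show ?thesis using shock_RH[OF x(1)] flux_G0 by simp
  qed
  ultimately show "flux (Gh (-1) (f y, y)) \<bullet> (1, - Df y) = m0" by (simp add: LIMSEQ_const_iff)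
qed

text \<open>The weak form of the downstream problem with test function \<open>\<eta>\<close>. The
  field \<open>flux (grad \<phi> x) - (m0, 0)\<close> has no flux through the shock and the wall, so
  the outlet is the only boundary term, and \<open>out\<close> fixes its sign.\<close>

lemma elliptic_test:
  assumes \<eta>: "C1_grad (A (-1)) \<eta> \<eta>'" and lim: "\<And>q. q \<in> closure (A (-1)) - A (-1) \<Longrightarrow> (\<eta> \<longlongrightarrow> \<eta>h q) (at q within A (-1))"
    and b: "bounded ((\<lambda>x. (flux (grad \<phi> x) - (m0, 0)) \<bullet> \<eta>' x) ` A (-1))"
    and out: "\<And>y. y \<in> closure \<Omega> \<Longrightarrow> 0 \<le> \<eta>h (1, y) * (m0 - fst (flux (Gh (-1) (1, y))))"
    and pos: "\<And>x. x \<in> A (-1) \<Longrightarrow> 0 \<le> (flux (grad \<phi> x) - (m0, 0)) \<bullet> \<eta>' x"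
    and x: "x \<in> A (-1)"
  shows "(flux (grad \<phi> x) - (m0, 0)) \<bullet> \<eta>' x = 0"
proof -
  define V where "V x = \<eta> x *\<^sub>R (flux (grad \<phi> x) - (m0, 0))" for x
  have "C1_div (A (-1)) (\<lambda>x. flux (grad \<phi> x) + (- (m0, 0))) (\<lambda>x. 0 + 0)"
    by (rule C1_div_add[OF C1_div_flux[OF pm1(2)] C1_div_const])
  then have "C1_div (A (-1)) (\<lambda>x. flux (grad \<phi> x) - (m0, 0)) (\<lambda>x. 0)" by (simp only: add_uminus_conv_diff add_0_right)
  from C1_div_cong[OF C1_div_scale[OF \<eta> this]]
  have VC: "C1_div (A (-1)) V (\<lambda>x. (flux (grad \<phi> x) - (m0, 0)) \<bullet> \<eta>' x)" unfolding V_def by simp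
  have "(LINT x:A (-1)|lborel. (flux (grad \<phi> x) - (m0, 0)) \<bullet> \<eta>' x) \<le> 0"
  proof (rule duct_divergence_nonpos[OF \<Omega> pm1(2) Df VC b])
    fix q assume q: "q \<in> closure (A (-1)) - A (-1)"
    define l where "l = \<eta>h q *\<^sub>R (flux (Gh (-1) q) - (m0, 0))"
    have qc: "snd q \<in> closure \<Omega>" using closure_duct_part(1)[OF f_cont, of q "-1"] q by blast
    show "\<exists>l. (V \<longlongrightarrow> l) (at q within A (-1)) \<and> (1 + (-1) * fst q = 0 \<longrightarrow> 0 \<le> (-1) * fst l) \<and>
        (fst q = f (snd q) \<longrightarrow> (-1) * (l \<bullet> (1, - Df (snd q))) \<le> 0) \<and>
        (\<forall>\<nu>. snd q \<in> frontier \<Omega> \<longrightarrow> outward_unit_normal \<Omega> (snd q) \<nu> \<longrightarrow> l \<bullet> (0, \<nu>) \<le> 0)"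
    proof (intro exI[of _ l] conjI allI impI)
      show "(V \<longlongrightarrow> l) (at q within A (-1))"
        unfolding V_def l_def using q
        by (intro tendsto_scaleR lim tendsto_diff tendsto_const tendsto_flux Gh_lim_boundary[OF pm1(2)] c2_pos_norm Gh_plus_norm) auto
      show "0 \<le> (-1) * fst l" if "1 + (-1) * fst q = 0"
      proof -
        have "q = (1, snd q)" using that by (simp add: prod_eq_iff)
        then have "0 \<le> \<eta>h q * (m0 - fst (flux (Gh (-1) q)))" using out[OF qc] by metis
        then show ?thesis by (simp add: l_def algebra_simps)
      qed
      show "(-1) * (l \<bullet> (1, - Df (snd q))) \<le> 0" if "fst q = f (snd q)"
      proof -
        have "q = (f (snd q), snd q)" using that by (simp add: prod_eq_iff)
        then have "flux (Gh (-1) q) \<bullet> (1, - Df (snd q)) = m0" using shock_flux[OF qc] by metis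
        then have "l \<bullet> (1, - Df (snd q)) = 0" by (simp add: l_def inner_diff_left)
        then show ?thesis by simp
      qed
      show "l \<bullet> (0, \<nu>) \<le> 0" if "snd q \<in> frontier \<Omega>" "outward_unit_normal \<Omega> (snd q) \<nu>" for \<nu>
        using Gh_wall[OF pm1(2) _ that] q by (simp add: l_def flux_def inner_diff_left)
    qed
  qed
  from continuous_nonneg_integral_eq_0[OF open_A bounded_A[OF pm1(2)] C1_div_continuous[OF VC] b pos this x]
  show ?thesis .
qed

end

section \<open>The subsonic region\<close>

text \<open>Lagrange's identity gives the determinant of \<open>e\<close> and \<open>n\<close>
  square 1, and Cramer's rule does the rest.\<close>

lemma orthonormal_pair_eq_0:
  fixes z e n :: pt2
  assumes "norm e = 1" "norm n = 1" "e \<bullet> n = 0" "z \<bullet> e = 0" "z \<bullet> n = 0"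
  shows "z = 0"
proof -
  obtain z1 z2 e1 e2 n1 n2 where [simp]: "z = (z1, z2)" "e = (e1, e2)" "n = (n1, n2)" by (cases z; cases e; cases n)
  have h: "e1 * e1 + e2 * e2 = 1" "n1 * n1 + n2 * n2 = 1" "e1 * n1 + e2 * n2 = 0" "z1 * e1 + z2 * e2 = 0" "z1 * n1 + z2 * n2 = 0"
    using assms by (auto simp: norm_eq_1)
  have "(e1 * n2 - e2 * n1)\<^sup>2 = (e1 * e1 + e2 * e2) * (n1 * n1 + n2 * n2) - (e1 * n1 + e2 * n2)\<^sup>2"
    by (simp add: power2_eq_square algebra_simps)
  then have D: "e1 * n2 - e2 * n1 \<noteq> 0" using h by auto
  have "z1 * (e1 * n2 - e2 * n1) = (z1 * e1 + z2 * e2) * n2 - (z1 * n1 + z2 * n2) * e2" by (simp add: algebra_simps)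
  moreover have "z2 * (e1 * n2 - e2 * n1) = (z1 * n1 + z2 * n2) * e1 - (z1 * e1 + z2 * e2) * n1" by (simp add: algebra_simps)
  ultimately have "z1 * (e1 * n2 - e2 * n1) = 0" "z2 * (e1 * n2 - e2 * n1) = 0" unfolding h by simp_all
  then show ?thesis using D by (simp add: zero_prod_def)
qed

context shock_solution
begin

abbreviation Gp :: pt3 where "Gp \<equiv> (up, 0)"

lemma norm_Gp [simp]: "norm Gp = up" using u_plus_props by (simp add: norm_Pair)

lemma flux_Gp: "flux Gp = (m0, 0)"
  using u_plus_props(3) by (simp only: flux_def norm_Gp) simp

text \<open>Built from \<open>\<psi>\<close> instead of \<open>\<phi>\<close> so that it has values
  on the outlet, where its minimum is studied.\<close>

definition w :: "pt3 \<Rightarrow> real" where "w x = \<psi> x - up * fst x"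

lemma w_cont: "\<sigma> = 1 \<or> \<sigma> = -1 \<Longrightarrow> continuous_on (closure (A \<sigma>)) w"
  unfolding w_def by (intro continuous_intros \<psi>_A)

lemma w_lim: "q \<in> closure (A (-1)) \<Longrightarrow> (w \<longlongrightarrow> w q) (at q within A (-1))"
  using w_cont[OF pm1(2)] tendsto_within_subset[OF _ closure_subset] unfolding continuous_on_def by blast

lemma w_C1: "C1_grad (A (-1)) w (\<lambda>x. grad \<phi> x - Gp)"
  unfolding C1_grad_def
proof
  show "\<forall>x\<in>A (-1). GDERIV w x :> grad \<phi> x - Gp"
  proof
    fix x assume x: "x \<in> A (-1)"
    have "GDERIV \<psi> x :> grad \<phi> x"
      by (rule GDERIV_transform_open[OF A_GDERIV[OF pm1(2) x] open_A x]) (simp add: \<psi>_A(2)[OF pm1(2)])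
    moreover have "GDERIV (\<lambda>x. up * fst x) x :> up *\<^sub>R (1, 0) + fst x *\<^sub>R 0"
      by (intro GDERIV_mult GDERIV_const GDERIV_fst)
    ultimately have "GDERIV w x :> grad \<phi> x - (up *\<^sub>R (1, 0) + fst x *\<^sub>R 0)"
      unfolding w_def by (rule GDERIV_diff)
    then show "GDERIV w x :> grad \<phi> x - Gp" by simp
  qed
  show "continuous_on (A (-1)) (\<lambda>x. grad \<phi> x - Gp)"
    by (intro continuous_intros grad_cont[OF pm1(2)])
qed

text \<open>\<open>Gp\<close> is the subsonic state with flux \<open>(m0, 0)\<close>, so the product
  compares two subsonic states and vanishes only if they coincide.\<close>

lemma mono_term: "x \<in> A (-1) \<Longrightarrow> 0 \<le> (flux (grad \<phi> x) - (m0, 0)) \<bullet> (grad \<phi> x - Gp)"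
  "x \<in> A (-1) \<Longrightarrow> (flux (grad \<phi> x) - (m0, 0)) \<bullet> (grad \<phi> x - Gp) = 0 \<Longrightarrow> grad \<phi> x = Gp"
proof -
  assume x: "x \<in> A (-1)"
  have *: "0 < (flux (grad \<phi> x) - (m0, 0)) \<bullet> (grad \<phi> x - Gp)" if "grad \<phi> x \<noteq> Gp"
    unfolding flux_Gp[symmetric]
    by (rule flux_strict_mono[OF _ _ that]) (use subsonic[of x] x A_plus u_plus_props(2) norm_Gp in auto)
  show "0 \<le> (flux (grad \<phi> x) - (m0, 0)) \<bullet> (grad \<phi> x - Gp)"
  proof (cases "grad \<phi> x = Gp")
    case True
    then show ?thesis by (simp only: diff_self inner_zero_right)
  qed (use * in force)
  show "grad \<phi> x = Gp" if "(flux (grad \<phi> x) - (m0, 0)) \<bullet> (grad \<phi> x - Gp) = 0"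
    using * that by force
qed

lemma bounded_terms: "bounded (w ` A (-1))" "bounded ((\<lambda>x. (flux (grad \<phi> x) - (m0, 0)) \<bullet> (grad \<phi> x - Gp)) ` A (-1))"
proof -
  show "bounded (w ` A (-1))"
    by (rule bounded_image_if_limits[OF bounded_A[OF pm1(2)] C1_grad_continuous[OF w_C1]]) (use w_lim in blast)
  have lim: "((\<lambda>x. (flux (grad \<phi> x) - (m0, 0)) \<bullet> (grad \<phi> x - Gp)) \<longlongrightarrow> (flux (Gh (-1) q) - (m0, 0)) \<bullet> (Gh (-1) q - Gp)) (at q within A (-1))"
    if q: "q \<in> closure (A (-1))" for q
    by (intro tendsto_inner tendsto_diff tendsto_const tendsto_flux Gh_lim[OF pm1(2) q] c2_pos_norm Gh_plus_norm q)
  show "bounded ((\<lambda>x. (flux (grad \<phi> x) - (m0, 0)) \<bullet> (grad \<phi> x - Gp)) ` A (-1))"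
  proof (rule bounded_image_if_limits[OF bounded_A[OF pm1(2)]])
    show "continuous_on (A (-1)) (\<lambda>x. (flux (grad \<phi> x) - (m0, 0)) \<bullet> (grad \<phi> x - Gp))"
      unfolding continuous_on_def
    proof
      fix x assume x: "x \<in> A (-1)"
      then have "x \<in> closure (A (-1))" using closure_subset by blast
      from lim[OF this] show "((\<lambda>x. (flux (grad \<phi> x) - (m0, 0)) \<bullet> (grad \<phi> x - Gp)) \<longlongrightarrow> (flux (grad \<phi> x) - (m0, 0)) \<bullet> (grad \<phi> x - Gp)) (at x within A (-1))"
        unfolding Gh_inside[OF x] .
    qed
  qed (use lim in blast)
qed

lemma outlet_closure: "y \<in> closure \<Omega> \<Longrightarrow> (1, y) \<in> closure (A (-1))"
  using inlet_closure[OF pm1(2)] by simp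

lemma outlet_not_A: "(1, y) \<notin> A (-1)" by (simp add: duct_part_def)

lemma outlet_state_closure: "y \<in> closure \<Omega> \<Longrightarrow> norm (Gh (-1) (1, y)) = c1 \<and> 0 \<le> fst (Gh (-1) (1, y))"
proof -
  assume y: "y \<in> closure \<Omega>"
  then obtain x where x: "\<And>n. x n \<in> \<Omega>" "x \<longlonglongrightarrow> y" unfolding closure_sequential by blast
  have "(\<lambda>n. (1, x n)) \<longlonglongrightarrow> (1, y)" by (intro tendsto_Pair tendsto_const x)
  from continuous_on_tendsto_compose[OF Gh_cont[OF pm1(2)] this outlet_closure[OF y]]
  have l: "(\<lambda>n. Gh (-1) (1, x n)) \<longlonglongrightarrow> Gh (-1) (1, y)"
    using outlet_closure[OF in_closure[OF x(1)]] by simp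
  have "(\<lambda>n. c1) \<longlonglongrightarrow> norm (Gh (-1) (1, y))"
    using tendsto_norm[OF l] outlet_state[OF x(1)] by simp
  moreover have "0 \<le> fst (Gh (-1) (1, y))"
    by (rule LIMSEQ_le_const[OF tendsto_fst[OF l]]) (use outlet_state[OF x(1)] in blast)
  ultimately show ?thesis by (simp add: LIMSEQ_const_iff)
qed

section \<open>Minimum principle\<close>

text \<open>The test function \<open>- pos2 (k - w x)\<close> vanishes on the outlet, and its minus
  sign makes the interior term nonnegative. Hence the gradient of \<open>w\<close> vanishes wherever
  \<open>w < k\<close>, and such a value could be followed unchanged to the outlet.\<close>

lemma w_lower:
  assumes k: "\<And>y. y \<in> closure \<Omega> \<Longrightarrow> k \<le> w (1, y)" and x: "x \<in> A (-1)"
  shows "k \<le> w x"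
proof -
  define \<eta> where "\<eta> x = - pos2 (k - w x)" for x
  define \<eta>' where "\<eta>' x = (2 * max 0 (k - w x)) *\<^sub>R (grad \<phi> x - Gp)" for x
  have \<eta>C: "C1_grad (A (-1)) \<eta> \<eta>'"
    unfolding \<eta>_def \<eta>'_def
  proof (rule C1_grad_compose[OF w_C1, where \<theta> = "\<lambda>t. - pos2 (k - t)" and \<theta>' = "\<lambda>t. 2 * max 0 (k - t)"])
    show "((\<lambda>t. - pos2 (k - t)) has_real_derivative 2 * max 0 (k - t)) (at t)" for t
    proof -
      have "((\<lambda>t. pos2 (k - t)) has_real_derivative 2 * max 0 (k - t) * (0 - 1)) (at t)"
        by (rule DERIV_chain2[OF DERIV_pos2]) (rule DERIV_diff[OF DERIV_const DERIV_ident])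
      from DERIV_minus[OF this] show ?thesis by simp
    qed
  qed (intro continuous_intros)
  have d: "(flux (grad \<phi> x) - (m0, 0)) \<bullet> \<eta>' x = 2 * max 0 (k - w x) * ((flux (grad \<phi> x) - (m0, 0)) \<bullet> (grad \<phi> x - Gp))" for x
    by (simp only: \<eta>'_def inner_scaleR_right)
  have zero: "(flux (grad \<phi> x) - (m0, 0)) \<bullet> \<eta>' x = 0" if "x \<in> A (-1)" for x
  proof (rule elliptic_test[OF \<eta>C, where \<eta>h = \<eta>])
    show "(\<eta> \<longlongrightarrow> \<eta> q) (at q within A (-1))" if "q \<in> closure (A (-1)) - A (-1)" for q
      unfolding \<eta>_def pos2_def using that by (intro tendsto_intros w_lim) auto
    obtain B1 where B1: "\<And>x. x \<in> A (-1) \<Longrightarrow> \<bar>w x\<bar> \<le> B1"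
      using bounded_terms(1) unfolding bounded_iff real_norm_def by blast
    obtain B2 where B2: "\<And>x. x \<in> A (-1) \<Longrightarrow> \<bar>(flux (grad \<phi> x) - (m0, 0)) \<bullet> (grad \<phi> x - Gp)\<bar> \<le> B2"
      using bounded_terms(2) unfolding bounded_iff real_norm_def by blast
    show "bounded ((\<lambda>x. (flux (grad \<phi> x) - (m0, 0)) \<bullet> \<eta>' x) ` A (-1))"
      unfolding bounded_iff
    proof (intro exI[of _ "2 * (\<bar>k\<bar> + B1) * B2"] ballI)
      fix z assume "z \<in> (\<lambda>x. (flux (grad \<phi> x) - (m0, 0)) \<bullet> \<eta>' x) ` A (-1)"
      then obtain x where x: "x \<in> A (-1)" "z = (flux (grad \<phi> x) - (m0, 0)) \<bullet> \<eta>' x" by blast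
      have mx: "\<bar>2 * max 0 (k - w x)\<bar> \<le> 2 * (\<bar>k\<bar> + B1)" using B1[OF x(1)] by (auto simp: max_def)
      have "\<bar>2 * max 0 (k - w x)\<bar> * \<bar>(flux (grad \<phi> x) - (m0, 0)) \<bullet> (grad \<phi> x - Gp)\<bar> \<le> 2 * (\<bar>k\<bar> + B1) * B2"
        by (rule mult_mono[OF mx B2[OF x(1)] order_trans[OF abs_ge_zero mx] abs_ge_zero])
      then show "norm z \<le> 2 * (\<bar>k\<bar> + B1) * B2" unfolding x(2) d real_norm_def abs_mult .
    qed
    show "0 \<le> \<eta> (1, y) * (m0 - fst (flux (Gh (-1) (1, y))))" if "y \<in> closure \<Omega>" for y
      using k[OF that] by (simp add: \<eta>_def pos2_def)
    show "0 \<le> (flux (grad \<phi> x) - (m0, 0)) \<bullet> \<eta>' x" if "x \<in> A (-1)" for x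
      unfolding d by (intro mult_nonneg_nonneg mono_term(1)[OF that]) auto
  qed (rule that)
  obtain x1 y where xy: "x = (x1, y)" by (cases x) auto
  have y: "y \<in> \<Omega>" and x1: "f y < x1" "x1 < 1" using x by (auto simp: xy duct_part_def)
  \<comment> \<open>The horizontal segment from \<open>x\<close> to the outlet stays behind the
    shock, because that region lies to the right of a graph.\<close>
  have "pos2 (k - w (1, y)) = pos2 (k - w (x1, y))"
  proof (rule DERIV_isconst_end[OF x1(2), of "\<lambda>t. pos2 (k - w (t, y))"])
    show "continuous_on {x1..1} (\<lambda>t. pos2 (k - w (t, y)))"
      unfolding w_def using x1 by (intro continuous_intros \<psi>_line_cont[OF pm1(2) y]) auto
    fix t assume t: "x1 < t" "t < 1"
    then have tA: "(t, y) \<in> A (-1)" using y x1 by (simp add: duct_part_def)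
    have Dw: "((\<lambda>t. w (t, y)) has_real_derivative fst (grad \<phi> (t, y)) - up) (at t)"
      unfolding w_def using DERIV_diff[OF DERIV_\<psi>_line[OF pm1(2) tA] DERIV_cmult_Id[of up]] by simp
    have "((\<lambda>t. pos2 (k - w (t, y))) has_real_derivative 2 * max 0 (k - w (t, y)) * (0 - (fst (grad \<phi> (t, y)) - up))) (at t)"
      by (rule DERIV_chain2[OF DERIV_pos2]) (rule DERIV_diff[OF DERIV_const Dw])
    moreover have "max 0 (k - w (t, y)) = 0 \<or> grad \<phi> (t, y) = Gp"
      using zero[OF tA] mono_term(2)[OF tA] unfolding d by (auto simp del: max_def)
    then have "2 * max 0 (k - w (t, y)) * (0 - (fst (grad \<phi> (t, y)) - up)) = 0" by auto
    ultimately show "((\<lambda>t. pos2 (k - w (t, y))) has_real_derivative 0) (at t)" by (simp only:)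
  qed
  then have "pos2 (k - w (x1, y)) = 0" using k[OF in_closure[OF y]] by (simp add: pos2_def)
  then show ?thesis by (simp add: pos2_def xy max_def split: if_splits)
qed

section \<open>The state on the outlet\<close>

text \<open>Over \<open>\<Omega>\<close> the minimum is tested along opposite rays. At a frontier
  point only the boundary curve is available, in both senses; it kills the component tangent to the
  wall, and the wall condition kills the normal one.\<close>

lemma outlet_tangential:
  assumes p: "p \<in> closure \<Omega>" and min: "\<And>y. y \<in> closure \<Omega> \<Longrightarrow> w (1, p) \<le> w (1, y)"
  shows "snd (Gh (-1) (1, p)) = 0"
proof (cases "p \<in> \<Omega>")
  case True
  have nn: "0 \<le> snd (Gh (-1) (1, p)) \<bullet> d" for d
  proof -
    have "\<forall>\<^sub>F z in nhds p. z \<in> \<Omega>" using op True by (rule eventually_nhds_in_open)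
    from eventually_along_ray[OF this, of d]
    obtain s0 where s0: "0 < s0" "\<And>s. 0 \<le> s \<Longrightarrow> s \<le> s0 \<Longrightarrow> p + s *\<^sub>R d \<in> \<Omega>" by blast
    have "\<forall>\<^sub>F s in at_right 0. 0 \<le> (\<psi> (1, p + s *\<^sub>R d) - \<psi> (1, p)) / s"
      unfolding eventually_at_right_field
    proof (intro exI[of _ s0] conjI s0 allI impI)
      fix s assume "0 < s" "s < s0"
      then show "0 \<le> (\<psi> (1, p + s *\<^sub>R d) - \<psi> (1, p)) / s"
        using min[OF in_closure[OF s0(2)[of s]]] by (simp add: w_def)
    qed
    moreover have "((\<lambda>s. (\<psi> (1, p + s *\<^sub>R d) - \<psi> (1, p)) / s) \<longlongrightarrow> Gh (-1) (1, p) \<bullet> (0, d)) (at_right 0)"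
      using end_curve(2)[OF pm1(2) True, of d] by simp
    ultimately have "0 \<le> Gh (-1) (1, p) \<bullet> (0, d)"
      by (intro tendsto_lowerbound[OF _ _ trivial_limit_at_right_real]) auto
    then show ?thesis by (simp add: inner_prod_def)
  qed
  have "snd (Gh (-1) (1, p)) \<bullet> snd (Gh (-1) (1, p)) = 0"
    using nn[of "- snd (Gh (-1) (1, p))"] nn[of "snd (Gh (-1) (1, p))"] unfolding inner_minus_right by linarith
  then show ?thesis by simp
next
  case False
  then have fr: "p \<in> frontier \<Omega>" using p op by (simp add: frontier_def interior_open)
  obtain r e n h where rep: "local_graph_rep \<Omega> p r e n h" and h: "C3_fun h"
    using \<Omega>(2) fr unfolding C3_boundary_def by blast
  note g = local_graph_repD[OF rep]
  have h0: "h 0 = 0" using rep unfolding local_graph_rep_def by blast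
  have en: "e \<bullet> e = 1" "n \<bullet> n = 1" "n \<bullet> e = 0" using g(2-4) by (simp_all add: norm_eq_1 inner_commute)
  have hc: "isCont h t" and h'c: "isCont (deriv h) t" for t
    using C3_fun_C1[OF h] DERIV_isCont continuous_on_eq_continuous_at[OF open_UNIV] by blast+
  define z where "z = snd (Gh (-1) (1, p))"
  have q: "(1, p) \<in> closure (A (-1)) - A (-1)" using outlet_closure[OF p] outlet_not_A by blast
  have normal: "z \<bullet> n = deriv h 0 * (z \<bullet> e)"
  proof -
    have "h differentiable (at 0)" using C3_fun_C1(1)[OF h] real_differentiable_def by blast
    then have "outward_unit_normal \<Omega> p ((1 / sqrt (1 + (deriv h 0)\<^sup>2)) *\<^sub>R (n - deriv h 0 *\<^sub>R e))"
      unfolding outward_unit_normal_def using rep by blast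
    from Gh_wall[OF pm1(2) outlet_closure[OF p], unfolded snd_conv, OF fr this]
    have "z \<bullet> ((1 / sqrt (1 + (deriv h 0)\<^sup>2)) *\<^sub>R (n - deriv h 0 *\<^sub>R e)) = 0"
      unfolding inner_prod_def z_def by simp
    moreover have "0 < 1 + (deriv h 0)\<^sup>2" by (simp add: add_pos_nonneg)
    ultimately show ?thesis by (simp add: inner_diff_right)
  qed
  have tang: "0 \<le> \<tau> * (z \<bullet> e + deriv h 0 * (z \<bullet> n))" if \<tau>: "\<tau> = 1 \<or> \<tau> = -1" for \<tau> :: real
  proof -
    \<comment> \<open>The boundary curve near \<open>p\<close>, run in the sense
      \<open>\<tau>\<close> with parameter \<open>s\<close> and pushed into \<open>\<Omega>\<close>
      by \<open>t\<close> along \<open>- n\<close>.\<close>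
    define \<kappa> where "\<kappa> s t = p + (\<tau> * s) *\<^sub>R e + (h (\<tau> * s) - t) *\<^sub>R n" for s t
    have fs: "(fst \<longlongrightarrow> 0) (nhds (0 :: real, 0 :: real))" "(snd \<longlongrightarrow> 0) (nhds (0 :: real, 0 :: real))"
      using tendsto_fst[OF filterlim_ident, of "(0 :: real, 0 :: real)"]
        tendsto_snd[OF filterlim_ident, of "(0 :: real, 0 :: real)"] by simp_all
    have "((\<lambda>x. \<kappa> (fst x) (snd x)) \<longlongrightarrow> \<kappa> 0 0) (nhds (0, 0))"
      unfolding \<kappa>_def by (intro tendsto_intros isCont_tendsto_compose[OF hc] fs)
    then have "\<forall>\<^sub>F x in nhds (0, 0). dist (\<kappa> (fst x) (snd x)) p < r"
      using g(1) h0 by (intro tendstoD) (simp_all add: \<kappa>_def)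
    then obtain \<delta> where \<delta>: "0 < \<delta>" "\<And>x. dist x (0, 0) < \<delta> \<Longrightarrow> dist (\<kappa> (fst x) (snd x)) p < r"
      unfolding eventually_nhds_metric by blast
    define s0 where "s0 = \<delta> / 3"
    have s0: "0 < s0" using \<delta>(1) by (simp add: s0_def)
    have ball: "\<kappa> s t \<in> ball p r" if "0 \<le> s" "s \<le> s0" "0 \<le> t" "t \<le> s0" for s t
    proof -
      have "dist (s, t) (0, 0) < \<delta>"
        using norm_Pair_le[of s t] that \<delta>(1) by (simp add: dist_norm s0_def)
      from \<delta>(2)[OF this] show ?thesis by (simp add: dist_commute)
    qed
    have \<kappa>e: "(\<kappa> s t - p) \<bullet> e = \<tau> * s" "(\<kappa> s t - p) \<bullet> n = h (\<tau> * s) - t" for s t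
      by (simp_all add: \<kappa>_def inner_add_left en g(4))
    have in_\<Omega>: "\<kappa> s t \<in> \<Omega>" if "0 \<le> s" "s \<le> s0" "0 < t" "t \<le> s0" for s t
      using g(5)[OF ball[of s t]] that by (simp add: \<kappa>e)
    have \<kappa>c: "continuous_on {0..s0} (\<lambda>s. \<kappa> s t)" for t
      unfolding \<kappa>_def by (intro continuous_at_imp_continuous_on ballI continuous_intros isCont_o2[OF _ hc])
    define t where "t m = s0 / real (Suc m)" for m
    have t: "0 < t m" "t m \<le> s0" for m using s0 harmonic_le[of s0 m] by (auto simp: t_def)
    \<comment> \<open>The shock may reach the outlet at \<open>p\<close>, so the horizontal shift
      has to adapt to \<open>f\<close>. On the pushed curve, a compact subset of
      \<open>\<Omega>\<close>, \<open>f\<close> stays below 1 by a positive margin.\<close>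
    have "\<exists>a. 0 < a \<and> a < t m \<and> (\<forall>s. 0 \<le> s \<longrightarrow> s \<le> s0 \<longrightarrow> f (\<kappa> s (t m)) < 1 - a)" for m
    proof -
      have "continuous_on {0..s0} (\<lambda>s. f (\<kappa> s (t m)))"
        by (rule continuous_on_compose2[OF f_cont \<kappa>c]) (rule image_subsetI, rule in_closure, rule in_\<Omega>, use t in auto)
      from continuous_attains_sup[OF compact_Icc _ this]
      obtain s1 where s1: "s1 \<in> {0..s0}" "\<And>s. s \<in> {0..s0} \<Longrightarrow> f (\<kappa> s (t m)) \<le> f (\<kappa> s1 (t m))"
        using s0 by auto
      have "f (\<kappa> s1 (t m)) < 1" using s1(1) t by (intro f_range in_\<Omega>) auto
      define b where "b = min (t m) (1 - f (\<kappa> s1 (t m))) / 2"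
      have b: "0 < b" "b < t m" "f (\<kappa> s1 (t m)) < 1 - b"
        using \<open>f (\<kappa> s1 (t m)) < 1\<close> t[of m] by (auto simp: b_def min_def field_simps)
      have "f (\<kappa> s (t m)) < 1 - b" if "0 \<le> s" "s \<le> s0" for s
        using s1(2)[of s] that b(3) by simp
      then show ?thesis using b by blast
    qed
    then obtain a where a: "\<And>m. 0 < a m" "\<And>m. a m < t m" "\<And>m s. 0 \<le> s \<Longrightarrow> s \<le> s0 \<Longrightarrow> f (\<kappa> s (t m)) < 1 - a m"
      by metis
    have t_lim: "t \<longlonglongrightarrow> 0"
      using tendsto_fst[OF harmonic_shift_tendsto[of s0]] unfolding t_def[abs_def] by simp
    have a_lim: "a \<longlonglongrightarrow> 0"
      by (rule Lim_null_comparison[OF _ t_lim]) (use a in \<open>auto intro!: always_eventually intro: less_imp_le simp: abs_of_pos\<close>)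
    define v where "v m = (- a m, - t m *\<^sub>R n)" for m
    have "(\<lambda>m. (- a m, - t m *\<^sub>R n)) \<longlonglongrightarrow> (- 0, - 0 *\<^sub>R n)" by (intro tendsto_intros a_lim t_lim)
    then have v: "v \<longlonglongrightarrow> 0" unfolding v_def[abs_def] by (simp add: zero_prod_def)
    define c where "c s = (1 :: real, \<kappa> s 0)" for s
    define c' where "c' s = (0 :: real, \<tau> *\<^sub>R e + (\<tau> * deriv h (\<tau> * s)) *\<^sub>R n)" for s
    have vA: "c s + v m \<in> A (-1)" if "0 \<le> s" "s \<le> s0" for m s
    proof -
      have "c s + v m = (1 - a m, \<kappa> s (t m))" by (simp add: c_def v_def \<kappa>_def algebra_simps)
      then show ?thesis using a(1)[of m] a(3)[OF that, of m] in_\<Omega>[OF that t] by (simp add: duct_part_def)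
    qed
    have c0: "c 0 = (1, p)" by (simp add: c_def \<kappa>_def h0)
    have lim: "((\<lambda>s. (\<psi> (c s) - \<psi> (1, p)) / s) \<longlongrightarrow> Gh (-1) (1, p) \<bullet> (0, \<tau> *\<^sub>R e + (\<tau> * deriv h 0) *\<^sub>R n)) (at_right 0)"
    proof (rule boundary_curve_derivative[where A = "A (-1)" and \<phi> = \<phi> and c = c and c' = c' and G = "grad \<phi>",
          OF A_GDERIV[OF pm1(2)] Gh_lim_boundary[OF pm1(2) q] outlet_not_A \<psi>_A[OF pm1(2)] s0 c0 _ _ _ v vA])
      show "continuous_on {0..s0} c" unfolding c_def by (intro continuous_on_Pair continuous_on_const \<kappa>c)
      show "(c has_vector_derivative c' s) (at s)" for s
        unfolding c_def c'_def
      proof (rule has_vector_derivative_Pair[OF has_vector_derivative_const])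
        have "((\<lambda>s. h (\<tau> * s)) has_real_derivative deriv h (\<tau> * s) * \<tau>) (at s)"
          by (rule DERIV_chain2[OF C3_fun_C1(1)[OF h] DERIV_cmult_Id])
        then show "((\<lambda>s. \<kappa> s 0) has_vector_derivative \<tau> *\<^sub>R e + (\<tau> * deriv h (\<tau> * s)) *\<^sub>R n) (at s)"
          unfolding \<kappa>_def
          by (auto intro!: derivative_eq_intros simp: has_vector_derivative_def has_field_derivative_def algebra_simps)
      qed
      have "((\<lambda>s. \<tau> * s) \<longlongrightarrow> \<tau> * 0) (at_right 0)" by (intro tendsto_intros)
      from isCont_tendsto_compose[OF h'c this]
      show "(c' \<longlongrightarrow> (0, \<tau> *\<^sub>R e + (\<tau> * deriv h 0) *\<^sub>R n)) (at_right 0)"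
        unfolding c'_def by (intro tendsto_intros) simp
    qed
    have "\<forall>\<^sub>F s in at_right 0. 0 \<le> (\<psi> (c s) - \<psi> (1, p)) / s"
      unfolding eventually_at_right_field
    proof (intro exI[of _ s0] conjI s0 allI impI)
      fix s assume s: "0 < s" "s < s0"
      have "(\<lambda>m. \<kappa> s (t m)) \<longlonglongrightarrow> \<kappa> s 0" unfolding \<kappa>_def by (intro tendsto_intros t_lim)
      then have "\<kappa> s 0 \<in> closure \<Omega>"
        by (rule closed_sequentially[OF closed_closure, rotated]) (use s t in_\<Omega> in_closure in auto)
      from min[OF this] show "0 \<le> (\<psi> (c s) - \<psi> (1, p)) / s" using s by (simp add: w_def c_def)
    qed
    then have "0 \<le> Gh (-1) (1, p) \<bullet> (0, \<tau> *\<^sub>R e + (\<tau> * deriv h 0) *\<^sub>R n)"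
      by (intro tendsto_lowerbound[OF lim _ trivial_limit_at_right_real]) auto
    then show ?thesis unfolding inner_prod_def z_def by (simp add: inner_add_right algebra_simps)
  qed
  have "z \<bullet> e + deriv h 0 * (z \<bullet> n) = 0" using tang[of 1] tang[of "-1"] by simp
  then have "(1 + (deriv h 0)\<^sup>2) * (z \<bullet> e) = 0" unfolding normal by (simp add: power2_eq_square algebra_simps)
  moreover have "1 + (deriv h 0)\<^sup>2 \<noteq> 0" using add_pos_nonneg[of 1 "(deriv h 0)\<^sup>2"] by simp
  ultimately have "z \<bullet> e = 0" by simp
  then have "z = 0" using orthonormal_pair_eq_0[OF g(2-4)] normal by simp
  then show ?thesis by (simp add: z_def)
qed

lemma outlet_min: "\<exists>p\<in>closure \<Omega>. \<forall>y\<in>closure \<Omega>. w (1, p) \<le> w (1, y)"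
proof (rule continuous_attains_inf)
  show "compact (closure \<Omega>)" using bd by (simp add: compact_closure)
  show "closure \<Omega> \<noteq> {}" using ne by simp
  show "continuous_on (closure \<Omega>) (\<lambda>y. w (1, y))"
  proof (rule continuous_on_compose2[OF w_cont[OF pm1(2)]])
    show "continuous_on (closure \<Omega>) (\<lambda>y. (1, y))" by (intro continuous_intros)
    show "(\<lambda>y. (1, y)) ` closure \<Omega> \<subseteq> closure (A (-1))" using outlet_closure by blast
  qed
qed

text \<open>At a minimum of \<open>w\<close> on the outlet the velocity is \<open>(c1, 0)\<close>. By the minimum principle
  \<open>w\<close> does not increase in the direction \<open>x1\<close> there; if the shock meets the outlet at that
  point, the jump condition gives the speed directly.\<close>
lemma c1_le_up: "c1 \<le> up"
proof -
  obtain p where p: "p \<in> closure \<Omega>" and min: "\<And>y. y \<in> closure \<Omega> \<Longrightarrow> w (1, p) \<le> w (1, y)"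
    using outlet_min by blast
  have "snd (Gh (-1) (1, p)) = 0" by (rule outlet_tangential[OF p min])
  moreover have "fst (Gh (-1) (1, p)) = c1"
  proof -
    have "Gh (-1) (1, p) = (fst (Gh (-1) (1, p)), 0)" using calculation by (simp add: prod_eq_iff)
    then have "norm (Gh (-1) (1, p)) = \<bar>fst (Gh (-1) (1, p))\<bar>" by (metis norm_Pair norm_zero power2_abs power_zero_numeral real_norm_def real_sqrt_abs add_0_right)
    then show ?thesis using outlet_state_closure[OF p] by simp
  qed
  ultimately have g: "Gh (-1) (1, p) = (c1, 0)" by (simp add: prod_eq_iff)
  have fp: "f p \<le> 1" using f_range_closure[OF p] by blast
  show ?thesis
  proof (cases "f p = 1")
    case True
    have "norm ((c1, 0) :: pt3) = c1" using c1 by (simp add: norm_Pair)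
    then have "R (c1\<^sup>2) * c1 = m0" using shock_flux[OF p] unfolding True g flux_def by simp
    then show ?thesis using mass_flux_strict_mono[of up c1] u_plus_props c1 by force
  next
    case False
    \<comment> \<open>A quarter of the distance from the shock to the outlet above \<open>p\<close>:
      near \<open>p\<close> the shock keeps a distance over \<open>2 * s0\<close> from the outlet,
      enough for a step \<open>s\<close> and a shift, each at most \<open>s0\<close>.\<close>
    define s0 where "s0 = (1 - f p) / 4"
    have s0: "0 < s0" using False fp by (simp add: s0_def)
    obtain \<delta> where \<delta>: "0 < \<delta>" "\<And>y. y \<in> closure \<Omega> \<Longrightarrow> dist y p < \<delta> \<Longrightarrow> f y < 1 - 2 * s0"
    proof -
      have "0 < 2 * s0" using s0 by simp
      then obtain \<delta> where "0 < \<delta>" "\<And>y. y \<in> closure \<Omega> \<Longrightarrow> dist y p < \<delta> \<Longrightarrow> dist (f y) (f p) < 2 * s0"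
        using f_cont p unfolding continuous_on_iff by metis
      moreover have "f y < 1 - 2 * s0" if "dist (f y) (f p) < 2 * s0" for y
      proof -
        have "f y - f p < 2 * s0" using abs_ge_self[of "f y - f p"] that unfolding dist_real_def by linarith
        moreover have "f p = 1 - 4 * s0" by (simp add: s0_def field_simps)
        ultimately show ?thesis by linarith
      qed
      ultimately show thesis using that[of \<delta>] by blast
    qed
    have "\<exists>y\<in>\<Omega>. dist y p < min \<delta> (1 / real (Suc n))" for n
    proof -
      have "0 < min \<delta> (1 / real (Suc n))" using \<delta>(1) by simp
      then show ?thesis using p unfolding closure_approachable by blast
    qed
    then obtain y where y: "\<And>n. y n \<in> \<Omega>" "\<And>n. dist (y n) p < min \<delta> (1 / real (Suc n))" by metis
    \<comment> \<open>The point \<open>p\<close> may lie on the frontier, so the shift also moves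
      the cross-section point to \<open>y n\<close> in \<open>\<Omega>\<close>.\<close>
    define v where "v n = (- s0 / real (Suc n), y n - p)" for n
    have "(\<lambda>n. y n - p) \<longlonglongrightarrow> 0"
    proof (rule Lim_null_comparison)
      show "\<forall>\<^sub>F n in sequentially. norm (y n - p) \<le> 1 / real (Suc n)"
        using y(2) by (intro always_eventually allI) (auto simp: dist_norm intro: less_imp_le)
      show "(\<lambda>n. 1 / real (Suc n)) \<longlonglongrightarrow> 0" using LIMSEQ_inverse_real_of_nat by (simp add: inverse_eq_divide)
    qed
    then have "(\<lambda>n. (- s0 / real (Suc n), y n - p)) \<longlonglongrightarrow> (fst (0 :: real \<times> pt2), 0)"
      by (intro tendsto_Pair tendsto_fst[OF harmonic_shift_tendsto[of "- s0"], unfolded fst_conv])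
    then have v: "v \<longlonglongrightarrow> 0" unfolding v_def[abs_def] by (simp add: zero_prod_def)
    have vA: "(1 - s, p) + v n \<in> A (-1)" if s: "0 \<le> s" "s \<le> s0" for s n
    proof -
      define t where "t = s0 / real (Suc n)"
      have t: "0 < t" "t \<le> s0" using s0 harmonic_le[of s0 n] by (auto simp: t_def)
      have "(1 - s, p) + v n = (1 - s - t, y n)" by (simp add: v_def t_def)
      moreover have "f (y n) < 1 - s - t" using \<delta>(2)[OF in_closure[OF y(1)[of n]]] y(2)[of n] s t by force
      ultimately show ?thesis using y(1) s t by (simp add: duct_part_def)
    qed
    have q: "(1, p) \<in> closure (A (-1)) - A (-1)" using outlet_closure[OF p] outlet_not_A by blast
    have lim: "((\<lambda>s. (\<psi> (1 - s, p) - \<psi> (1, p)) / s) \<longlongrightarrow> Gh (-1) (1, p) \<bullet> (-1, 0)) (at_right 0)"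
    proof (rule boundary_curve_derivative[where A = "A (-1)" and \<phi> = \<phi> and c = "\<lambda>s. (1 - s, p)" and c' = "\<lambda>_. (-1, 0)" and G = "grad \<phi>",
          OF A_GDERIV[OF pm1(2)] Gh_lim_boundary[OF pm1(2) q] outlet_not_A \<psi>_A[OF pm1(2)] s0 _ _ _ tendsto_const v vA])
      show "continuous_on {0..s0} (\<lambda>s. (1 - s, p))" by (intro continuous_intros)
      show "((\<lambda>s. (1 - s, p)) has_vector_derivative (-1, 0)) (at s)" for s
        unfolding has_vector_derivative_def by (auto intro!: derivative_eq_intros simp: zero_prod_def)
    qed simp_all
    have low: "w (1, p) \<le> w x" if x: "x \<in> closure (A (-1))" for x
    proof -
      obtain z where z: "\<And>n. z n \<in> A (-1)" "z \<longlonglongrightarrow> x" using x unfolding closure_sequential by blast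
      have "(\<lambda>n. w (z n)) \<longlonglongrightarrow> w x"
        by (rule continuous_on_tendsto_compose[OF w_cont[OF pm1(2)] z(2) x])
          (use z(1) closure_subset[of "A (-1)"] in \<open>auto intro!: always_eventually\<close>)
      then show ?thesis by (rule LIMSEQ_le_const) (use w_lower[OF min z(1)] in blast)
    qed
    have "\<forall>\<^sub>F s in at_right 0. - up \<le> (\<psi> (1 - s, p) - \<psi> (1, p)) / s"
      unfolding eventually_at_right_field
    proof (intro exI[of _ s0] conjI s0 allI impI)
      fix s assume s: "0 < s" "s < s0"
      have "(\<lambda>n. (1 - s, p) + v n) \<longlonglongrightarrow> (1 - s, p) + 0" by (intro tendsto_add tendsto_const v)
      then have "(1 - s, p) \<in> closure (A (-1))"
        unfolding closure_sequential using vA[of s] s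
        by (intro exI[of _ "\<lambda>n. (1 - s, p) + v n"]) (simp only: add_0_right simp_thms less_imp_le)
      from low[OF this] show "- up \<le> (\<psi> (1 - s, p) - \<psi> (1, p)) / s"
        using s by (simp add: w_def pos_le_divide_eq algebra_simps)
    qed
    then have "- up \<le> Gh (-1) (1, p) \<bullet> (-1, 0)"
      by (intro tendsto_lowerbound[OF lim _ trivial_limit_at_right_real]) auto
    then show ?thesis by (simp add: g)
  qed
qed

lemma downstream: "x \<in> A (-1) \<Longrightarrow> grad \<phi> x = Gp"
proof -
  assume x: "x \<in> A (-1)"
  obtain p where min: "\<And>y. y \<in> closure \<Omega> \<Longrightarrow> w (1, p) \<le> w (1, y)"
    using outlet_min by blast
  have "(flux (grad \<phi> x) - (m0, 0)) \<bullet> (grad \<phi> x - Gp) = 0"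
  proof (rule elliptic_test[where \<eta> = "\<lambda>x. w x - w (1, p)" and \<eta>h = "\<lambda>x. w x - w (1, p)"])
    have "GDERIV (\<lambda>x. w x - w (1, p)) x :> (grad \<phi> x - Gp) - 0" if "x \<in> A (-1)" for x
      using w_C1 that unfolding C1_grad_def by (intro GDERIV_diff GDERIV_const) blast
    then show "C1_grad (A (-1)) (\<lambda>x. w x - w (1, p)) (\<lambda>x. grad \<phi> x - Gp)"
      using w_C1 unfolding C1_grad_def by (simp only: diff_zero) blast
    show "((\<lambda>x. w x - w (1, p)) \<longlongrightarrow> w q - w (1, p)) (at q within A (-1))" if "q \<in> closure (A (-1)) - A (-1)" for q
      using that by (intro tendsto_diff w_lim tendsto_const) blast
    fix y assume y: "y \<in> closure \<Omega>"
    define g where "g = Gh (-1) (1, y)"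
    have gn: "norm g = c1" using outlet_state_closure[OF y] by (simp add: g_def)
    \<comment> \<open>With the length of the outlet state fixed, the horizontal mass flux is largest
      for a horizontal state, and then \<open>c1_le_up\<close> bounds it by
      \<open>m0\<close>.\<close>
    have "fst g \<le> c1" using norm_fst_le[of "fst g" "snd g"] gn by (metis abs_le_D1 prod.collapse real_norm_def)
    then have "R (c1\<^sup>2) * fst g \<le> R (c1\<^sup>2) * c1"
      using rho_pos[OF c2_pos_le_cs[of "c1\<^sup>2"]] c1 by (intro mult_left_mono) (auto simp: power_mono less_imp_le)
    also have "\<dots> \<le> m0"
      using mass_flux_strict_mono[of c1 up] c1_le_up c1 u_plus_props by (cases "c1 = up") auto
    finally have "fst (flux g) \<le> m0" by (simp add: flux_def gn)
    then show "0 \<le> (w (1, y) - w (1, p)) * (m0 - fst (flux (Gh (-1) (1, y))))"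
      using min[OF y] by (intro mult_nonneg_nonneg) (auto simp: g_def)
  qed (use bounded_terms(2) mono_term(1) x in blast)+
  then show ?thesis using mono_term(2)[OF x] by blast
qed

section \<open>Form of the solution\<close>

lemma Gh_downstream: "q \<in> closure (A (-1)) - A (-1) \<Longrightarrow> Gh (-1) q = Gp"
proof (rule Gh_eqI[OF pm1(2)])
  show "(grad \<phi> \<longlongrightarrow> Gp) (at q within A (-1))"
    by (rule tendsto_eventually) (use downstream in \<open>simp add: eventually_at_filter\<close>)
qed

lemma c1_eq_up: "c1 = up"
proof -
  obtain y where y: "y \<in> \<Omega>" using ne by blast
  have "(1, y) \<in> closure (A (-1)) - A (-1)" using outlet_closure[OF in_closure[OF y]] outlet_not_A by blast
  then have "Gh (-1) (1, y) = Gp" by (rule Gh_downstream)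
  then show ?thesis using outlet_state[OF y] norm_Gp by simp
qed

text \<open>The states on the two sides are horizontal and different, while their jump is a multiple
  of \<open>(1, - Df y)\<close>.\<close>

lemma Df_eq_0: "y \<in> \<Omega> \<Longrightarrow> Df y = 0"
proof -
  assume y: "y \<in> \<Omega>"
  obtain k where k: "Gh (-1) (f y, y) = Gh 1 (f y, y) - k *\<^sub>R (1, - Df y)" using shock_jump[OF y] by blast
  have "Gh (-1) (f y, y) = Gp" by (rule Gh_downstream[OF shock_curve(1)[OF pm1(2) y]])
  moreover have "Gh 1 (f y, y) = G0" by (rule Gh_upstream) (use shock_curve(1)[OF pm1(1) y] in blast)
  ultimately have "up = um - k" "k *\<^sub>R Df y = 0" using k by auto
  moreover have "up < um" using u_plus_props um by linarith
  ultimately show ?thesis by simp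
qed

lemma solution_form: "\<exists>t. -1 < t \<and> t < 1 \<and> (\<forall>x\<in>cyl \<Omega>. \<phi> x = phi_t um up t x)"
proof -
  obtain y0 where y0: "y0 \<in> \<Omega>" using ne by blast
  define t where "t = f y0"
  have t: "f y = t" if "y \<in> \<Omega>" for y
  proof -
    have "(f has_derivative (\<lambda>h. 0)) (at z)" if "z \<in> \<Omega>" for z
      using GDERIV_f[OF that] Df_eq_0[OF that] unfolding gderiv_def by simp
    then show ?thesis
      unfolding t_def by (rule has_derivative_zero_unique_connected[OF op conn _ \<open>y \<in> \<Omega>\<close> y0])
  qed
  have t1: "-1 < t" "t < 1" using f_range[OF y0] by (auto simp: t_def)
  have "\<phi> x = phi_t um up t x" if x: "x \<in> cyl \<Omega>" for x
  proof -
    obtain x1 y where xy: "x = (x1, y)" by (cases x) auto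
    have y: "y \<in> \<Omega>" and x1: "-1 < x1" "x1 < 1" using x by (auto simp: xy cyl_def)
    have up_t: "\<psi> (r, y) = um * r" if "-1 \<le> r" "r \<le> t" for r using \<psi>_upstream[OF y] t[OF y] that by simp
    show ?thesis
    proof (cases "x1 \<le> t")
      case True
      then show ?thesis using up_t[of x1] x1 \<psi>(2)[OF x] by (auto simp: xy phi_t_def)
    next
      case False
      have "\<psi> (x1, y) - up * x1 = \<psi> (t, y) - up * t"
      proof (rule DERIV_isconst_end[of t x1 "\<lambda>r. \<psi> (r, y) - up * r"])
        show "continuous_on {t..x1} (\<lambda>r. \<psi> (r, y) - up * r)"
          using t[OF y] x1 by (intro continuous_intros \<psi>_line_cont[OF pm1(2) y]) auto
        fix r assume r: "t < r" "r < x1"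
        then have A: "(r, y) \<in> A (-1)" using y x1 t[OF y] by (simp add: duct_part_def)
        show "((\<lambda>r. \<psi> (r, y) - up * r) has_real_derivative 0) (at r)"
          using DERIV_diff[OF DERIV_\<psi>_line[OF pm1(2) A] DERIV_cmult_Id[of up]] downstream[OF A] by simp
      qed (use False in simp)
      then show ?thesis using up_t[of t] t1 \<psi>(2)[OF x] False by (auto simp: xy phi_t_def algebra_simps)
    qed
  qed
  then show ?thesis using t1 by blast
qed

end

section \<open>The explicit solution\<close>

context supersonic_gas
begin

lemma grad_phi_t:
  "fst x < 0 \<Longrightarrow> GDERIV (phi_t um up 0) x :> (um, 0)" "0 < fst x \<Longrightarrow> GDERIV (phi_t um up 0) x :> (up, 0)"
proof -
  have lin: "GDERIV (\<lambda>x. c * fst x) x :> (c, 0)" for c and x :: pt3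
    using GDERIV_mult[OF GDERIV_const[of c] GDERIV_fst] by simp
  have o: "open {x :: pt3. fst x < 0}" "open {x :: pt3. 0 < fst x}"
    by (intro open_Collect_less continuous_intros)+
  show "GDERIV (phi_t um up 0) x :> (um, 0)" if "fst x < 0"
    by (rule GDERIV_transform_open[OF lin o(1)]) (use that in \<open>auto simp: phi_t_def\<close>)
  show "GDERIV (phi_t um up 0) x :> (up, 0)" if "0 < fst x"
    by (rule GDERIV_transform_open[OF lin o(2)]) (use that in \<open>auto simp: phi_t_def\<close>)
qed

text \<open>For existence a single member of the family is enough, with the flat shock in the middle
  of the duct. All one-sided limits are limits of constants.\<close>

lemma phi_t_solution:
  assumes "bounded_domain \<Omega>"
  shows "transonic_shock_solution \<gamma> b0 um up \<Omega> (\<lambda>_. 0) (phi_t um up 0)"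
proof -
  let ?\<phi> = "phi_t um up 0"
  let ?Dm = "Dminus \<Omega> (\<lambda>_. 0)" and ?Dp = "Dplus \<Omega> (\<lambda>_. 0)"
  have op: "open \<Omega>" using assms by (simp add: bounded_domain_def)
  have upum: "up < um" using u_plus_props um by linarith
  have Dm: "?Dm = {x. -1 < fst x \<and> fst x < 0 \<and> snd x \<in> \<Omega>}" by (auto simp: Dminus_def cyl_def)
  have Dp: "?Dp = {x. 0 < fst x \<and> fst x < 1 \<and> snd x \<in> \<Omega>}" by (auto simp: Dplus_def cyl_def)
  have gm: "grad ?\<phi> x = G0" if "fst x < 0" for x using grad_eqI[OF grad_phi_t(1)[OF that]] .
  have gp: "grad ?\<phi> x = (up, 0)" if "0 < fst x" for x using grad_eqI[OF grad_phi_t(2)[OF that]] .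
  have nGp: "norm ((up, 0) :: pt3) = up" using u_plus_props by (simp add: norm_Pair)
  have sm: "side_grad ?\<phi> ?Dm q G0" for q
    unfolding side_grad_def by (rule tendsto_eventually) (simp add: eventually_at_filter Dm gm)
  have sp: "side_grad ?\<phi> ?Dp q (up, 0)" for q
    unfolding side_grad_def by (rule tendsto_eventually) (simp add: eventually_at_filter Dp gp)
  have o: "open {x :: pt3. fst x < 0}" "open {x :: pt3. 0 < fst x}"
    by (intro open_Collect_less continuous_intros)+
  \<comment> \<open>Any function of the gradient is locally constant off the shock; the instances
    \<open>id\<close> and \<open>flux\<close> give the regularity and the equation.\<close>
  have loc: "(F \<circ> grad ?\<phi> has_derivative (\<lambda>h. 0)) (at x)" if "x \<in> ?Dm \<union> ?Dp" for F :: "pt3 \<Rightarrow> pt3" and x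
  proof (cases "fst x < 0")
    case True
    show ?thesis
      by (rule has_derivative_transform_within_open[OF has_derivative_const[of "F G0"] o(1)]) (use True gm in auto)
  next
    case False
    then have "0 < fst x" using that by (auto simp: Dm Dp)
    then show ?thesis
      by (intro has_derivative_transform_within_open[OF has_derivative_const[of "F (up, 0)"] o(2)]) (use gp in auto)
  qed
  have fr: "frechet_derivative (F \<circ> grad ?\<phi>) (at x) = (\<lambda>h. 0)" if "x \<in> ?Dm \<union> ?Dp" for F :: "pt3 \<Rightarrow> pt3" and x
    using frechet_derivative_at[OF loc[OF that]] by simp
  have cl: "fst q \<le> 0" if "q \<in> closure ?Dm" for q
  proof -
    have "closed {x :: pt3. fst x \<le> 0}" by (intro closed_Collect_le continuous_intros)
    then have "closure ?Dm \<subseteq> {x. fst x \<le> 0}" by (intro closure_minimal) (auto simp: Dm)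
    then show ?thesis using that by blast
  qed
  have cl': "0 \<le> fst q" if "q \<in> closure ?Dp" for q
  proof -
    have "closed {x :: pt3. 0 \<le> fst x}" by (intro closed_Collect_le continuous_intros)
    then have "closure ?Dp \<subseteq> {x. 0 \<le> fst x}" by (intro closure_minimal) (auto simp: Dp)
    then show ?thesis using that by blast
  qed
  have 1: "C1_on_closure \<Omega> (\<lambda>_. 0)"
  proof -
    have "(\<lambda>h. (0 :: pt2) \<bullet> h) = (\<lambda>h. 0)" by (simp only: inner_zero_left)
    then show ?thesis
      unfolding C1_on_closure_def
      by (intro exI[of _ "\<lambda>_. 0"] conjI ballI continuous_on_const) (simp only: has_derivative_const)
  qed
  \<comment> \<open>A linear function plus a multiple of \<open>min (fst x) 0\<close>, which makes
    the Lipschitz bound across the shock and the inlet limit immediate.\<close>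
  have form: "?\<phi> x = up * fst x + (um - up) * min (fst x) 0" for x
    by (simp add: phi_t_def min_def algebra_simps)
  have 2: "um-lipschitz_on (cyl \<Omega>) ?\<phi>"
  proof (rule lipschitz_onI)
    fix x y
    have "\<bar>?\<phi> x - ?\<phi> y\<bar> = \<bar>up * (fst x - fst y) + (um - up) * (min (fst x) 0 - min (fst y) 0)\<bar>"
      unfolding form by (simp add: algebra_simps)
    also have "\<dots> \<le> up * \<bar>fst x - fst y\<bar> + (um - up) * \<bar>min (fst x) 0 - min (fst y) 0\<bar>"
      using abs_triangle_ineq[of "up * (fst x - fst y)" "(um - up) * (min (fst x) 0 - min (fst y) 0)"] u_plus_props(1) upum
      by (simp add: abs_mult)
    also have "\<dots> \<le> up * \<bar>fst x - fst y\<bar> + (um - up) * \<bar>fst x - fst y\<bar>"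
      using upum by (intro add_left_mono mult_left_mono) (auto simp: min_def)
    also have "\<dots> = um * \<bar>fst x - fst y\<bar>" by (simp add: algebra_simps)
    also have "\<dots> \<le> um * dist x y"
      using dist_fst_le[of x y] um_pos by (intro mult_left_mono) (auto simp: dist_real_def)
    finally show "dist (?\<phi> x) (?\<phi> y) \<le> um * dist x y" by (simp add: dist_real_def)
  qed (use um_pos in simp)
  have 3: "C2_on (?Dm \<union> ?Dp) ?\<phi>"
    unfolding C2_on_def
  proof (intro conjI ballI)
    fix x assume x: "x \<in> ?Dm \<union> ?Dp"
    then have "fst x < 0 \<or> 0 < fst x" by (auto simp: Dm Dp)
    then show "?\<phi> differentiable at x" using grad_phi_t unfolding gderiv_def differentiable_def by blast
    show "grad ?\<phi> differentiable at x" using loc[OF x, of id] unfolding differentiable_def by auto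
  next
    fix b :: pt3
    have "continuous_on (?Dm \<union> ?Dp) (\<lambda>x. 0 :: pt3)" by simp
    then show "continuous_on (?Dm \<union> ?Dp) (\<lambda>x. frechet_derivative (grad ?\<phi>) (at x) b)"
      by (rule continuous_on_eq) (use fr[of _ id] in simp)
  qed
  have 4: "0 < c2 ((norm (grad ?\<phi> x))\<^sup>2)" if "x \<in> ?Dm \<union> ?Dp" for x
  proof -
    have "norm (grad ?\<phi> x) = um \<or> norm (grad ?\<phi> x) = up"
      using that gm[of x] gp[of x] norm_G0 nGp by (auto simp: Dm Dp simp del: norm_Pair)
    then show ?thesis using c2um c2_pos_le_cs[of "up\<^sup>2"] u_plus_props by (auto simp: power_mono less_imp_le)
  qed
  have 5: "(\<lambda>z. flux (grad ?\<phi> z)) differentiable (at x) \<and> divg (\<lambda>z. flux (grad ?\<phi> z)) x = 0" if "x \<in> ?Dm \<union> ?Dp" for x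
    using loc[OF that, of flux] fr[OF that, of flux] unfolding o_def differentiable_def divg_def by auto
  have 6: "(?\<phi> \<longlongrightarrow> - um) (at q within cyl \<Omega>)" if "q \<in> sigma (-1) \<Omega>" for q
  proof -
    have "(?\<phi> \<longlongrightarrow> up * fst q + (um - up) * min (fst q) 0) (at q within cyl \<Omega>)"
      unfolding form by (intro tendsto_intros)
    moreover have "fst q = -1" using that by (simp add: sigma_def)
    ultimately show ?thesis by simp
  qed
  have g0: "grad (\<lambda>_ :: pt2. 0) y = 0" for y by (rule grad_eqI[OF GDERIV_const])
  have 7: "\<exists>g. side_grad ?\<phi> C q g \<and> fst g = um \<and> 0 \<le> fst g"
    if "q \<in> sigma (-1) \<Omega>" "C \<in> {?Dm, ?Dp}" "q \<in> closure C" for q C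
  proof -
    have "C = ?Dm" using that cl'[of q] by (auto simp: sigma_def)
    then show ?thesis using sm[of q] um_pos by (intro exI[of _ G0]) simp
  qed
  have 8: "\<exists>g. side_grad ?\<phi> C q g \<and> norm g = up \<and> 0 \<le> fst g"
    if "q \<in> sigma 1 \<Omega>" "C \<in> {?Dm, ?Dp}" "q \<in> closure C" for q C
  proof -
    have "C = ?Dp" using that cl[of q] by (auto simp: sigma_def)
    then show ?thesis using sp[of q] nGp u_plus_props(1) by (intro exI[of _ "(up, 0)"]) simp
  qed
  have 9: "\<exists>g. side_grad ?\<phi> C q g \<and> (\<forall>\<nu>. outward_unit_normal \<Omega> (snd q) \<nu> \<longrightarrow> g \<bullet> (0, \<nu>) = 0)"
    if "C \<in> {?Dm, ?Dp}" for q C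
  proof -
    have "G0 \<bullet> (0, \<nu>) = 0" "(up, 0) \<bullet> (0, \<nu>) = 0" for \<nu> :: pt2 by simp_all
    then show ?thesis using that sm[of q] sp[of q] by blast
  qed
  \<comment> \<open>For a flat shock the jump condition is the equation that defines
    \<open>u_plus\<close>.\<close>
  have 10: "\<exists>gm gp. side_grad ?\<phi> ?Dm (0, y) gm \<and> side_grad ?\<phi> ?Dp (0, y) gp \<and>
      R ((norm gp)\<^sup>2) * (gp \<bullet> (1, - grad (\<lambda>_. 0) y)) = R ((norm gm)\<^sup>2) * (gm \<bullet> (1, - grad (\<lambda>_. 0) y)) \<and>
      norm gp < norm gm" for y :: pt2
    using sm[of "(0, y)"] sp[of "(0, y)"] nGp norm_G0 u_plus_props(3) upum
    by (intro exI[of _ G0] exI[of _ "(up, 0)"]) (simp only: inner_Pair, simp)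
  show ?thesis
    unfolding transonic_shock_solution_def Let_def
  proof (intro conjI ballI impI)
    show "\<exists>L. L-lipschitz_on (cyl \<Omega>) ?\<phi>" using 2 by blast
    show "0 < 1 + (\<gamma> - 1) * (b0 - (norm (grad ?\<phi> x))\<^sup>2 / 2)" if "x \<in> ?Dm \<union> ?Dp" for x
      using 4[OF that] by (simp add: c2_def)
    show "cs < norm (grad ?\<phi> x)" if "x \<in> ?Dm" for x
      using that gm[of x] norm_G0 um by (simp only: Dm) simp
    show "norm (grad ?\<phi> x) < cs" if "x \<in> ?Dp" for x
      using that gp[of x] nGp u_plus_props(2) by (simp only: Dp) simp
    show "(\<lambda>z. R ((norm (grad ?\<phi> z))\<^sup>2) *\<^sub>R grad ?\<phi> z) differentiable at x"
      "divg (\<lambda>z. R ((norm (grad ?\<phi> z))\<^sup>2) *\<^sub>R grad ?\<phi> z) x = 0" if "x \<in> ?Dm \<union> ?Dp" for x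
      using 5[OF that] unfolding flux_def by blast+
  qed (fact 1 3 | rule 10 | erule (2) 7 8 | erule 9 | erule 6)+
qed

end

theorem theorem1p1:
  fixes \<Omega> :: "(real \<times> real) set" and \<gamma> b0 um c1 :: real
  assumes "bounded_domain \<Omega>" and "C3_boundary \<Omega>"
    and "\<gamma> \<ge> 1"
    and "\<gamma> > 1 \<longrightarrow> 1 + (\<gamma> - 1) * b0 > 0"
    and "c_star \<gamma> b0 < um"
    and "\<gamma> > 1 \<longrightarrow> um < sqrt (2 * (b0 + 1 / (\<gamma> - 1)))"
    and "0 < c1" and "c1 < c_star \<gamma> b0"
  shows "((\<exists>f \<phi>. transonic_shock_solution \<gamma> b0 um c1 \<Omega> f \<phi>) \<longleftrightarrow> c1 = u_plus \<gamma> b0 um) \<and>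
         (\<forall>f \<phi>. transonic_shock_solution \<gamma> b0 um c1 \<Omega> f \<phi> \<longrightarrow>
            (\<exists>t. -1 < t \<and> t < 1 \<and> (\<forall>x\<in>cyl \<Omega>. \<phi> x = phi_t um (u_plus \<gamma> b0 um) t x)))"
proof -
  interpret gas \<gamma> b0 by unfold_locales (use assms in auto)
  \<comment> \<open>The upper bound on \<open>um\<close> is the speed at which vacuum is reached;
    below it the squared sound speed is positive.\<close>
  have "0 < c2 (um\<^sup>2)"
  proof (cases "\<gamma> = 1")
    case True
    then show ?thesis unfolding c2_def by simp
  next
    case False
    then have g: "0 < \<gamma> - 1" using assms(3) by simp
    have "um < sqrt (2 * (b0 + 1 / (\<gamma> - 1)))" using assms(6) g by simp
    moreover have "0 < um" using assms(5) cs_pos by simp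
    ultimately have "um\<^sup>2 < 2 * (b0 + 1 / (\<gamma> - 1))" by (metis less_eq_real_def real_less_rsqrt real_sqrt_less_iff real_sqrt_abs abs_of_pos)
    then have "(\<gamma> - 1) * (um\<^sup>2 / 2) < (\<gamma> - 1) * (b0 + 1 / (\<gamma> - 1))" using g by (intro mult_strict_left_mono) auto
    then show ?thesis using g by (simp add: c2_def algebra_simps)
  qed
  then interpret supersonic_gas \<gamma> b0 um by unfold_locales (use assms in auto)
  have sol: "shock_solution \<gamma> b0 um \<Omega> c1 f \<phi>" if "transonic_shock_solution \<gamma> b0 um c1 \<Omega> f \<phi>" for f \<phi>
    by unfold_locales (use that assms in auto)
  have "c1 = u_plus \<gamma> b0 um" if "transonic_shock_solution \<gamma> b0 um c1 \<Omega> f \<phi>" for f \<phi>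
    by (rule shock_solution.c1_eq_up[OF sol[OF that]])
  moreover have "\<exists>t. -1 < t \<and> t < 1 \<and> (\<forall>x\<in>cyl \<Omega>. \<phi> x = phi_t um (u_plus \<gamma> b0 um) t x)"
    if "transonic_shock_solution \<gamma> b0 um c1 \<Omega> f \<phi>" for f \<phi>
    by (rule shock_solution.solution_form[OF sol[OF that]])
  moreover have "\<exists>f \<phi>. transonic_shock_solution \<gamma> b0 um c1 \<Omega> f \<phi>" if "c1 = u_plus \<gamma> b0 um"
    unfolding that using phi_t_solution[OF assms(1)] by blast
  ultimately show ?thesis by blast
qed

end
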